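(* For each $k,\ell\ge1$, the following statements are provable in $\mathrm{RCA}^*_0$: (a) $\forall X\,(\mathrm{B}\Sigma_\ell(X)\Rightarrow\mathrm{GPHP}(\Sigma_\ell(X)))$; (b) $(\mathrm{B}\Sigma^0_k\land\neg\mathrm{I}\Sigma^0_k)\Rightarrow\forall X\,\mathrm{GPHP}(\Sigma_\ell(X))$.
   Context: $\mathrm{RCA}^*_0$ is the second-order arithmetic theory with basic axioms, $\Delta^0_0$ induction, $\Sigma^0_1$ collection, $\exp$ (totality of exponentiation), and $\Delta^0_1$ comprehension. $\Sigma_\ell(X)$ formulas are $\Sigma_\ell$ formulas whose only second-order parameter is $X$ (number parameters allowed); $\mathrm{B}\Sigma_\ell(X)$ and $\mathrm{I}\Sigma_\ell(X)$ are collection and induction for $\Sigma_\ell(X)$ formulas; $\mathrm{B}\Sigma^0_k$ means $\forall X\,\mathrm{B}\Sigma_k(X)$ and $\mathrm{I}\Sigma^0_k$ means $\forall X\,\mathrm{I}\Sigma_k(X)$. $\mathrm{GPHP}(\Sigma_\ell(X))$ (generalized pigeonhole principle) is the scheme asserting, for every $\Sigma_\ell(X)$ formula $\varphi(x,y,z)$: for every $a$ there is $b$ such that for no $c$ does $\varphi(\cdot,\cdot,c)$ define an injective multifunction from $b$ into $a$, i.e. \[\forall a\,\exists b\,\forall c\,[\forall x\!<\!b\,\exists y\!<\!a\,\varphi(x,y,c)\Rightarrow\neg\,\forall y\!<\!a\,\exists^{\le1}x\!<\!b\,\varphi(x,y,c)].\] Provability of a scheme means provability of each instance. *)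

theory Defs
  imports Main
begin

section \<open>Two-sorted language of second-order arithmetic\<close>

text \<open>
  Number variables and set variables are two independent families of de Bruijn indices:
  number quantifiers bind number index 0, set quantifiers bind set index 0.
  The only set terms are set variables.
\<close>

datatype tm = Var nat | Zero | One | Add tm tm | Mul tm tm

datatype fm =
    Eq tm tm | Less tm tm | Mem tm nat
  | Bot | Imp fm fm | AllN fm | AllS fm

abbreviation Neg :: "fm \<Rightarrow> fm" where "Neg p \<equiv> Imp p Bot"
abbreviation And :: "fm \<Rightarrow> fm \<Rightarrow> fm" where "And p q \<equiv> Neg (Imp p (Neg q))"
abbreviation Or :: "fm \<Rightarrow> fm \<Rightarrow> fm" where "Or p q \<equiv> Imp (Neg p) q"
abbreviation Iff :: "fm \<Rightarrow> fm \<Rightarrow> fm" where "Iff p q \<equiv> And (Imp p q) (Imp q p)"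
abbreviation ExN :: "fm \<Rightarrow> fm" where "ExN p \<equiv> Neg (AllN (Neg p))"
abbreviation ExS :: "fm \<Rightarrow> fm" where "ExS p \<equiv> Neg (AllS (Neg p))"

primrec Conj :: "fm list \<Rightarrow> fm" where
  "Conj [] = Neg Bot"
| "Conj (p # ps) = And p (Conj ps)"

primrec substt :: "(nat \<Rightarrow> tm) \<Rightarrow> tm \<Rightarrow> tm" where
  "substt \<sigma> (Var i) = \<sigma> i"
| "substt \<sigma> Zero = Zero"
| "substt \<sigma> One = One"
| "substt \<sigma> (Add s t) = Add (substt \<sigma> s) (substt \<sigma> t)"
| "substt \<sigma> (Mul s t) = Mul (substt \<sigma> s) (substt \<sigma> t)"

definition liftt :: "tm \<Rightarrow> tm" where
  "liftt = substt (\<lambda>i. Var (Suc i))"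

text \<open>Simultaneous capture-avoiding substitution of terms for number variables and of set
  variables for set variables.\<close>

primrec substf :: "(nat \<Rightarrow> tm) \<Rightarrow> (nat \<Rightarrow> nat) \<Rightarrow> fm \<Rightarrow> fm" where
  "substf \<sigma> \<rho> (Eq s t) = Eq (substt \<sigma> s) (substt \<sigma> t)"
| "substf \<sigma> \<rho> (Less s t) = Less (substt \<sigma> s) (substt \<sigma> t)"
| "substf \<sigma> \<rho> (Mem t X) = Mem (substt \<sigma> t) (\<rho> X)"
| "substf \<sigma> \<rho> Bot = Bot"
| "substf \<sigma> \<rho> (Imp p q) = Imp (substf \<sigma> \<rho> p) (substf \<sigma> \<rho> q)"
| "substf \<sigma> \<rho> (AllN p) = AllN (substf (case_nat (Var 0) (\<lambda>i. liftt (\<sigma> i))) \<rho> p)"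
| "substf \<sigma> \<rho> (AllS p) = AllS (substf \<sigma> (case_nat 0 (\<lambda>i. Suc (\<rho> i))) p)"

definition liftN :: "fm \<Rightarrow> fm" where "liftN = substf (\<lambda>i. Var (Suc i)) id"
definition liftS :: "fm \<Rightarrow> fm" where "liftS = substf Var Suc"

definition instN :: "tm \<Rightarrow> fm \<Rightarrow> fm" where "instN t = substf (case_nat t Var) id"
definition instS :: "nat \<Rightarrow> fm \<Rightarrow> fm" where "instS Y = substf Var (case_nat Y id)"

text \<open>
  \<open>app p ts m\<close> is \<open>p(ts)\<close>, where number variables \<open>0, \<dots>, length ts - 1\<close> of \<open>p\<close> are its
  displayed arguments and the remaining ones are parameters. The result is meant to be placed
  under \<open>m\<close> number quantifiers, so that the parameters occupy the indices from \<open>m\<close> on.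
\<close>

definition app :: "fm \<Rightarrow> tm list \<Rightarrow> nat \<Rightarrow> fm" where
  "app p ts m =
     substf (\<lambda>i. if i < length ts then ts ! i else Var (i - length ts + m)) id p"

text \<open>Strict upper bounds on the free number (set) variables, and universal closures.\<close>

primrec numbdt :: "tm \<Rightarrow> nat" where
  "numbdt (Var i) = Suc i"
| "numbdt Zero = 0"
| "numbdt One = 0"
| "numbdt (Add s t) = max (numbdt s) (numbdt t)"
| "numbdt (Mul s t) = max (numbdt s) (numbdt t)"

primrec numbd :: "fm \<Rightarrow> nat" where
  "numbd (Eq s t) = max (numbdt s) (numbdt t)"
| "numbd (Less s t) = max (numbdt s) (numbdt t)"
| "numbd (Mem t X) = numbdt t"
| "numbd Bot = 0"
| "numbd (Imp p q) = max (numbd p) (numbd q)"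
| "numbd (AllN p) = numbd p - 1"
| "numbd (AllS p) = numbd p"

primrec setbd :: "fm \<Rightarrow> nat" where
  "setbd (Eq s t) = 0"
| "setbd (Less s t) = 0"
| "setbd (Mem t X) = Suc X"
| "setbd Bot = 0"
| "setbd (Imp p q) = max (setbd p) (setbd q)"
| "setbd (AllN p) = setbd p"
| "setbd (AllS p) = setbd p - 1"

definition clN :: "fm \<Rightarrow> fm" where "clN p = (AllN ^^ numbd p) p"
definition cl :: "fm \<Rightarrow> fm" where "cl p = (AllS ^^ setbd p) (clN p)"


section \<open>Provability\<close>

text \<open>Classical two-sorted natural deduction with number equality. In the generalization rules
  the variable condition is expressed by shifting the hypotheses.\<close>

inductive derives :: "fm set \<Rightarrow> fm \<Rightarrow> bool" (infix \<open>\<turnstile>\<close> 50) where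
  Hyp: "p \<in> \<Gamma> \<Longrightarrow> \<Gamma> \<turnstile> p"
| ImpI: "insert p \<Gamma> \<turnstile> q \<Longrightarrow> \<Gamma> \<turnstile> Imp p q"
| ImpE: "\<Gamma> \<turnstile> Imp p q \<Longrightarrow> \<Gamma> \<turnstile> p \<Longrightarrow> \<Gamma> \<turnstile> q"
| Contr: "insert (Neg p) \<Gamma> \<turnstile> Bot \<Longrightarrow> \<Gamma> \<turnstile> p"
| AllNI: "liftN ` \<Gamma> \<turnstile> p \<Longrightarrow> \<Gamma> \<turnstile> AllN p"
| AllNE: "\<Gamma> \<turnstile> AllN p \<Longrightarrow> \<Gamma> \<turnstile> instN t p"
| AllSI: "liftS ` \<Gamma> \<turnstile> p \<Longrightarrow> \<Gamma> \<turnstile> AllS p"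
| AllSE: "\<Gamma> \<turnstile> AllS p \<Longrightarrow> \<Gamma> \<turnstile> instS Y p"
| EqI: "\<Gamma> \<turnstile> Eq t t"
| EqE: "\<Gamma> \<turnstile> Eq s t \<Longrightarrow> \<Gamma> \<turnstile> instN s p \<Longrightarrow> \<Gamma> \<turnstile> instN t p"


section \<open>Arithmetical hierarchy\<close>

text \<open>\<open>p\<close> lives under the bounded quantifier, \<open>t\<close> outside of it.\<close>

definition ball :: "tm \<Rightarrow> fm \<Rightarrow> fm" where
  "ball t p = AllN (Imp (Less (Var 0) (liftt t)) p)"

definition bex :: "tm \<Rightarrow> fm \<Rightarrow> fm" where
  "bex t p = ExN (And (Less (Var 0) (liftt t)) p)"

text \<open>Set variables of any index may occur free.\<close>

inductive Delta0 :: "fm \<Rightarrow> bool" where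
  "Delta0 (Eq s t)"
| "Delta0 (Less s t)"
| "Delta0 (Mem t X)"
| "Delta0 Bot"
| "Delta0 p \<Longrightarrow> Delta0 q \<Longrightarrow> Delta0 (Imp p q)"
| "Delta0 p \<Longrightarrow> Delta0 (ball t p)"
| "Delta0 p \<Longrightarrow> Delta0 (bex t p)"

text \<open>Alternating, possibly empty, blocks of like quantifiers in front of a bounded formula.\<close>

inductive Sigma :: "nat \<Rightarrow> fm \<Rightarrow> bool" and Pi :: "nat \<Rightarrow> fm \<Rightarrow> bool" where
  "Delta0 p \<Longrightarrow> Sigma 0 p"
| "Pi n p \<Longrightarrow> Sigma (Suc n) p"
| "Sigma (Suc n) p \<Longrightarrow> Sigma (Suc n) (ExN p)"
| "Delta0 p \<Longrightarrow> Pi 0 p"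
| "Sigma n p \<Longrightarrow> Pi (Suc n) p"
| "Pi (Suc n) p \<Longrightarrow> Pi (Suc n) (AllN p)"

text \<open>\<open>\<Sigma>\<^sub>n(X)\<close> formulas, with \<open>X\<close> being set variable 0; number parameters are unrestricted.\<close>

definition SigmaX :: "nat \<Rightarrow> fm set" where
  "SigmaX n = {p. Sigma n p \<and> setbd p \<le> 1}"


section \<open>Axiom schemes\<close>

definition Ind :: "fm \<Rightarrow> fm" where
  "Ind p = Imp (And (app p [Zero] 0) (AllN (Imp p (app p [Add (Var 0) One] 1)))) (AllN p)"

text \<open>\<open>\<forall>a (\<forall>x<a \<exists>y p(x,y) \<longrightarrow> \<exists>b \<forall>x<a \<exists>y<b p(x,y))\<close>\<close>

definition Coll :: "fm \<Rightarrow> fm" where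
  "Coll p = AllN (Imp (ball (Var 0) (ExN (app p [Var 1, Var 0] 3)))
                      (ExN (ball (Var 1) (bex (Var 1) (app p [Var 1, Var 0] 4)))))"

definition Comp :: "fm \<Rightarrow> fm \<Rightarrow> fm" where
  "Comp p q = Imp (AllN (Iff p q)) (ExS (AllN (Iff (Mem (Var 0) 0) (liftS p))))"

text \<open>
  \<open>\<forall>a \<exists>b \<forall>c (\<forall>x<b \<exists>y<a p(x,y,c) \<longrightarrow>
     \<not> (\<forall>y<a \<forall>x<b \<forall>x'<b (p(x,y,c) \<and> p(x',y,c) \<longrightarrow> x = x')))\<close>
\<close>

definition GPHP :: "fm \<Rightarrow> fm" where
  "GPHP p = AllN (ExN (AllN (Imp
     (ball (Var 1) (bex (Var 3) (app p [Var 1, Var 0, Var 2] 5)))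
     (Neg (ball (Var 2) (ball (Var 2) (ball (Var 3)
        (Imp (And (app p [Var 1, Var 2, Var 3] 6) (app p [Var 0, Var 2, Var 3] 6))
             (Eq (Var 1) (Var 0))))))))))"

text \<open>Instances of the schemes with number parameters universally quantified; the set parameter
  \<open>X\<close> remains free as set variable 0. Prefixing an instance by \<open>AllS\<close> quantifies over \<open>X\<close>.\<close>

definition ISigma :: "nat \<Rightarrow> fm set" where
  "ISigma n = {clN (Ind p) | p. p \<in> SigmaX n}"

definition BSigma :: "nat \<Rightarrow> fm set" where
  "BSigma n = {clN (Coll p) | p. p \<in> SigmaX n}"

definition GPHPSigma :: "nat \<Rightarrow> fm set" where
  "GPHPSigma n = {clN (GPHP p) | p. p \<in> SigmaX n}"


section \<open>The theory \<open>RCA\<^sup>*\<^sub>0\<close>\<close>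

definition basic_axioms :: "fm set" where
  "basic_axioms = {
     Neg (Eq (Add (Var 0) One) Zero),
     Imp (Eq (Add (Var 0) One) (Add (Var 1) One)) (Eq (Var 0) (Var 1)),
     Eq (Add (Var 0) Zero) (Var 0),
     Eq (Add (Var 0) (Add (Var 1) One)) (Add (Add (Var 0) (Var 1)) One),
     Eq (Mul (Var 0) Zero) Zero,
     Eq (Mul (Var 0) (Add (Var 1) One)) (Add (Mul (Var 0) (Var 1)) (Var 0)),
     Neg (Less (Var 0) Zero),
     Iff (Less (Var 0) (Add (Var 1) One)) (Or (Less (Var 0) (Var 1)) (Eq (Var 0) (Var 1)))}"

text \<open>Goedel's beta function: \<open>r\<close> is the remainder of \<open>c\<close> modulo \<open>(i + 1) d + 1\<close>.\<close>

definition beta :: "tm \<Rightarrow> tm \<Rightarrow> tm \<Rightarrow> tm \<Rightarrow> fm" where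
  "beta c d i r = (let m = Add (Mul (Add i One) d) One in
     And (Less r m)
         (bex (Add c One) (Eq (liftt c) (Add (Mul (Var 0) (liftt m)) (liftt r)))))"

text \<open>
  Totality of exponentiation: for all \<open>m, n\<close> there is \<open>y = m\<^sup>n\<close>, witnessed by a sequence (given
  by \<open>c, d\<close> via beta) \<open>1, m, m\<^sup>2, \<dots>, m\<^sup>n = y\<close>. Indices: \<open>d = 0, c = 1, y = 2, n = 3, m = 4\<close>;
  under the bounded quantifiers \<open>u = 0, i = 1\<close> and the rest is shifted by 2.
\<close>

definition exp_total :: fm where
  "exp_total = AllN (AllN (ExN (ExN (ExN
     (And (beta (Var 1) (Var 0) Zero One)
     (And (ball (Var 3) (bex (Add (Var 2) One)
             (And (beta (Var 3) (Var 2) (Var 1) (Var 0))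
                  (beta (Var 3) (Var 2) (Add (Var 1) One) (Mul (Var 6) (Var 0))))))
          (beta (Var 1) (Var 0) (Var 3) (Var 2))))))))"

definition RCA0star :: "fm set" where
  "RCA0star = cl ` basic_axioms
     \<union> {exp_total}
     \<union> {cl (Ind p) | p. Delta0 p}
     \<union> {cl (Coll p) | p. Sigma 1 p}
     \<union> {cl (Comp p q) | p q. Sigma 1 p \<and> Pi 1 q}"

end

theory Submission
  imports Defs "HOL-Library.Countable_Set" "HOL-Library.Nat_Bijection"
begin

text \<open>
  By completeness it suffices to argue in a model of \<open>RCA\<^sup>*\<^sub>0\<close>. Under \<open>B\<Sigma>\<^sub>k\<close> the relations that
  are both \<open>\<Sigma>\<^sub>k\<close> and \<open>\<Pi>\<^sub>k\<close> satisfy induction, their bounded restrictions are coded by numbers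
  below a power of two, and hence they satisfy the pigeonhole principle. For (a), take \<open>b = a + 1\<close>;
  collection bounds the witnesses of \<open>\<phi>\<close>, so the multifunction restricted to these witnesses is
  such a relation.

  For (b), failure of \<open>I\<Sigma>\<^sub>k\<close> gives a proper cut \<open>I\<close> with a cofinal map \<open>i \<mapsto> a\<^sub>i\<close> from \<open>I\<close>.
  By collection, every definable family of truth values on \<open>n < N\<close>, \<open>i \<in> I\<close> is the trace on \<open>I\<close> of
  a coded set. Using this together with overspill, one shows by induction on an arithmetical formula
  that its truth at a tuple depends only on a coded type \<open>{(i, t) | i \<in> I, t < E}\<close> of the tuple:
  the type for \<open>\<forall>z\<close> records which initial parts of types are realized by some \<open>z < a\<^sub>i\<close>. As \<open>E\<close>
  is the same for all tuples, the number of types of \<open>x\<close> over all \<open>y < a\<close> is bounded by some \<open>T\<close>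
  that does not depend on the parameter \<open>c\<close>. With \<open>b = T + 1\<close> two different \<open>x, x' < b\<close> have
  the same type, so they are related to the same \<open>y < a\<close>.
\<close>

section \<open>Substitution\<close>

text \<open>In (b) the level l may exceed k, so neither induction nor collection is available for
  phi, and no counting argument can be applied to phi itself. All counting is done on codes of
  types, which are Delta objects at a level where collection holds; phi enters only through the
  statement that tuples of equal type are equivalent. Exponentiation is what provides enough codes:
  the number of types is bounded by a power of two. The failure of induction helps because a
  relation with no code may still have the same trace on the cut as a coded one. Passing to models
  requires a completeness proof for this particular calculus. In return, definability becomes a
  property of relations on environments, with closure rules in place of transformations of formulas,
  and the finiteness of derivations gives back the finite list of collection instances that the
  theorem asks for.\<close>

lemma substt_cong: "(\<And>i. i < numbdt t \<Longrightarrow> \<sigma> i = \<tau> i) \<Longrightarrow> substt \<sigma> t = substt \<tau> t"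
  by (induction t) auto

lemma substf_cong:
  "(\<And>i. i < numbd p \<Longrightarrow> \<sigma> i = \<tau> i) \<Longrightarrow> (\<And>i. i < setbd p \<Longrightarrow> \<rho> i = \<rho>' i) \<Longrightarrow>
   substf \<sigma> \<rho> p = substf \<tau> \<rho>' p"
proof (induction p arbitrary: \<sigma> \<tau> \<rho> \<rho>')
  case (Imp p q)
  have "substf \<sigma> \<rho> p = substf \<tau> \<rho>' p" "substf \<sigma> \<rho> q = substf \<tau> \<rho>' q"
    using Imp.prems by (auto intro!: Imp.IH)
  then show ?case by simp
next
  case (AllN p)
  have "substf (case_nat (Var 0) (\<lambda>i. liftt (\<sigma> i))) \<rho> p = substf (case_nat (Var 0) (\<lambda>i. liftt (\<tau> i))) \<rho>' p"
    using AllN.prems by (intro AllN.IH) (auto split: nat.split)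
  then show ?case by simp
next
  case (AllS p)
  have "substf \<sigma> (case_nat 0 (\<lambda>i. Suc (\<rho> i))) p = substf \<tau> (case_nat 0 (\<lambda>i. Suc (\<rho>' i))) p"
    using AllS.prems by (intro AllS.IH) (auto split: nat.split)
  then show ?case by simp
qed (auto intro: substt_cong)

lemma substt_substt: "substt \<sigma> (substt \<tau> t) = substt (\<lambda>i. substt \<sigma> (\<tau> i)) t"
  by (induction t) auto

lemma substt_liftt: "substt (case_nat u (\<lambda>i. liftt (\<sigma> i))) (liftt t) = liftt (substt \<sigma> t)"
  by (simp add: liftt_def substt_substt)

lemma substt_case_liftt: "substt (case_nat u \<sigma>) (liftt t) = substt \<sigma> t"
  by (simp add: liftt_def substt_substt)

lemma substf_substf: "substf \<sigma> \<rho> (substf \<sigma>' \<rho>' p) = substf (\<lambda>i. substt \<sigma> (\<sigma>' i)) (\<rho> \<circ> \<rho>') p"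
proof (induction p arbitrary: \<sigma> \<sigma>' \<rho> \<rho>')
  case (AllN p)
  show ?case
    by (auto simp: AllN.IH substt_liftt intro!: substf_cong split: nat.split)
next
  case (AllS p)
  show ?case
    by (auto simp: AllS.IH intro!: substf_cong split: nat.split)
qed (auto simp: substt_substt)

lemma substt_Var [simp]: "substt Var t = t"
  by (induction t) auto

lemma substf_Var [simp]: "substf Var id p = p"
proof (induction p)
  case (AllN p)
  have "case_nat (Var 0) (\<lambda>i. liftt (Var i)) = Var"
    by (auto simp: liftt_def split: nat.split)
  with AllN show ?case by simp
next
  case (AllS p)
  have "case_nat 0 (\<lambda>i. Suc (id i)) = id"
    by (auto split: nat.split)
  with AllS show ?case by (simp only: substf.simps)
qed auto

lemma substf_liftN:
  "substf (case_nat (Var 0) (\<lambda>i. liftt (\<sigma> i))) \<rho> (liftN p) = liftN (substf \<sigma> \<rho> p)"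
  by (simp add: liftN_def substf_substf liftt_def)

lemma substf_liftS:
  "substf \<sigma> (case_nat 0 (\<lambda>i. Suc (\<rho> i))) (liftS p) = liftS (substf \<sigma> \<rho> p)"
  by (auto simp: liftS_def substf_substf intro!: substf_cong)

lemma substf_instN:
  "substf \<sigma> \<rho> (instN t p) =
   instN (substt \<sigma> t) (substf (case_nat (Var 0) (\<lambda>i. liftt (\<sigma> i))) \<rho> p)"
  by (auto simp: instN_def substf_substf substt_case_liftt intro!: substf_cong split: nat.split)

lemma substf_instS:
  "substf \<sigma> \<rho> (instS Y p) = instS (\<rho> Y) (substf \<sigma> (case_nat 0 (\<lambda>i. Suc (\<rho> i))) p)"
  by (auto simp: instS_def substf_substf intro!: substf_cong split: nat.split)

lemma instN_substf_up:
  "instN t (substf (case_nat (Var 0) (\<lambda>i. liftt (\<sigma> i))) \<rho> p) = substf (case_nat t \<sigma>) \<rho> p"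
  by (auto simp: instN_def substf_substf substt_case_liftt intro!: substf_cong split: nat.split)

lemma instS_substf_up:
  "instS Y (substf \<sigma> (case_nat 0 (\<lambda>i. Suc (\<rho> i))) p) = substf \<sigma> (case_nat Y \<rho>) p"
  by (auto simp: instS_def substf_substf intro!: substf_cong split: nat.split)


section \<open>Completeness of the calculus\<close>

lemma derives_mono: "\<Gamma> \<turnstile> p \<Longrightarrow> \<Gamma> \<subseteq> \<Delta> \<Longrightarrow> \<Delta> \<turnstile> p"
proof (induction arbitrary: \<Delta> rule: derives.induct)
  case (Hyp p \<Gamma>)
  show ?case by (rule derives.Hyp, use Hyp in blast)
next
  case (ImpI p \<Gamma> q)
  show ?case by (rule derives.ImpI, rule ImpI.IH, rule insert_mono, rule ImpI.prems)
next
  case (ImpE \<Gamma> p q)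
  show ?case by (rule derives.ImpE[of _ p q]; (fact ImpE.IH(1)[OF ImpE.prems] | fact ImpE.IH(2)[OF ImpE.prems]))
next
  case (Contr p \<Gamma>)
  show ?case by (rule derives.Contr, rule Contr.IH, rule insert_mono, rule Contr.prems)
next
  case (AllNI \<Gamma> p)
  show ?case by (rule derives.AllNI, rule AllNI.IH, rule image_mono, rule AllNI.prems)
next
  case (AllNE \<Gamma> p t)
  show ?case by (rule derives.AllNE, rule AllNE.IH, rule AllNE.prems)
next
  case (AllSI \<Gamma> p)
  show ?case by (rule derives.AllSI, rule AllSI.IH, rule image_mono, rule AllSI.prems)
next
  case (AllSE \<Gamma> p Y)
  show ?case by (rule derives.AllSE, rule AllSE.IH, rule AllSE.prems)
next
  case (EqI \<Gamma> t)
  show ?case by (rule derives.EqI)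
next
  case (EqE \<Gamma> s t p)
  show ?case by (rule derives.EqE[of _ s t p]; (fact EqE.IH(1)[OF EqE.prems] | fact EqE.IH(2)[OF EqE.prems]))
qed

lemma derives_substf: "\<Gamma> \<turnstile> p \<Longrightarrow> substf \<sigma> \<rho> ` \<Gamma> \<turnstile> substf \<sigma> \<rho> p"
proof (induction arbitrary: \<sigma> \<rho> rule: derives.induct)
  case (AllNI \<Gamma> p)
  have "liftN ` substf \<sigma> \<rho> ` \<Gamma> = substf (case_nat (Var 0) (\<lambda>i. liftt (\<sigma> i))) \<rho> ` liftN ` \<Gamma>"
    by (simp add: image_image substf_liftN)
  with AllNI.IH show ?case by (simp add: derives.AllNI)
next
  case (AllSI \<Gamma> p)
  have "liftS ` substf \<sigma> \<rho> ` \<Gamma> = substf \<sigma> (case_nat 0 (\<lambda>i. Suc (\<rho> i))) ` liftS ` \<Gamma>"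
    by (simp add: image_image substf_liftS)
  with AllSI.IH show ?case by (simp add: derives.AllSI)
next
  case (AllNE \<Gamma> p t)
  then show ?case by (simp add: substf_instN derives.AllNE)
next
  case (AllSE \<Gamma> p t)
  then show ?case by (simp add: substf_instS derives.AllSE)
next
  case (EqE \<Gamma> s t p)
  then show ?case unfolding substf_instN by (metis derives.EqE substf.simps(1))
next
  case (Contr p \<Gamma>)
  have "substf \<sigma> \<rho> ` insert (Neg p) \<Gamma> \<turnstile> substf \<sigma> \<rho> Bot" by (rule Contr.IH)
  then show ?case by - (rule derives.Contr, simp)
next
  case (ImpI p \<Gamma> q)
  have "substf \<sigma> \<rho> ` insert p \<Gamma> \<turnstile> substf \<sigma> \<rho> q" by (rule ImpI.IH)
  then show ?case by (simp add: derives.ImpI)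
next
  case (ImpE \<Gamma> p q)
  have "substf \<sigma> \<rho> ` \<Gamma> \<turnstile> Imp (substf \<sigma> \<rho> p) (substf \<sigma> \<rho> q)"
    using ImpE.IH(1) by simp
  then show ?case using ImpE.IH(2) by (rule derives.ImpE)
qed (simp_all add: derives.Hyp derives.EqI)

lemma derives_finite: "\<Gamma> \<turnstile> p \<Longrightarrow> \<exists>\<Delta>\<subseteq>\<Gamma>. finite \<Delta> \<and> \<Delta> \<turnstile> p"
proof (induction rule: derives.induct)
  case (Hyp p \<Gamma>)
  have "{p} \<turnstile> p" by (rule derives.Hyp) simp
  then show ?case using Hyp by (intro exI[of _ "{p}"]) simp
next
  case (ImpI p \<Gamma> q)
  then obtain \<Delta> where \<Delta>: "\<Delta> \<subseteq> insert p \<Gamma>" "finite \<Delta>" "\<Delta> \<turnstile> q" by blast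
  have "insert p (\<Delta> - {p}) \<turnstile> q" by (rule derives_mono[OF \<Delta>(3)]) blast
  then have "\<Delta> - {p} \<turnstile> Imp p q" by (rule derives.ImpI)
  then show ?case using \<Delta> by (intro exI[of _ "\<Delta> - {p}"]) auto
next
  case (ImpE \<Gamma> p q)
  then obtain \<Delta> \<Delta>' where \<Delta>: "\<Delta> \<subseteq> \<Gamma>" "finite \<Delta>" "\<Delta> \<turnstile> Imp p q" "\<Delta>' \<subseteq> \<Gamma>" "finite \<Delta>'" "\<Delta>' \<turnstile> p"
    by blast
  have "\<Delta> \<union> \<Delta>' \<turnstile> Imp p q" "\<Delta> \<union> \<Delta>' \<turnstile> p"
    using derives_mono[OF \<Delta>(3), of "\<Delta> \<union> \<Delta>'"] derives_mono[OF \<Delta>(6), of "\<Delta> \<union> \<Delta>'"] by auto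
  then have "\<Delta> \<union> \<Delta>' \<turnstile> q" by (rule derives.ImpE)
  then show ?case using \<Delta> by (intro exI[of _ "\<Delta> \<union> \<Delta>'"]) auto
next
  case (Contr p \<Gamma>)
  then obtain \<Delta> where \<Delta>: "\<Delta> \<subseteq> insert (Neg p) \<Gamma>" "finite \<Delta>" "\<Delta> \<turnstile> Bot" by blast
  have "insert (Neg p) (\<Delta> - {Neg p}) \<turnstile> Bot" by (rule derives_mono[OF \<Delta>(3)]) blast
  then have "\<Delta> - {Neg p} \<turnstile> p" by (rule derives.Contr)
  then show ?case using \<Delta> by (intro exI[of _ "\<Delta> - {Neg p}"]) auto
next
  case (AllNI \<Gamma> p)
  then obtain \<Delta> where \<Delta>: "\<Delta> \<subseteq> \<Gamma>" "finite \<Delta>" "liftN ` \<Delta> \<turnstile> p"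
    by (metis finite_subset_image)
  from \<Delta>(3) have "\<Delta> \<turnstile> AllN p" by (rule derives.AllNI)
  then show ?case using \<Delta> by (intro exI[of _ \<Delta>]) simp
next
  case (AllSI \<Gamma> p)
  then obtain \<Delta> where \<Delta>: "\<Delta> \<subseteq> \<Gamma>" "finite \<Delta>" "liftS ` \<Delta> \<turnstile> p"
    by (metis finite_subset_image)
  from \<Delta>(3) have "\<Delta> \<turnstile> AllS p" by (rule derives.AllSI)
  then show ?case using \<Delta> by (intro exI[of _ \<Delta>]) simp
next
  case (EqI \<Gamma> t)
  have "{} \<turnstile> Eq t t" by (rule derives.EqI)
  then show ?case by (intro exI[of _ "{}"]) simp
next
  case (EqE \<Gamma> s t p)
  then obtain \<Delta> \<Delta>' where \<Delta>: "\<Delta> \<subseteq> \<Gamma>" "finite \<Delta>" "\<Delta> \<turnstile> Eq s t" "\<Delta>' \<subseteq> \<Gamma>" "finite \<Delta>'" "\<Delta>' \<turnstile> instN s p"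
    by blast
  have "\<Delta> \<union> \<Delta>' \<turnstile> Eq s t" "\<Delta> \<union> \<Delta>' \<turnstile> instN s p"
    using derives_mono[OF \<Delta>(3), of "\<Delta> \<union> \<Delta>'"] derives_mono[OF \<Delta>(6), of "\<Delta> \<union> \<Delta>'"] by auto
  then have "\<Delta> \<union> \<Delta>' \<turnstile> instN t p" by (rule derives.EqE)
  then show ?case using \<Delta> by (intro exI[of _ "\<Delta> \<union> \<Delta>'"]) auto
next
  case (AllNE \<Gamma> p t)
  then obtain \<Delta> where \<Delta>: "\<Delta> \<subseteq> \<Gamma>" "finite \<Delta>" "\<Delta> \<turnstile> AllN p" by blast
  from \<Delta>(3) have "\<Delta> \<turnstile> instN t p" by (rule derives.AllNE)
  then show ?case using \<Delta> by (intro exI[of _ \<Delta>]) simp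
next
  case (AllSE \<Gamma> p Y)
  then obtain \<Delta> where \<Delta>: "\<Delta> \<subseteq> \<Gamma>" "finite \<Delta>" "\<Delta> \<turnstile> AllS p" by blast
  from \<Delta>(3) have "\<Delta> \<turnstile> instS Y p" by (rule derives.AllSE)
  then show ?case using \<Delta> by (intro exI[of _ \<Delta>]) simp
qed

lemma derives_cut: "\<Gamma> \<turnstile> p \<Longrightarrow> insert p \<Gamma> \<turnstile> q \<Longrightarrow> \<Gamma> \<turnstile> q"
  by (metis ImpE ImpI)

text \<open>The renaming that sends \<open>n\<close> to 0 and every other index to its successor
  acts on the hypotheses as the shift, because none of them contains \<open>n\<close>, and it turns
  the instance back into \<open>p\<close>. So an instance at a fresh variable is enough for the rule
  \<open>AllNI\<close>.\<close>

lemma derives_AllN_fresh: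
  assumes "\<Gamma> \<turnstile> instN (Var n) p" and "\<And>q. q \<in> \<Gamma> \<Longrightarrow> numbd q \<le> n" and "numbd p \<le> Suc n"
  shows "\<Gamma> \<turnstile> AllN p"
proof -
  define \<sigma> where "\<sigma> = (\<lambda>i. if i = n then Var 0 else Var (Suc i))"
  have "substf \<sigma> id ` \<Gamma> \<turnstile> substf \<sigma> id (instN (Var n) p)"
    using assms(1) by (rule derives_substf)
  moreover have "substf \<sigma> id ` \<Gamma> = liftN ` \<Gamma>"
    unfolding liftN_def using assms(2) by (intro image_cong substf_cong) (force simp: \<sigma>_def)+
  moreover have "substf \<sigma> id (instN (Var n) p) = substf Var id p"
    unfolding instN_def substf_substf using assms(3)
    by (intro substf_cong) (auto simp: \<sigma>_def split: nat.split)
  ultimately show ?thesis by (simp add: AllNI)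
qed

lemma derives_AllS_fresh:
  assumes "\<Gamma> \<turnstile> instS n p" and "\<And>q. q \<in> \<Gamma> \<Longrightarrow> setbd q \<le> n" and "setbd p \<le> Suc n"
  shows "\<Gamma> \<turnstile> AllS p"
proof -
  define \<rho> where "\<rho> = (\<lambda>i. if i = n then 0 else Suc i)"
  have "substf Var \<rho> ` \<Gamma> \<turnstile> substf Var \<rho> (instS n p)"
    using assms(1) by (rule derives_substf)
  moreover have "substf Var \<rho> ` \<Gamma> = liftS ` \<Gamma>"
    unfolding liftS_def using assms(2) by (intro image_cong substf_cong) (force simp: \<rho>_def)+
  moreover have "substf Var \<rho> (instS n p) = substf Var id p"
    unfolding instS_def substf_substf using assms(3)
    by (intro substf_cong) (auto simp: \<rho>_def split: nat.split)
  ultimately show ?thesis by (simp add: AllSI)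
qed

section \<open>Henkin extensions of consistent sets\<close>

instance tm :: countable by countable_datatype
instance fm :: countable by countable_datatype

definition fresh :: "nat \<Rightarrow> fm set \<Rightarrow> bool" where
  "fresh n \<Gamma> \<longleftrightarrow> (\<forall>p\<in>\<Gamma>. numbd p \<le> n \<and> setbd p \<le> n)"

text \<open>The index \<open>n\<close> serves as the fresh number or set variable. All other
  formulas return themselves, so that adding the result to a set that contains them changes
  nothing.\<close>

fun witness :: "nat \<Rightarrow> fm \<Rightarrow> fm" where
  "witness n (Imp (AllN p) Bot) = Neg (instN (Var n) p)"
| "witness n (Imp (AllS p) Bot) = Neg (instS n p)"
| "witness n p = p"

lemma witness_consistent:
  assumes "p \<in> \<Gamma>" "fresh n \<Gamma>" "\<not> \<Gamma> \<turnstile> Bot"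
  shows "\<not> insert (witness n p) \<Gamma> \<turnstile> Bot"
proof
  assume *: "insert (witness n p) \<Gamma> \<turnstile> Bot"
  have "\<Gamma> \<turnstile> Bot"
  proof (cases "(n, p)" rule: witness.cases)
    case (1 m q)
    then have "\<Gamma> \<turnstile> instN (Var n) q" using * by - (rule Contr, simp)
    moreover have "numbd q \<le> Suc n" using assms(1,2) 1 by (force simp: fresh_def)
    ultimately have "\<Gamma> \<turnstile> AllN q"
      using assms(2) by (intro derives_AllN_fresh) (auto simp: fresh_def)
    moreover have "\<Gamma> \<turnstile> Neg (AllN q)" using assms(1) 1 by (intro Hyp) simp
    ultimately show ?thesis by (metis ImpE)
  next
    case (2 m q)
    then have "\<Gamma> \<turnstile> instS n q" using * by - (rule Contr, simp)
    moreover have "setbd q \<le> Suc n" using assms(1,2) 2 by (force simp: fresh_def)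
    ultimately have "\<Gamma> \<turnstile> AllS q"
      using assms(2) by (intro derives_AllS_fresh) (auto simp: fresh_def)
    moreover have "\<Gamma> \<turnstile> Neg (AllS q)" using assms(1) 2 by (intro Hyp) simp
    ultimately show ?thesis by (metis ImpE)
  qed (use * assms(1) in \<open>auto simp: insert_absorb\<close>)
  with assms(3) show False by contradiction
qed

primrec henkin_chain :: "fm set \<Rightarrow> nat \<Rightarrow> fm set" where
  "henkin_chain \<Gamma> 0 = \<Gamma>"
| "henkin_chain \<Gamma> (Suc n) =
    (let \<Delta> = insert (from_nat n) (henkin_chain \<Gamma> n)
     in if \<Delta> \<turnstile> Bot then henkin_chain \<Gamma> n else insert (witness (LEAST m. fresh m \<Delta>) (from_nat n)) \<Delta>)"

definition henkin :: "fm set \<Rightarrow> fm set" where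
  "henkin \<Gamma> = (\<Union>n. henkin_chain \<Gamma> n)"

lemma fresh_insert: "fresh n \<Gamma> \<Longrightarrow> fresh (max n (max (numbd p) (setbd p))) (insert p \<Gamma>)"
  by (force simp: fresh_def)

lemma henkin_chain_fresh: "fresh m \<Gamma> \<Longrightarrow> \<exists>m. fresh m (henkin_chain \<Gamma> n)"
proof (induction n)
  case (Suc n)
  then obtain k where "fresh k (henkin_chain \<Gamma> n)" by blast
  then show ?case using fresh_insert by (simp add: Let_def) metis
qed auto

lemma henkin_chain_consistent:
  assumes "fresh m \<Gamma>" "\<not> \<Gamma> \<turnstile> Bot"
  shows "\<not> henkin_chain \<Gamma> n \<turnstile> Bot"
proof (induction n)
  case (Suc n)
  show ?case
  proof (cases "insert (from_nat n) (henkin_chain \<Gamma> n) \<turnstile> Bot")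
    case False
    have "\<exists>m. fresh m (insert (from_nat n) (henkin_chain \<Gamma> n))"
      using henkin_chain_fresh[OF assms(1)] fresh_insert by blast
    then have "fresh (LEAST m. fresh m (insert (from_nat n) (henkin_chain \<Gamma> n)))
        (insert (from_nat n) (henkin_chain \<Gamma> n))"
      by (rule LeastI_ex)
    with False show ?thesis by (simp add: Let_def witness_consistent)
  qed (use Suc in simp)
qed (use assms in simp)

lemma henkin_chain_mono: "m \<le> n \<Longrightarrow> henkin_chain \<Gamma> m \<subseteq> henkin_chain \<Gamma> n"
  by (induction rule: dec_induct) (auto simp: Let_def)

lemma finite_subset_henkin:
  assumes "finite \<Delta>" "\<Delta> \<subseteq> henkin \<Gamma>"
  shows "\<exists>n. \<Delta> \<subseteq> henkin_chain \<Gamma> n"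
  using assms
proof (induction rule: finite_induct)
  case (insert p \<Delta>)
  then obtain m n where "\<Delta> \<subseteq> henkin_chain \<Gamma> m" "p \<in> henkin_chain \<Gamma> n" by (auto simp: henkin_def)
  then have "insert p \<Delta> \<subseteq> henkin_chain \<Gamma> (max m n)"
    using henkin_chain_mono[of m "max m n" \<Gamma>] henkin_chain_mono[of n "max m n" \<Gamma>] by auto
  then show ?case ..
qed auto

locale henkin_set =
  fixes H :: "fm set"
  assumes consistent: "\<not> H \<turnstile> Bot"
    and maximal: "\<not> insert p H \<turnstile> Bot \<Longrightarrow> p \<in> H"
    and witness_AllN: "Neg (AllN p) \<in> H \<Longrightarrow> \<exists>t. Neg (instN t p) \<in> H"
    and witness_AllS: "Neg (AllS p) \<in> H \<Longrightarrow> \<exists>Y. Neg (instS Y p) \<in> H"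

lemma henkin_set_henkin:
  assumes "fresh m \<Gamma>" "\<not> \<Gamma> \<turnstile> Bot"
  shows "henkin_set (henkin \<Gamma>)"
proof -
  have con: "\<not> henkin \<Gamma> \<turnstile> Bot"
  proof
    assume "henkin \<Gamma> \<turnstile> Bot"
    then obtain \<Delta> where \<Delta>: "\<Delta> \<subseteq> henkin \<Gamma>" "finite \<Delta>" "\<Delta> \<turnstile> Bot"
      using derives_finite by blast
    then obtain n where "\<Delta> \<subseteq> henkin_chain \<Gamma> n" using finite_subset_henkin by blast
    with \<Delta>(3) show False using henkin_chain_consistent[OF assms] derives_mono by blast
  qed
  \<comment> \<open>A formula consistent with the limit is in particular consistent with the stage
    at which the enumeration reaches it, so it is accepted there together with a witness.\<close>
  have step: "p \<in> henkin_chain \<Gamma> (Suc (to_nat p)) \<and> (\<exists>m. witness m p \<in> henkin_chain \<Gamma> (Suc (to_nat p)))"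
    if "\<not> insert p (henkin \<Gamma>) \<turnstile> Bot" for p
  proof -
    have "\<not> insert p (henkin_chain \<Gamma> (to_nat p)) \<turnstile> Bot"
    proof
      assume "insert p (henkin_chain \<Gamma> (to_nat p)) \<turnstile> Bot"
      moreover have "insert p (henkin_chain \<Gamma> (to_nat p)) \<subseteq> insert p (henkin \<Gamma>)"
        by (auto simp: henkin_def)
      ultimately show False using that derives_mono by blast
    qed
    then show ?thesis unfolding henkin_chain.simps Let_def from_nat_to_nat by (simp only: if_False) blast
  qed
  have wit: "\<exists>m. witness m p \<in> henkin \<Gamma>" if "p \<in> henkin \<Gamma>" for p
  proof -
    have "insert p (henkin \<Gamma>) = henkin \<Gamma>" using that by blast
    then show ?thesis using step[of p] con unfolding henkin_def by (metis UN_I UNIV_I)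
  qed
  show ?thesis
  proof
    show "p \<in> henkin \<Gamma>" if "\<not> insert p (henkin \<Gamma>) \<turnstile> Bot" for p
      using step[OF that] unfolding henkin_def by blast
    show "\<exists>t. Neg (instN t p) \<in> henkin \<Gamma>" if "Neg (AllN p) \<in> henkin \<Gamma>" for p
      using wit[OF that] by auto
    show "\<exists>Y. Neg (instS Y p) \<in> henkin \<Gamma>" if "Neg (AllS p) \<in> henkin \<Gamma>" for p
      using wit[OF that] by auto
  qed (rule con)
qed

lemma subset_henkin: "\<Gamma> \<subseteq> henkin \<Gamma>"
  using henkin_def[of \<Gamma>] henkin_chain.simps(1) by blast

section \<open>Truth conditions and equality in a maximal Henkin set\<close>

context henkin_set
begin

lemma closed: "H \<turnstile> p \<Longrightarrow> p \<in> H"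
  by (metis maximal consistent derives_cut)

lemma Bot_notin: "Bot \<notin> H"
  by (metis consistent Hyp)

lemma Imp_iff: "Imp p q \<in> H \<longleftrightarrow> (p \<in> H \<longrightarrow> q \<in> H)"
proof
  assume "Imp p q \<in> H"
  then show "p \<in> H \<longrightarrow> q \<in> H" by (metis closed ImpE Hyp)
next
  assume *: "p \<in> H \<longrightarrow> q \<in> H"
  show "Imp p q \<in> H"
  proof (cases "insert p H \<turnstile> Bot")
    case True
    then have "insert p H \<turnstile> q" by (rule Contr[OF derives_mono]) auto
    then show ?thesis by (metis closed ImpI)
  next
    case False
    then have "q \<in> H" using * maximal by blast
    then show ?thesis by (metis closed ImpI Hyp insertI2)
  qed
qed

lemma AllN_iff: "AllN p \<in> H \<longleftrightarrow> (\<forall>t. instN t p \<in> H)"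
proof
  show "AllN p \<in> H \<Longrightarrow> \<forall>t. instN t p \<in> H" by (metis closed AllNE Hyp)
  show "\<forall>t. instN t p \<in> H \<Longrightarrow> AllN p \<in> H"
    using witness_AllN[of p] Bot_notin by (auto simp: Imp_iff)
qed

lemma AllS_iff: "AllS p \<in> H \<longleftrightarrow> (\<forall>Y. instS Y p \<in> H)"
proof
  show "AllS p \<in> H \<Longrightarrow> \<forall>Y. instS Y p \<in> H" by (metis closed AllSE Hyp)
  show "\<forall>Y. instS Y p \<in> H \<Longrightarrow> AllS p \<in> H"
    using witness_AllS[of p] Bot_notin by (auto simp: Imp_iff)
qed

lemma Eq_refl: "Eq t t \<in> H"
  by (metis closed EqI)

lemma Eq_subst: "Eq s t \<in> H \<Longrightarrow> instN s p \<in> H \<Longrightarrow> instN t p \<in> H"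
  by (metis closed EqE Hyp)

text \<open>Contexts with the hole \<open>Var 0\<close> for the rule \<open>EqE\<close>; the
  remaining terms are lifted so that filling the hole leaves them as they were.\<close>

lemma instN_liftt: "instN t (Eq (liftt s) (Var 0)) = Eq s t" "instN t (Eq (Var 0) (liftt s)) = Eq t s"
    "instN t (Less (liftt s) (Var 0)) = Less s t" "instN t (Less (Var 0) (liftt s)) = Less t s"
    "instN t (Mem (Var 0) X) = Mem t X"
    "instN t (Eq (Add (liftt u) (liftt v)) (Add (Var 0) (liftt v))) = Eq (Add u v) (Add t v)"
    "instN t (Eq (Add (liftt u) (liftt v)) (Add (liftt u) (Var 0))) = Eq (Add u v) (Add u t)"
    "instN t (Eq (Mul (liftt u) (liftt v)) (Mul (Var 0) (liftt v))) = Eq (Mul u v) (Mul t v)"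
    "instN t (Eq (Mul (liftt u) (liftt v)) (Mul (liftt u) (Var 0))) = Eq (Mul u v) (Mul u t)"
  by (simp_all add: instN_def substt_case_liftt)

lemma Eq_sym: "Eq s t \<in> H \<Longrightarrow> Eq t s \<in> H"
  using Eq_subst[of s t "Eq (Var 0) (liftt s)"] Eq_refl by (simp add: instN_liftt)

lemma Eq_trans: "Eq s t \<in> H \<Longrightarrow> Eq t u \<in> H \<Longrightarrow> Eq s u \<in> H"
  using Eq_subst[of t u "Eq (liftt s) (Var 0)"] by (simp add: instN_liftt)

lemma Eq_Add: "Eq s s' \<in> H \<Longrightarrow> Eq t t' \<in> H \<Longrightarrow> Eq (Add s t) (Add s' t') \<in> H"
  using Eq_subst[of s s' "Eq (Add (liftt s) (liftt t)) (Add (Var 0) (liftt t))"]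
    Eq_subst[of t t' "Eq (Add (liftt s') (liftt t)) (Add (liftt s') (Var 0))"] Eq_refl
  by (auto simp: instN_liftt intro: Eq_trans)

lemma Eq_Mul: "Eq s s' \<in> H \<Longrightarrow> Eq t t' \<in> H \<Longrightarrow> Eq (Mul s t) (Mul s' t') \<in> H"
  using Eq_subst[of s s' "Eq (Mul (liftt s) (liftt t)) (Mul (Var 0) (liftt t))"]
    Eq_subst[of t t' "Eq (Mul (liftt s') (liftt t)) (Mul (liftt s') (Var 0))"] Eq_refl
  by (auto simp: instN_liftt intro: Eq_trans)

lemma Eq_Less: "Eq s s' \<in> H \<Longrightarrow> Eq t t' \<in> H \<Longrightarrow> Less s t \<in> H \<Longrightarrow> Less s' t' \<in> H"
  using Eq_subst[of s s' "Less (Var 0) (liftt t)"] Eq_subst[of t t' "Less (liftt s') (Var 0)"]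
  by (auto simp: instN_liftt)

lemma Eq_Mem: "Eq s s' \<in> H \<Longrightarrow> Mem s X \<in> H \<Longrightarrow> Mem s' X \<in> H"
  using Eq_subst[of s s' "Mem (Var 0) X"] by (auto simp: instN_liftt)

end

section \<open>Semantics\<close>

lemma setbd_AllN_funpow [simp]: "setbd ((AllN ^^ n) p) = setbd p"
  by (induction n) auto

text \<open>Sets form a second sort with an arbitrary membership relation, so set quantifiers have
  Henkin semantics; with full power sets there would be no completeness theorem.\<close>

locale two_sorted =
  fixes zero one :: 'a
    and add mul :: "'a \<Rightarrow> 'a \<Rightarrow> 'a"
    and less :: "'a \<Rightarrow> 'a \<Rightarrow> bool"
    and mem :: "'a \<Rightarrow> 's \<Rightarrow> bool"
begin

primrec evt :: "(nat \<Rightarrow> 'a) \<Rightarrow> tm \<Rightarrow> 'a" where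
  "evt e (Var i) = e i"
| "evt e Zero = zero"
| "evt e One = one"
| "evt e (Add s t) = add (evt e s) (evt e t)"
| "evt e (Mul s t) = mul (evt e s) (evt e t)"

primrec ev :: "(nat \<Rightarrow> 'a) \<Rightarrow> (nat \<Rightarrow> 's) \<Rightarrow> fm \<Rightarrow> bool" where
  "ev e s (Eq t u) \<longleftrightarrow> evt e t = evt e u"
| "ev e s (Less t u) \<longleftrightarrow> less (evt e t) (evt e u)"
| "ev e s (Mem t X) \<longleftrightarrow> mem (evt e t) (s X)"
| "ev e s Bot \<longleftrightarrow> False"
| "ev e s (Imp p q) \<longleftrightarrow> (ev e s p \<longrightarrow> ev e s q)"
| "ev e s (AllN p) \<longleftrightarrow> (\<forall>x. ev (case_nat x e) s p)"
| "ev e s (AllS p) \<longleftrightarrow> (\<forall>A. ev e (case_nat A s) p)"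

lemma evt_cong: "(\<And>i. i < numbdt t \<Longrightarrow> e i = e' i) \<Longrightarrow> evt e t = evt e' t"
  by (induction t) auto

lemma ev_cong:
  "(\<And>i. i < numbd p \<Longrightarrow> e i = e' i) \<Longrightarrow> (\<And>i. i < setbd p \<Longrightarrow> s i = s' i) \<Longrightarrow> ev e s p = ev e' s' p"
proof (induction p arbitrary: e e' s s')
  case (Imp p q)
  have "ev e s p = ev e' s' p" "ev e s q = ev e' s' q"
    using Imp.prems by (intro Imp.IH; simp)+
  then show ?case by simp
next
  case (AllN p)
  have "ev (case_nat x e) s p = ev (case_nat x e') s' p" for x
    using AllN.prems by (intro AllN.IH) (auto split: nat.split)
  then show ?case by simp
next
  case (AllS p)
  have "ev e (case_nat x s) p = ev e' (case_nat x s') p" for x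
    using AllS.prems by (intro AllS.IH) (auto split: nat.split)
  then show ?case by simp
next
  case (Eq t u)
  then show ?case using evt_cong[of t e e'] evt_cong[of u e e'] by simp
next
  case (Less t u)
  then show ?case using evt_cong[of t e e'] evt_cong[of u e e'] by simp
next
  case (Mem t X)
  then show ?case using evt_cong[of t e e'] by simp
qed simp

lemma evt_substt [simp]: "evt e (substt \<sigma> t) = evt (\<lambda>i. evt e (\<sigma> i)) t"
  by (induction t) auto

lemma evt_liftt [simp]: "evt (case_nat x e) (liftt t) = evt e t"
  by (simp add: liftt_def)

lemma ev_substf: "ev e s (substf \<sigma> \<rho> p) = ev (\<lambda>i. evt e (\<sigma> i)) (\<lambda>i. s (\<rho> i)) p"
proof (induction p arbitrary: e s \<sigma> \<rho>)
  case (AllN p)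
  have "(\<lambda>i. evt (case_nat x e) (case_nat (Var 0) (\<lambda>i. liftt (\<sigma> i)) i)) =
      case_nat x (\<lambda>i. evt e (\<sigma> i))" for x
    by (auto split: nat.split)
  then show ?case by (simp add: AllN.IH)
next
  case (AllS p)
  have "(\<lambda>i. (case_nat A s) (case_nat 0 (\<lambda>i. Suc (\<rho> i)) i)) = case_nat A (\<lambda>i. s (\<rho> i))" for A
    by (auto split: nat.split)
  then show ?case by (simp add: AllS.IH)
qed auto

lemma ev_app:
  "ev e s (app p ts m) =
   ev (\<lambda>i. if i < length ts then evt e (ts ! i) else e (i - length ts + m)) s p"
  by (auto simp: app_def ev_substf intro!: ev_cong)

lemma ev_ball [simp]: "ev e s (ball t p) \<longleftrightarrow> (\<forall>x. less x (evt e t) \<longrightarrow> ev (case_nat x e) s p)"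
  by (simp add: ball_def)

lemma ev_bex [simp]: "ev e s (bex t p) \<longleftrightarrow> (\<exists>x. less x (evt e t) \<and> ev (case_nat x e) s p)"
  by (auto simp: bex_def)

lemma ev_AllN_funpow: "ev e s ((AllN ^^ n) p) \<longleftrightarrow> (\<forall>e'. (\<forall>i. e' (i + n) = e i) \<longrightarrow> ev e' s p)"
proof (induction n arbitrary: e p)
  case 0
  have "e' = e \<longleftrightarrow> (\<forall>i. e' i = e i)" for e' by auto
  then show ?case by auto
next
  case (Suc n)
  have "ev e s ((AllN ^^ Suc n) p) \<longleftrightarrow> (\<forall>x e'. (\<forall>i. e' (i + n) = case_nat x e i) \<longrightarrow> ev e' s p)"
    by (simp add: Suc.IH)
  also have "\<dots> \<longleftrightarrow> (\<forall>e'. (\<forall>i. e' (i + Suc n) = e i) \<longrightarrow> ev e' s p)"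
  proof safe
    fix e' assume *: "\<forall>x e'. (\<forall>i. e' (i + n) = case_nat x e i) \<longrightarrow> ev e' s p" "\<forall>i. e' (i + Suc n) = e i"
    have "\<forall>i. e' (i + n) = case_nat (e' n) e i"
      using *(2) by (auto split: nat.split)
    with *(1) show "ev e' s p" by blast
  next
    fix x e' assume *: "\<forall>e'. (\<forall>i. e' (i + Suc n) = e i) \<longrightarrow> ev e' s p" "\<forall>i. e' (i + n) = case_nat x e i"
    have "e' (i + Suc n) = e i" for i
      using *(2)[rule_format, of "Suc i"] by simp
    with *(1) show "ev e' s p" by blast
  qed
  finally show ?case .
qed

lemma ev_clN: "ev e s (clN p) \<longleftrightarrow> (\<forall>e. ev e s p)"
proof -
  have "ev e' s p" if *: "\<forall>e'. (\<forall>i. e' (i + numbd p) = e i) \<longrightarrow> ev e' s p" for e'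
  proof -
    \<comment> \<open>The iterated quantifiers change only the first \<open>numbd p\<close> values,
      so the tail has to come from \<open>e\<close>; \<open>p\<close> does not see it.\<close>
    define e'' where "e'' i = (if i < numbd p then e' i else e (i - numbd p))" for i
    have "ev e'' s p" using * by (simp add: e''_def)
    then show ?thesis using ev_cong[of p e'' e' s s] by (simp add: e''_def)
  qed
  then show ?thesis by (auto simp: clN_def ev_AllN_funpow)
qed

lemma ev_AllS_funpow: "ev e s ((AllS ^^ n) p) \<longleftrightarrow> (\<forall>s'. (\<forall>i. s' (i + n) = s i) \<longrightarrow> ev e s' p)"
proof (induction n arbitrary: s p)
  case 0
  have "s' = s \<longleftrightarrow> (\<forall>i. s' i = s i)" for s' by auto
  then show ?case by auto
next
  case (Suc n)
  have "ev e s ((AllS ^^ Suc n) p) \<longleftrightarrow> (\<forall>x s'. (\<forall>i. s' (i + n) = case_nat x s i) \<longrightarrow> ev e s' p)"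
    by (simp add: Suc.IH)
  also have "\<dots> \<longleftrightarrow> (\<forall>s'. (\<forall>i. s' (i + Suc n) = s i) \<longrightarrow> ev e s' p)"
  proof safe
    fix s' assume *: "\<forall>x s'. (\<forall>i. s' (i + n) = case_nat x s i) \<longrightarrow> ev e s' p" "\<forall>i. s' (i + Suc n) = s i"
    have "\<forall>i. s' (i + n) = case_nat (s' n) s i"
      using *(2) by (auto split: nat.split)
    with *(1) show "ev e s' p" by blast
  next
    fix x s' assume *: "\<forall>s'. (\<forall>i. s' (i + Suc n) = s i) \<longrightarrow> ev e s' p" "\<forall>i. s' (i + n) = case_nat x s i"
    have "s' (i + Suc n) = s i" for i
      using *(2)[rule_format, of "Suc i"] by simp
    with *(1) show "ev e s' p" by blast
  qed
  finally show ?case .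
qed

lemma ev_cl: "ev e s (cl p) \<longleftrightarrow> (\<forall>e s. ev e s p)"
proof -
  have "ev e s' (clN p)" if *: "\<forall>s'. (\<forall>i. s' (i + setbd p) = s i) \<longrightarrow> ev e s' (clN p)" for s'
  proof -
    define s'' where "s'' i = (if i < setbd p then s' i else s (i - setbd p))" for i
    have "ev e s'' (clN p)" using * by (simp add: s''_def)
    then show ?thesis using ev_cong[of "clN p" e e s'' s'] by (simp add: s''_def clN_def)
  qed
  then show ?thesis by (auto simp: cl_def ev_AllS_funpow ev_clN)
qed

end

text \<open>The axioms making the successor injective and not onto are assumed only so that the
  countable term model is infinite and can be carried by the whole type \<^typ>\<open>nat\<close>.\<close>

theorem completeness:
  assumes fresh: "fresh m \<Gamma>" and con: "\<not> \<Gamma> \<turnstile> Bot"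
    and S0: "cl (Neg (Eq (Add (Var 0) One) Zero)) \<in> \<Gamma>"
    and Sinj: "cl (Imp (Eq (Add (Var 0) One) (Add (Var 1) One)) (Eq (Var 0) (Var 1))) \<in> \<Gamma>"
  obtains zero one :: nat and add mul less mem and e s :: "nat \<Rightarrow> nat"
  where "\<And>p. p \<in> \<Gamma> \<Longrightarrow> two_sorted.ev zero one add mul less mem e s p"
proof -
  interpret henkin_set "henkin \<Gamma>" using henkin_set_henkin[OF fresh con] .
  let ?H = "henkin \<Gamma>"
  have "AllN (Neg (Eq (Add (Var 0) One) Zero)) \<in> ?H"
    using S0 subset_henkin by (auto simp: cl_def clN_def)
  then have H0: "Eq (Add t One) Zero \<notin> ?H" for t
    using Bot_notin by (auto simp: AllN_iff instN_def Imp_iff)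
  have "AllN (AllN (Imp (Eq (Add (Var 0) One) (Add (Var 1) One)) (Eq (Var 0) (Var 1)))) \<in> ?H"
    using Sinj subset_henkin by (auto simp: cl_def clN_def numeral_2_eq_2)
  then have Hinj: "Eq (Add t One) (Add u One) \<in> ?H \<Longrightarrow> Eq t u \<in> ?H" for t u
    by (auto simp: AllN_iff instN_def Imp_iff liftt_def substt_substt)
  define cls where "cls t = {u. Eq t u \<in> ?H}" for t
  have cls: "cls t = cls u \<longleftrightarrow> Eq t u \<in> ?H" for t u
    unfolding cls_def using Eq_refl Eq_sym Eq_trans by blast
  have "infinite (range cls)"
  proof
    assume fin: "finite (range cls)"
    define f where "f c = cls (Add (inv cls c) One)" for c
    have inv: "cls (inv cls (cls t)) = cls t" for t
      by (simp add: f_inv_into_f)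
    have f: "f (cls t) = cls (Add t One)" for t
      unfolding f_def using inv by (simp add: cls Eq_Add Eq_refl)
    have "inj_on f (range cls)"
      by (auto simp: inj_on_def f cls Hinj)
    then have "f ` range cls = range cls"
      using fin by (intro endo_inj_surj) (auto simp: f)
    then have "cls Zero \<in> f ` range cls" by blast
    then show False using H0 by (auto simp: f cls) (use Eq_sym in blast)
  qed
  moreover have "countable (range cls)" by simp
  ultimately obtain h where h: "bij_betw h (range cls) (UNIV :: nat set)"
    using to_nat_on_infinite by blast
  define val where "val t = h (cls t)" for t
  have val: "val t = val u \<longleftrightarrow> Eq t u \<in> ?H" for t u
    using h by (auto simp: val_def bij_betw_def inj_on_def cls[symmetric])
  have "surj val"
    using h by (auto simp: val_def bij_betw_def image_image image_def)
  define rep where "rep = inv val"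
  have rep: "val (rep x) = x" for x
    by (simp add: rep_def surj_f_inv_f \<open>surj val\<close>)
  have Erep: "Eq (rep (val t)) t \<in> ?H" "Eq t (rep (val t)) \<in> ?H" for t
    by (simp_all add: rep flip: val)
  define zero one where "zero = val Zero" and "one = val One"
  define add mul where "add x y = val (Add (rep x) (rep y))"
    and "mul x y = val (Mul (rep x) (rep y))" for x y
  define less where "less x y \<longleftrightarrow> Less (rep x) (rep y) \<in> ?H" for x y
  \<comment> \<open>Set variables themselves are the sets: the language has no equality between
    sets, so no quotient is taken.\<close>
  define mem where "mem x Y \<longleftrightarrow> Mem (rep x) Y \<in> ?H" for x and Y :: nat
  interpret two_sorted zero one add mul less mem .
  have "add (val t) (val u) = val (Add t u)" "mul (val t) (val u) = val (Mul t u)" for t u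
    by (simp_all add: add_def mul_def val Eq_Add Eq_Mul Erep)
  then have evt: "evt (\<lambda>i. val (\<sigma> i)) t = val (substt \<sigma> t)" for \<sigma> t
    by (induction t) (simp_all flip: zero_def one_def)
  have less: "less (val t) (val u) \<longleftrightarrow> Less t u \<in> ?H" for t u
    unfolding less_def using Eq_Less Erep by blast
  have mem: "mem (val t) Y \<longleftrightarrow> Mem t Y \<in> ?H" for t Y
    unfolding mem_def using Eq_Mem Erep by blast
  \<comment> \<open>The substitutions are arbitrary because each quantifier extends them by one more
    term or set variable.\<close>
  have truth: "ev (\<lambda>i. val (\<sigma> i)) \<rho> p \<longleftrightarrow> substf \<sigma> \<rho> p \<in> ?H" for \<sigma> \<rho> p
  proof (induction p arbitrary: \<sigma> \<rho>)
    case (AllN p)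
    have "case_nat (val t) (\<lambda>i. val (\<sigma> i)) = (\<lambda>i. val (case_nat t \<sigma> i))" for t
      by (auto split: nat.split)
    moreover have "(\<forall>x. P x) \<longleftrightarrow> (\<forall>t. P (val t))" for P
      using rep by metis
    ultimately show ?case by (simp add: AllN.IH AllN_iff instN_substf_up)
  next
    case (AllS p)
    then show ?case by (simp add: AllS_iff instS_substf_up)
  qed (auto simp: evt val less mem Imp_iff Bot_notin)
  have "ev (\<lambda>i. val (Var i)) id p" if "p \<in> \<Gamma>" for p
    using truth[of Var id p] that subset_henkin by auto
  then show thesis by (rule that)
qed

section \<open>Definable relations\<close>

lemma setbd_substf_id [simp]: "setbd (substf \<sigma> id p) = setbd p"
proof -
  have "setbd (substf \<sigma> \<rho> p) = setbd p" if "\<And>i. \<rho> i = i" for \<rho>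
    using that
  proof (induction p arbitrary: \<sigma> \<rho>)
    case (AllS p)
    have "case_nat 0 (\<lambda>i. Suc (\<rho> i)) i = i" for i
      using AllS.prems by (auto split: nat.split)
    from AllS.IH[OF this] show ?case by simp
  qed auto
  then show ?thesis by simp
qed

lemma substf_ball: "substf \<sigma> \<rho> (ball t p) =
    ball (substt \<sigma> t) (substf (case_nat (Var 0) (\<lambda>i. liftt (\<sigma> i))) \<rho> p)"
  by (simp add: ball_def substt_liftt)

lemma substf_bex: "substf \<sigma> \<rho> (bex t p) =
    bex (substt \<sigma> t) (substf (case_nat (Var 0) (\<lambda>i. liftt (\<sigma> i))) \<rho> p)"
  by (simp add: bex_def substt_liftt)

lemma Delta0_substf: "Delta0 p \<Longrightarrow> Delta0 (substf \<sigma> \<rho> p)"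
  by (induction arbitrary: \<sigma> \<rho> rule: Delta0.induct)
    (auto simp: substf_ball substf_bex intro: Delta0.intros)

lemma Sigma_Pi_substf:
  "Sigma n p \<Longrightarrow> Sigma n (substf \<sigma> \<rho> p)"
  "Pi n p \<Longrightarrow> Pi n (substf \<sigma> \<rho> p)"
  by (induction arbitrary: \<sigma> \<rho> and \<sigma> \<rho> rule: Sigma_Pi.inducts)
    (auto intro: Delta0_substf Sigma_Pi.intros)

lemma setbd_ball [simp]: "setbd (ball t p) = setbd p" and setbd_bex [simp]: "setbd (bex t p) = setbd p"
  by (simp_all add: ball_def bex_def)

lemma RCA0star_basic: "p \<in> basic_axioms \<Longrightarrow> cl p \<in> RCA0star"
  and RCA0star_exp: "exp_total \<in> RCA0star"
  and RCA0star_Ind: "Delta0 p \<Longrightarrow> cl (Ind p) \<in> RCA0star"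
  and RCA0star_Comp: "Sigma 1 p \<Longrightarrow> Pi 1 q \<Longrightarrow> cl (Comp p q) \<in> RCA0star"
  unfolding RCA0star_def by blast+

text \<open>Model elements cannot occur in formulas, so parameters are read off from a second
  environment. Interleaving leaves both supplies infinite and avoids bookkeeping of bounds on the
  free variables.\<close>

definition merge :: "(nat \<Rightarrow> 'a) \<Rightarrow> (nat \<Rightarrow> 'a) \<Rightarrow> nat \<Rightarrow> 'a" where
  "merge e c i = (if even i then e (i div 2) else c (i div 2))"

text \<open>One parameter environment that holds countably many others, so that relations defined
  separately can share their parameters.\<close>

definition params :: "(nat \<Rightarrow> nat \<Rightarrow> 'a) \<Rightarrow> nat \<Rightarrow> 'a" where
  "params c n = (case prod_decode n of (i, j) \<Rightarrow> c i j)"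

definition params_idx :: "nat \<Rightarrow> nat \<Rightarrow> nat" where
  "params_idx i j = (if even j then j else Suc (2 * prod_encode (i, j div 2)))"

lemma merge_params: "merge e (params c) (params_idx i j) = merge e (c i) j"
  by (simp add: merge_def params_def params_idx_def)

text \<open>In the interleaved order, putting a bound variable in front shifts only the even
  positions; this swap of neighbours is the effect on the positions after the first.\<close>

definition bind_idx :: "nat \<Rightarrow> nat" where
  "bind_idx i = (if odd i then i - 1 else Suc i)"

lemma merge_case_nat: "merge (case_nat x e) c = case_nat x (\<lambda>i. merge e c (bind_idx i))"
  by (auto simp: merge_def bind_idx_def fun_eq_iff split: nat.split elim!: oddE)

lemma (in two_sorted) ev_Ind:
  "ev e s (Ind p) \<longleftrightarrow> (ev (case_nat zero e) s p \<longrightarrow>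
     (\<forall>x. ev (case_nat x e) s p \<longrightarrow> ev (case_nat (add x one) e) s p) \<longrightarrow> (\<forall>x. ev (case_nat x e) s p))"
proof -
  have 1: "ev e s (app p [Zero] 0) = ev (case_nat zero e) s p"
    unfolding ev_app by (intro ev_cong) (auto split: nat.split)
  have 2: "ev (case_nat x e) s (app p [Add (Var 0) One] 1) = ev (case_nat (add x one) e) s p" for x
    unfolding ev_app by (intro ev_cong) (auto split: nat.split)
  show ?thesis unfolding Ind_def ev.simps 1 2 by blast
qed

section \<open>Semantic definability from one set and number parameters\<close>

locale arith_model = two_sorted zero one add mul less mem
  for zero one :: 'a
    and add mul :: "'a \<Rightarrow> 'a \<Rightarrow> 'a"
    and less :: "'a \<Rightarrow> 'a \<Rightarrow> bool"
    and mem :: "'a \<Rightarrow> 's \<Rightarrow> bool" +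
  assumes RCA: "p \<in> RCA0star \<Longrightarrow> ev e s p"

locale set_model = arith_model zero one add mul less mem
  for zero one :: 'a
    and add mul :: "'a \<Rightarrow> 'a \<Rightarrow> 'a"
    and less :: "'a \<Rightarrow> 'a \<Rightarrow> bool"
    and mem :: "'a \<Rightarrow> 's \<Rightarrow> bool" +
  fixes X :: 's
begin

notation add (infixl \<open>\<oplus>\<close> 65)
notation mul (infixl \<open>\<otimes>\<close> 70)
notation less (infix \<open>\<prec>\<close> 50)

abbreviation tr :: "(nat \<Rightarrow> 'a) \<Rightarrow> fm \<Rightarrow> bool" where
  "tr e p \<equiv> ev e (\<lambda>_. X) p"

text \<open>Terms and, below, formulas are represented by the functions and relations on
  environments that they define. Complexity bounds then follow from introduction rules, and formulas
  need not be written down.\<close>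

definition trm :: "((nat \<Rightarrow> 'a) \<Rightarrow> 'a) \<Rightarrow> bool" where
  "trm f \<longleftrightarrow> (\<exists>t c. f = (\<lambda>e. evt (merge e c) t))"

text \<open>The odd variables of the defining formula hold the parameters.\<close>

definition dfn :: "(fm \<Rightarrow> bool) \<Rightarrow> ((nat \<Rightarrow> 'a) \<Rightarrow> bool) \<Rightarrow> bool" where
  "dfn Q P \<longleftrightarrow> (\<exists>p c. Q p \<and> setbd p \<le> 1 \<and> P = (\<lambda>e. tr (merge e c) p))"

lemma trm_var: "trm (\<lambda>e. e i)"
  unfolding trm_def by (rule exI[of _ "Var (2 * i)"]) (simp add: merge_def)

lemma trm_const: "trm (\<lambda>e. a)"
  unfolding trm_def by (rule exI[of _ "Var 1"], rule exI[of _ "\<lambda>_. a"]) (simp add: merge_def)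

lemma trm_family:
  assumes "\<And>i::nat. trm (f i)"
  obtains c t where "\<And>i. f i = (\<lambda>e. evt (merge e c) (t i))"
proof -
  from assms obtain t c where tc: "\<And>i. f i = (\<lambda>e. evt (merge e (c i)) (t i))"
    unfolding trm_def by metis
  have "f i = (\<lambda>e. evt (merge e (params c)) (substt (\<lambda>j. Var (params_idx i j)) (t i)))" for i
    by (simp add: tc merge_params)
  then show thesis by (rule that)
qed

lemma trm_add:
  assumes "trm f" "trm g"
  shows "trm (\<lambda>e. f e \<oplus> g e)"
proof -
  have "trm (if i = 0 then f else g)" for i :: nat using assms by simp
  from trm_family[of "\<lambda>i. if i = 0 then f else g", OF this]
  obtain c t where ct: "\<And>i::nat. (if i = 0 then f else g) = (\<lambda>e. evt (merge e c) (t i))" by metis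
  show ?thesis unfolding trm_def using ct[of 0] ct[of 1]
    by (intro exI[of _ "Add (t 0) (t 1)"] exI[of _ c]) simp
qed

lemma trm_mul:
  assumes "trm f" "trm g"
  shows "trm (\<lambda>e. f e \<otimes> g e)"
proof -
  have "trm (if i = 0 then f else g)" for i :: nat using assms by simp
  from trm_family[of "\<lambda>i. if i = 0 then f else g", OF this]
  obtain c t where ct: "\<And>i::nat. (if i = 0 then f else g) = (\<lambda>e. evt (merge e c) (t i))" by metis
  show ?thesis unfolding trm_def using ct[of 0] ct[of 1]
    by (intro exI[of _ "Mul (t 0) (t 1)"] exI[of _ c]) simp
qed

lemmas trm_intros = trm_var trm_const trm_add trm_mul

text \<open>Old variables become the terms \<open>f i\<close> and old parameters become constants;
  taken as a single family, they receive common parameters. The same device serves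
  \<open>dfn_subst\<close>.\<close>

lemma trm_subst:
  assumes "trm g" "\<And>i. trm (f i)"
  shows "trm (\<lambda>e. g (\<lambda>i. f i e))"
proof -
  from assms(1) obtain t c where tc: "g = (\<lambda>e. evt (merge e c) t)" by (auto simp: trm_def)
  have "trm (if even i then f (i div 2) else (\<lambda>_. c (i div 2)))" for i
    using assms(2) trm_const by auto
  from trm_family[of "\<lambda>i. if even i then f (i div 2) else (\<lambda>_. c (i div 2))", OF this]
  obtain d u where du: "\<And>i. (if even i then f (i div 2) else (\<lambda>_. c (i div 2))) =
      (\<lambda>e. evt (merge e d) (u i))" by metis
  have "merge (\<lambda>i. f i e) c = (\<lambda>i. evt (merge e d) (u i))" for e
  proof
    show "merge (\<lambda>i. f i e) c i = evt (merge e d) (u i)" for i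
      using fun_cong[OF du[of i], of e] by (auto simp: merge_def split: if_splits)
  qed
  then have "(\<lambda>e. g (\<lambda>i. f i e)) = (\<lambda>e. evt (merge e d) (substt u t))"
    by (simp add: tc)
  then show ?thesis unfolding trm_def by blast
qed

lemma dfn_subst:
  assumes "dfn Q P" "\<And>i. trm (f i)" and Q: "\<And>p \<sigma>. Q p \<Longrightarrow> Q (substf \<sigma> id p)"
  shows "dfn Q (\<lambda>e. P (\<lambda>i. f i e))"
proof -
  from assms(1) obtain p c where pc: "Q p" "setbd p \<le> 1" "P = (\<lambda>e. tr (merge e c) p)"
    by (auto simp: dfn_def)
  have "trm (if even i then f (i div 2) else (\<lambda>_. c (i div 2)))" for i
    using assms(2) trm_const by auto
  from trm_family[of "\<lambda>i. if even i then f (i div 2) else (\<lambda>_. c (i div 2))", OF this]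
  obtain d u where du: "\<And>i. (if even i then f (i div 2) else (\<lambda>_. c (i div 2))) =
      (\<lambda>e. evt (merge e d) (u i))" by metis
  have "merge (\<lambda>i. f i e) c = (\<lambda>i. evt (merge e d) (u i))" for e
  proof
    show "merge (\<lambda>i. f i e) c i = evt (merge e d) (u i)" for i
      using fun_cong[OF du[of i], of e] by (auto simp: merge_def split: if_splits)
  qed
  then have "(\<lambda>e. P (\<lambda>i. f i e)) = (\<lambda>e. tr (merge e d) (substf u id p))"
    by (simp add: pc(3) ev_substf)
  then show ?thesis unfolding dfn_def using pc Q
    by (intro exI[of _ "substf u id p"] exI[of _ d]) simp
qed

lemma dfn_family:
  assumes "\<And>i::nat. dfn (Q i) (P i)" and Q: "\<And>i p \<sigma>. Q i p \<Longrightarrow> Q i (substf \<sigma> id p)"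
  obtains c p where "\<And>i. Q i (p i)" "\<And>i. setbd (p i) \<le> 1" "\<And>i. P i = (\<lambda>e. tr (merge e c) (p i))"
proof -
  from assms(1) obtain p c where pc: "\<And>i. Q i (p i)" "\<And>i. setbd (p i) \<le> 1"
      "\<And>i. P i = (\<lambda>e. tr (merge e (c i)) (p i))"
    unfolding dfn_def by metis
  have "P i = (\<lambda>e. tr (merge e (params c)) (substf (\<lambda>j. Var (params_idx i j)) id (p i)))" for i
    by (simp add: pc(3) ev_substf merge_params)
  then show thesis using pc(1,2) Q
    by (intro that[of "\<lambda>i. substf (\<lambda>j. Var (params_idx i j)) id (p i)" "params c"]) simp_all
qed

lemma dfn_bind:
  assumes "dfn Q (\<lambda>e. P (e 0) (\<lambda>i. e (Suc i)))" and Q: "\<And>p \<sigma>. Q p \<Longrightarrow> Q (substf \<sigma> id p)"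
  obtains p c where "Q p" "setbd p \<le> 1" "\<And>x e. P x e \<longleftrightarrow> tr (case_nat x (merge e c)) p"
proof -
  from assms(1) obtain p c where pc: "Q p" "setbd p \<le> 1"
      "(\<lambda>e. P (e 0) (\<lambda>i. e (Suc i))) = (\<lambda>e. tr (merge e c) p)"
    by (auto simp: dfn_def)
  define \<sigma> where "\<sigma> = case_nat (Var 0) (\<lambda>i. Var (Suc (bind_idx i)))"
  have "P x e \<longleftrightarrow> tr (case_nat x (merge e c)) (substf \<sigma> id p)" for x e
  proof -
    have "P x e \<longleftrightarrow> tr (merge (case_nat x e) c) p"
      using fun_cong[OF pc(3), of "case_nat x e"] by simp
    also have "merge (case_nat x e) c = (\<lambda>i. evt (case_nat x (merge e c)) (\<sigma> i))"
      by (auto simp: merge_case_nat \<sigma>_def split: nat.split)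
    finally show ?thesis by (simp add: ev_substf)
  qed
  then show thesis using that pc Q by (metis setbd_substf_id)
qed

text \<open>Each level adds one unbounded quantifier, and Pi relations are the complements of Sigma
  relations. Blocks of like quantifiers are contracted later in \<open>Sg_ex\<close>, by means of
  collection.\<close>

primrec Sg :: "nat \<Rightarrow> ((nat \<Rightarrow> 'a) \<Rightarrow> bool) \<Rightarrow> bool" where
  "Sg 0 P = dfn Delta0 P"
| "Sg (Suc k) P = (\<exists>R. Sg k R \<and> P = (\<lambda>e. \<exists>z. \<not> R (case_nat z e)))"

lemma Sg0_eq: "trm f \<Longrightarrow> trm g \<Longrightarrow> Sg 0 (\<lambda>e. f e = g e)"
proof -
  assume "trm f" "trm g"
  moreover have "dfn Delta0 (\<lambda>e. e 0 = e 1)"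
    unfolding dfn_def
    by (intro exI[of _ "Eq (Var 0) (Var 2)"]) (auto simp: merge_def intro: Delta0.intros)
  ultimately show ?thesis
    using dfn_subst[of Delta0 "\<lambda>e. e 0 = e 1" "\<lambda>i. if i = 0 then f else g"] Delta0_substf by auto
qed

lemma Sg0_less: "trm f \<Longrightarrow> trm g \<Longrightarrow> Sg 0 (\<lambda>e. f e \<prec> g e)"
proof -
  assume "trm f" "trm g"
  moreover have "dfn Delta0 (\<lambda>e. e 0 \<prec> e 1)"
    unfolding dfn_def
    by (intro exI[of _ "Less (Var 0) (Var 2)"]) (auto simp: merge_def intro: Delta0.intros)
  ultimately show ?thesis
    using dfn_subst[of Delta0 "\<lambda>e. e 0 \<prec> e 1" "\<lambda>i. if i = 0 then f else g"] Delta0_substf by auto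
qed

lemma Sg0_mem: "trm f \<Longrightarrow> Sg 0 (\<lambda>e. mem (f e) X)"
proof -
  assume "trm f"
  moreover have "dfn Delta0 (\<lambda>e. mem (e 0) X)"
    unfolding dfn_def
    by (intro exI[of _ "Mem (Var 0) 0"]) (auto simp: merge_def intro: Delta0.intros)
  ultimately show ?thesis
    using dfn_subst[of Delta0 "\<lambda>e. mem (e 0) X" "\<lambda>i. f"] Delta0_substf by auto
qed

lemma Sg0_False: "Sg 0 (\<lambda>e. False)"
  unfolding Sg.simps dfn_def by (rule exI[of _ Bot]) (auto intro: Delta0.intros)

lemma Sg0_imp:
  assumes "Sg 0 P" "Sg 0 Q"
  shows "Sg 0 (\<lambda>e. P e \<longrightarrow> Q e)"
proof -
  have "dfn Delta0 (if i = 0 then P else Q)" for i :: nat using assms by simp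
  from dfn_family[of "\<lambda>_. Delta0" "\<lambda>i. if i = 0 then P else Q", OF this Delta0_substf]
  obtain c p where cp: "\<And>i::nat. Delta0 (p i)" "\<And>i::nat. setbd (p i) \<le> 1"
      "\<And>i::nat. (if i = 0 then P else Q) = (\<lambda>e. tr (merge e c) (p i))" by metis
  show ?thesis unfolding Sg.simps dfn_def using cp(3)[of 0] cp(3)[of 1] cp(1,2)
    by (intro exI[of _ "Imp (p 0) (p 1)"] exI[of _ c]) (auto intro: Delta0.intros)
qed

lemma Sg0_not: "Sg 0 P \<Longrightarrow> Sg 0 (\<lambda>e. \<not> P e)"
  using Sg0_imp[OF _ Sg0_False, of P] by simp

lemma Sg0_bool: "Sg 0 (\<lambda>e. b)"
  using Sg0_not[OF Sg0_False] Sg0_False by (cases b) auto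

lemma Sg0_and: "Sg 0 P \<Longrightarrow> Sg 0 Q \<Longrightarrow> Sg 0 (\<lambda>e. P e \<and> Q e)"
  using Sg0_not[OF Sg0_imp[OF _ Sg0_not, of P Q]] by simp

lemma Sg0_or: "Sg 0 P \<Longrightarrow> Sg 0 Q \<Longrightarrow> Sg 0 (\<lambda>e. P e \<or> Q e)"
  using Sg0_imp[OF Sg0_not, of P Q] by (simp add: disj_imp)

lemma Sg0_iff: "Sg 0 P \<Longrightarrow> Sg 0 Q \<Longrightarrow> Sg 0 (\<lambda>e. P e \<longleftrightarrow> Q e)"
  using Sg0_and[OF Sg0_imp[of P Q] Sg0_imp[of Q P]] by (simp add: iff_conv_conj_imp)

lemma Sg0_ball:
  assumes "Sg 0 (\<lambda>e. P (e 0) (\<lambda>i. e (Suc i)))" "trm f"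
  shows "Sg 0 (\<lambda>e. \<forall>x. x \<prec> f e \<longrightarrow> P x e)"
proof -
  from dfn_bind[of Delta0 P] assms(1) Delta0_substf
  obtain p c where pc: "Delta0 p" "setbd p \<le> 1" "\<And>x e. P x e \<longleftrightarrow> tr (case_nat x (merge e c)) p"
    by auto
  have "dfn Delta0 (\<lambda>e. \<forall>x. x \<prec> e 0 \<longrightarrow> P x (\<lambda>i. e (Suc i)))"
  proof -
    \<comment> \<open>Variable 0 is now the bound. Under the quantifier, the even positions
      therefore move past it and past the quantified variable, the odd ones only past the
      latter.\<close>
    define \<sigma> where "\<sigma> = case_nat (Var 0) (\<lambda>i. Var (if even i then Suc (Suc (Suc i)) else Suc i))"
    have "case_nat x (merge (\<lambda>i. e (Suc i)) c) = (\<lambda>i. evt (case_nat x (merge e c)) (\<sigma> i))" for x e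
      by (auto simp: \<sigma>_def merge_def fun_eq_iff split: nat.split)
    then have "(\<lambda>e. \<forall>x. x \<prec> e 0 \<longrightarrow> P x (\<lambda>i. e (Suc i))) =
        (\<lambda>e. tr (merge e c) (ball (Var 0) (substf \<sigma> id p)))"
      by (simp add: pc(3) ev_substf merge_def)
    then show ?thesis unfolding dfn_def using pc
      by (intro exI[of _ "ball (Var 0) (substf \<sigma> id p)"] exI[of _ c])
        (auto intro: Delta0.intros Delta0_substf)
  qed
  from dfn_subst[OF this, of "case_nat f (\<lambda>i e. e i)"] show ?thesis
    using assms(2) by (simp add: Delta0_substf trm_var split: nat.split)
qed

lemma Sg0_bex:
  assumes "Sg 0 (\<lambda>e. P (e 0) (\<lambda>i. e (Suc i)))" "trm f"
  shows "Sg 0 (\<lambda>e. \<exists>x. x \<prec> f e \<and> P x e)"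
  using Sg0_not[OF Sg0_ball[OF Sg0_not[OF assms(1)] assms(2)]] by simp

lemmas Sg0_intros = Sg0_eq Sg0_less Sg0_mem Sg0_bool Sg0_imp Sg0_not Sg0_and Sg0_or Sg0_iff Sg0_ball
  Sg0_bex trm_intros

text \<open>Only bounded relations admit induction at this stage. In the applications, case 1 is
  this complexity condition, and existential statements get explicit bounds in order to meet
  it.\<close>

lemma induct0:
  assumes "Sg 0 (\<lambda>e. P (e 0))" "P zero" "\<And>x. P x \<Longrightarrow> P (x \<oplus> one)"
  shows "P x"
proof -
  from assms(1) obtain p c where pc: "Delta0 p" "(\<lambda>e. P (e 0)) = (\<lambda>e. tr (merge e c) p)"
    by (auto simp: dfn_def)
  define e' where "e' = (\<lambda>i. merge (\<lambda>_. zero) c (bind_idx i))"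
  have P: "P x = tr (case_nat x e') p" for x
    using fun_cong[OF pc(2), of "case_nat x (\<lambda>_. zero)"] by (simp add: merge_case_nat e'_def)
  have "ev e (\<lambda>_. X) (cl (Ind p))" for e using pc(1) by (rule RCA[OF RCA0star_Ind])
  then have "tr e' (Ind p)" unfolding ev_cl by blast
  then show ?thesis using assms(2,3) unfolding ev_Ind P by blast
qed

section \<open>Arithmetic in a model\<close>

lemma basic: "p \<in> basic_axioms \<Longrightarrow> ev e s p"
proof -
  assume "p \<in> basic_axioms"
  then have "ev e s (cl p)" by (rule RCA[OF RCA0star_basic])
  then show ?thesis by (simp add: ev_cl)
qed

lemma succ_neq_zero: "x \<oplus> one \<noteq> zero" "zero \<noteq> x \<oplus> one"
proof -
  show "x \<oplus> one \<noteq> zero"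
    using basic[of "Neg (Eq (Add (Var 0) One) Zero)" "\<lambda>_. x"] by (simp add: basic_axioms_def)
  then show "zero \<noteq> x \<oplus> one" by (rule not_sym)
qed

lemma succ_inject: "x \<oplus> one = y \<oplus> one \<longleftrightarrow> x = y"
  using basic[of "Imp (Eq (Add (Var 0) One) (Add (Var 1) One)) (Eq (Var 0) (Var 1))" "case_nat x (\<lambda>_. y)"]
  by (auto simp: basic_axioms_def)

lemma add_zero: "x \<oplus> zero = x"
  using basic[of "Eq (Add (Var 0) Zero) (Var 0)" "\<lambda>_. x"] by (simp add: basic_axioms_def)

lemma add_succ: "x \<oplus> (y \<oplus> one) = x \<oplus> y \<oplus> one"
  using basic[of "Eq (Add (Var 0) (Add (Var 1) One)) (Add (Add (Var 0) (Var 1)) One)" "case_nat x (\<lambda>_. y)"]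
  by (simp add: basic_axioms_def)

lemma mul_zero: "x \<otimes> zero = zero"
  using basic[of "Eq (Mul (Var 0) Zero) Zero" "\<lambda>_. x"] by (simp add: basic_axioms_def)

lemma mul_succ: "x \<otimes> (y \<oplus> one) = x \<otimes> y \<oplus> x"
  using basic[of "Eq (Mul (Var 0) (Add (Var 1) One)) (Add (Mul (Var 0) (Var 1)) (Var 0))" "case_nat x (\<lambda>_. y)"]
  by (simp add: basic_axioms_def)

lemma not_less_zero: "\<not> x \<prec> zero"
  using basic[of "Neg (Less (Var 0) Zero)" "\<lambda>_. x"] by (simp add: basic_axioms_def)

lemma less_succ: "x \<prec> y \<oplus> one \<longleftrightarrow> x \<prec> y \<or> x = y"
  using basic[of "Iff (Less (Var 0) (Add (Var 1) One)) (Or (Less (Var 0) (Var 1)) (Eq (Var 0) (Var 1)))"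
    "case_nat x (\<lambda>_. y)"]
  by (auto simp: basic_axioms_def)

lemma zero_add: "zero \<oplus> x = x"
proof (induction rule: induct0[of "\<lambda>x. zero \<oplus> x = x"])
  case 1 show ?case by (intro Sg0_intros)
qed (simp_all add: add_zero add_succ)

lemma succ_add: "(x \<oplus> one) \<oplus> y = x \<oplus> y \<oplus> one"
proof (induction rule: induct0[of "\<lambda>y. (x \<oplus> one) \<oplus> y = x \<oplus> y \<oplus> one"])
  case 1 show ?case by (intro Sg0_intros)
qed (simp_all add: add_zero add_succ)

lemma add_commute: "x \<oplus> y = y \<oplus> x"
proof (induction rule: induct0[of "\<lambda>y. x \<oplus> y = y \<oplus> x"])
  case 1 show ?case by (intro Sg0_intros)
qed (simp_all add: add_zero zero_add add_succ succ_add)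

lemma add_assoc: "x \<oplus> y \<oplus> z = x \<oplus> (y \<oplus> z)"
proof (induction rule: induct0[of "\<lambda>z. x \<oplus> y \<oplus> z = x \<oplus> (y \<oplus> z)"])
  case 1 show ?case by (intro Sg0_intros)
qed (simp_all add: add_zero add_succ)

lemma zero_mul: "zero \<otimes> x = zero"
proof (induction rule: induct0[of "\<lambda>x. zero \<otimes> x = zero"])
  case 1 show ?case by (intro Sg0_intros)
qed (simp_all add: mul_zero mul_succ add_zero)

lemma succ_mul: "(x \<oplus> one) \<otimes> y = x \<otimes> y \<oplus> y"
proof (induction rule: induct0[of "\<lambda>y. (x \<oplus> one) \<otimes> y = x \<otimes> y \<oplus> y"])
  case 1 show ?case by (intro Sg0_intros)
next
  case (3 y)
  have "x \<otimes> y \<oplus> y \<oplus> (x \<oplus> one) = x \<otimes> y \<oplus> x \<oplus> (y \<oplus> one)"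
    by (metis add_assoc add_commute)
  with 3 show ?case by (simp add: mul_succ)
qed (simp add: mul_zero add_zero)

lemma mul_commute: "x \<otimes> y = y \<otimes> x"
proof (induction rule: induct0[of "\<lambda>y. x \<otimes> y = y \<otimes> x"])
  case 1 show ?case by (intro Sg0_intros)
qed (simp_all add: mul_zero zero_mul mul_succ succ_mul)

lemma add_mul: "(x \<oplus> y) \<otimes> z = x \<otimes> z \<oplus> y \<otimes> z"
proof (induction rule: induct0[of "\<lambda>z. (x \<oplus> y) \<otimes> z = x \<otimes> z \<oplus> y \<otimes> z"])
  case 1 show ?case by (intro Sg0_intros)
next
  case (3 z)
  then show ?case by (simp add: mul_succ) (metis add_assoc add_commute)
qed (simp add: mul_zero add_zero)

lemma mul_assoc: "x \<otimes> y \<otimes> z = x \<otimes> (y \<otimes> z)"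
proof (induction rule: induct0[of "\<lambda>z. x \<otimes> y \<otimes> z = x \<otimes> (y \<otimes> z)"])
  case 1 show ?case by (intro Sg0_intros)
next
  case (3 z)
  then show ?case using add_mul[of _ _ x] by (simp add: mul_succ mul_commute[of x])
qed (simp add: mul_zero)

lemma one_mul: "one \<otimes> x = x"
  using succ_mul[of zero x] by (simp add: zero_add zero_mul)

lemma zero_neq_one: "zero \<noteq> one"
  using succ_neq_zero[of zero] by (simp add: zero_add)

lemma mul_one: "x \<otimes> one = x"
  by (metis one_mul mul_commute)

sublocale M: comm_semiring_1 mul one add zero
  by unfold_locales
    (rule add_assoc add_zero zero_add mul_assoc one_mul mul_one zero_mul mul_zero add_mul
      zero_neq_one add_commute mul_commute)+

lemma add_right_cancel: "x \<oplus> z = y \<oplus> z \<longleftrightarrow> x = y"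
proof (induction rule: induct0[of "\<lambda>z. x \<oplus> z = y \<oplus> z \<longleftrightarrow> x = y"])
  case 1 show ?case by (intro Sg0_intros)
qed (simp_all add: add_zero add_succ succ_inject)

lemma add_left_cancel: "z \<oplus> x = z \<oplus> y \<longleftrightarrow> x = y"
  by (metis add_right_cancel add_commute)

lemma zero_less_succ: "zero \<prec> x \<oplus> one"
proof (induction rule: induct0[of "\<lambda>x. zero \<prec> x \<oplus> one"])
  case 1 show ?case by (intro Sg0_intros)
next
  case 2 show ?case unfolding less_succ by simp
next
  case (3 x) then show ?case unfolding less_succ[of _ "x \<oplus> one"] by blast
qed

lemma zero_less_one: "zero \<prec> one"
  using zero_less_succ[of zero] by (simp only: zero_add)

lemma succ_less_succI: "x \<prec> y \<Longrightarrow> x \<oplus> one \<prec> y \<oplus> one"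
proof -
  have "x \<prec> y \<longrightarrow> x \<oplus> one \<prec> y \<oplus> one"
  proof (induction rule: induct0[of "\<lambda>y. x \<prec> y \<longrightarrow> x \<oplus> one \<prec> y \<oplus> one"])
    case 1 show ?case by (intro Sg0_intros)
  next
    case (3 y)
    then show ?case using less_succ by blast
  qed (simp add: not_less_zero)
  then show "x \<prec> y \<Longrightarrow> x \<oplus> one \<prec> y \<oplus> one" by simp
qed

lemma zero_or_succ: "x = zero \<or> (\<exists>y. x = y \<oplus> one)"
proof -
  have "x = zero \<or> (\<exists>y. y \<prec> x \<and> x = y \<oplus> one)"
  proof (induction rule: induct0[of "\<lambda>x. x = zero \<or> (\<exists>y. y \<prec> x \<and> x = y \<oplus> one)"])
    case 1 show ?case by (intro Sg0_intros)
  qed (auto simp: less_succ)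
  then show ?thesis by blast
qed

lemma less_iff_add: "x \<prec> y \<longleftrightarrow> (\<exists>z. y = x \<oplus> z \<oplus> one)"
proof
  have "x \<prec> y \<longrightarrow> (\<exists>z. z \<prec> y \<and> y = x \<oplus> z \<oplus> one)"
  proof (induction rule: induct0[of "\<lambda>y. x \<prec> y \<longrightarrow> (\<exists>z. z \<prec> y \<and> y = x \<oplus> z \<oplus> one)"])
    case 1 show ?case by (intro Sg0_intros)
  next
    case (3 y)
    show ?case
    proof
      assume "x \<prec> y \<oplus> one"
      then consider "x \<prec> y" | "x = y" by (auto simp: less_succ)
      then show "\<exists>z. z \<prec> y \<oplus> one \<and> y \<oplus> one = x \<oplus> z \<oplus> one"
      proof cases
        case 1
        with 3 obtain z where "z \<prec> y" "y = x \<oplus> z \<oplus> one" by blast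
        then show ?thesis by (intro exI[of _ "z \<oplus> one"]) (simp add: succ_less_succI add_succ)
      next
        case 2
        then show ?thesis by (intro exI[of _ zero]) (simp add: zero_less_succ add_zero)
      qed
    qed
  qed (simp add: not_less_zero)
  then show "x \<prec> y \<Longrightarrow> \<exists>z. y = x \<oplus> z \<oplus> one" by blast
  have "x \<prec> x \<oplus> z \<oplus> one" for z
  proof (induction rule: induct0[of "\<lambda>z. x \<prec> x \<oplus> z \<oplus> one"])
    case 1 show ?case by (intro Sg0_intros)
  qed (auto simp: less_succ add_zero add_succ)
  then show "\<exists>z. y = x \<oplus> z \<oplus> one \<Longrightarrow> x \<prec> y" by blast
qed

lemma less_irrefl: "\<not> x \<prec> x"
proof
  assume "x \<prec> x"
  then obtain z where "x \<oplus> zero = x \<oplus> (z \<oplus> one)" unfolding less_iff_add by (metis add_assoc add_zero)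
  then show False by (simp only: add_left_cancel succ_neq_zero)
qed

lemma less_trans: "x \<prec> y \<Longrightarrow> y \<prec> z \<Longrightarrow> x \<prec> z"
proof -
  assume "x \<prec> y" "y \<prec> z"
  then obtain u v where "y = x \<oplus> u \<oplus> one" "z = y \<oplus> v \<oplus> one" by (auto simp: less_iff_add)
  then have "z = x \<oplus> (u \<oplus> one \<oplus> v) \<oplus> one" by (simp add: add_assoc)
  then show ?thesis unfolding less_iff_add by blast
qed

lemma less_linear: "x \<prec> y \<or> x = y \<or> y \<prec> x"
proof (induction rule: induct0[of "\<lambda>y. x \<prec> y \<or> x = y \<or> y \<prec> x"])
  case 1 show ?case by (intro Sg0_intros)
next
  case 2 show ?case using zero_or_succ[of x] zero_less_succ by auto
next
  case (3 y)
  then show ?case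
  proof (elim disjE)
    assume "y \<prec> x"
    then obtain z where z: "x = y \<oplus> z \<oplus> one" by (auto simp: less_iff_add)
    show ?thesis
    proof (cases "z = zero")
      case False
      then obtain w where "z = w \<oplus> one" using zero_or_succ by blast
      then have "x = (y \<oplus> one) \<oplus> w \<oplus> one" using z by (metis add_succ succ_add)
      then show ?thesis unfolding less_iff_add by blast
    qed (use z in \<open>simp add: add_zero\<close>)
  qed (auto simp: less_succ)
qed

definition leq :: "'a \<Rightarrow> 'a \<Rightarrow> bool" (infix \<open>\<preceq>\<close> 50) where
  "x \<preceq> y \<longleftrightarrow> x \<prec> y \<or> x = y"

sublocale M: linorder leq less
proof
  fix x y z
  show "x \<prec> y \<longleftrightarrow> x \<preceq> y \<and> \<not> y \<preceq> x" using less_irrefl less_trans unfolding leq_def by blast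
  show "x \<preceq> x" by (simp add: leq_def)
  show "x \<preceq> y \<Longrightarrow> y \<preceq> z \<Longrightarrow> x \<preceq> z" using less_trans unfolding leq_def by blast
  show "x \<preceq> y \<Longrightarrow> y \<preceq> x \<Longrightarrow> x = y" using less_irrefl less_trans unfolding leq_def by blast
  show "x \<preceq> y \<or> y \<preceq> x" using less_linear unfolding leq_def by blast
qed

lemma less_succ_leq: "x \<prec> y \<oplus> one \<longleftrightarrow> x \<preceq> y"
  by (simp add: less_succ leq_def)

lemma leq_iff_add: "x \<preceq> y \<longleftrightarrow> (\<exists>z. y = x \<oplus> z)"
proof
  assume "x \<preceq> y"
  then have "x \<prec> y \<oplus> one" by (simp add: less_succ_leq)
  then show "\<exists>z. y = x \<oplus> z" by (auto simp: less_iff_add succ_inject)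
next
  assume "\<exists>z. y = x \<oplus> z"
  then have "x \<prec> y \<oplus> one" by (auto simp: less_iff_add)
  then show "x \<preceq> y" by (simp add: less_succ_leq)
qed

lemma zero_leq: "zero \<preceq> x"
  unfolding leq_iff_add by (rule exI[of _ x]) (simp add: zero_add)

lemma leq_add: "x \<preceq> x \<oplus> y" "x \<preceq> y \<oplus> x"
  unfolding leq_iff_add using add_commute by blast+

lemma succ_leq: "x \<oplus> one \<preceq> y \<longleftrightarrow> x \<prec> y"
  unfolding less_iff_add leq_iff_add by (metis add_assoc add_commute)

lemma add_less_mono: "x \<prec> y \<Longrightarrow> x \<oplus> z \<prec> y \<oplus> z"
  unfolding less_iff_add by (metis add_assoc add_commute)

lemma add_leq_mono: "x \<preceq> y \<Longrightarrow> u \<preceq> v \<Longrightarrow> x \<oplus> u \<preceq> y \<oplus> v"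
  unfolding leq_iff_add by (metis add_assoc add_commute)

lemma mul_leq_mono1: "x \<preceq> y \<Longrightarrow> x \<otimes> z \<preceq> y \<otimes> z"
  unfolding leq_iff_add using add_mul by blast

lemma mul_leq_mono: "x \<preceq> y \<Longrightarrow> u \<preceq> v \<Longrightarrow> x \<otimes> u \<preceq> y \<otimes> v"
  using mul_leq_mono1[of x y u] mul_leq_mono1[of u v y] M.order_trans
  by (metis mul_commute)

section \<open>Division with remainder and a pairing function\<close>

lemma div_unique_aux:
  assumes "q \<otimes> m \<oplus> r = q' \<otimes> m \<oplus> r'" "r \<prec> m"
  shows "\<not> q \<prec> q'"
proof
  assume "q \<prec> q'"
  then obtain z where "q' = q \<oplus> z \<oplus> one" by (auto simp: less_iff_add)
  then have "q \<otimes> m \<oplus> r = q \<otimes> m \<oplus> (m \<oplus> (z \<otimes> m \<oplus> r'))"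
    using assms(1) by (simp add: add_mul one_mul M.add_ac)
  then have "m \<preceq> r" unfolding add_left_cancel leq_iff_add by blast
  with assms(2) show False by (simp add: M.leD)
qed

lemma div_unique:
  assumes "q \<otimes> m \<oplus> r = q' \<otimes> m \<oplus> r'" "r \<prec> m" "r' \<prec> m"
  shows "q = q' \<and> r = r'"
proof -
  have "q = q'"
    using div_unique_aux[OF assms(1,2)] div_unique_aux[OF assms(1)[symmetric] assms(3)] less_linear
    by blast
  then show ?thesis using assms(1) by (simp add: add_left_cancel)
qed

lemma div_exists:
  assumes "zero \<prec> m"
  shows "\<exists>q r. r \<prec> m \<and> x = q \<otimes> m \<oplus> r"
proof -
  have "\<exists>q. q \<prec> x \<oplus> one \<and> (\<exists>r. r \<prec> m \<and> x = q \<otimes> m \<oplus> r)"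
  proof (induction rule: induct0[of "\<lambda>x. \<exists>q. q \<prec> x \<oplus> one \<and> (\<exists>r. r \<prec> m \<and> x = q \<otimes> m \<oplus> r)"])
    case 1 show ?case by (intro Sg0_intros)
  next
    case 2 show ?case using assms
      by (intro exI[of _ zero] conjI) (simp_all add: zero_mul zero_add zero_less_one)
  next
    case (3 x)
    then obtain q r where qr: "q \<prec> x \<oplus> one" "r \<prec> m" "x = q \<otimes> m \<oplus> r" by blast
    show ?case
    proof (cases "r \<oplus> one = m")
      case True
      then have "x \<oplus> one = (q \<oplus> one) \<otimes> m \<oplus> zero"
        using qr(3) by (simp add: succ_mul add_zero add_assoc)
      then show ?thesis using qr(1) assms succ_less_succI by blast
    next
      case False
      then have "r \<oplus> one \<prec> m" using qr(2) succ_leq leq_def by blast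
      moreover have "x \<oplus> one = q \<otimes> m \<oplus> (r \<oplus> one)" using qr(3) by (simp add: add_assoc)
      ultimately show ?thesis using qr(1) less_succ by blast
    qed
  qed
  then show ?thesis by blast
qed

text \<open>An injective polynomial, hence a term of the language; the Cantor pairing would involve
  division by two.\<close>

definition pr :: "'a \<Rightarrow> 'a \<Rightarrow> 'a" where
  "pr x y = (x \<oplus> y) \<otimes> (x \<oplus> y) \<oplus> x"

lemma trm_pr: "trm f \<Longrightarrow> trm g \<Longrightarrow> trm (\<lambda>e. pr (f e) (g e))"
  unfolding pr_def by (intro trm_intros)

text \<open>With s = x + y, the value lies between s^2 and s^2 + s, hence below (s + 1)^2.\<close>

lemma pr_less_aux:
  assumes "x \<oplus> y \<prec> x' \<oplus> y'"
  shows "pr x y \<prec> pr x' y'"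
proof -
  let ?s = "x \<oplus> y" and ?t = "x' \<oplus> y'"
  have sq: "(s \<oplus> one) \<otimes> (s \<oplus> one) = s \<otimes> s \<oplus> s \<oplus> s \<oplus> one" for s
    by (simp add: mul_succ succ_mul add_assoc)
  have "pr x y \<preceq> ?s \<otimes> ?s \<oplus> ?s"
    unfolding pr_def by (intro add_leq_mono leq_add M.order_refl)
  also have "\<dots> \<prec> (?s \<oplus> one) \<otimes> (?s \<oplus> one)"
    unfolding less_iff_add sq by blast
  also have "\<dots> \<preceq> ?t \<otimes> ?t" using assms by (intro mul_leq_mono) (simp_all add: succ_leq)
  also have "\<dots> \<preceq> pr x' y'" unfolding pr_def by (rule leq_add)
  finally show ?thesis .
qed

lemma pr_inject: "pr x y = pr x' y' \<longleftrightarrow> x = x' \<and> y = y'"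
proof
  assume *: "pr x y = pr x' y'"
  then have s: "x \<oplus> y = x' \<oplus> y'"
    using pr_less_aux[of x y x' y'] pr_less_aux[of x' y' x y] less_linear less_irrefl by metis
  with * have "x = x'" by (simp add: pr_def add_left_cancel)
  with s show "x = x' \<and> y = y'" by (simp add: add_left_cancel)
qed simp

lemma pr_less: "x \<prec> x' \<Longrightarrow> y \<prec> y' \<Longrightarrow> pr x y \<prec> pr x' y'"
  by (intro pr_less_aux) (meson add_less_mono add_leq_mono M.less_imp_le M.less_le_trans M.order_refl)

lemma leq_pr: "y \<preceq> pr x y"
proof -
  have sq: "z \<preceq> z \<otimes> z" for z
    using zero_or_succ[of z] by (auto simp: mul_zero mul_succ leq_add zero_leq)
  have "y \<preceq> x \<oplus> y" by (rule leq_add)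
  also have "\<dots> \<preceq> (x \<oplus> y) \<otimes> (x \<oplus> y)" by (rule sq)
  also have "\<dots> \<preceq> pr x y" unfolding pr_def by (rule leq_add)
  finally show ?thesis .
qed

section \<open>The arithmetical hierarchy under collection\<close>

lemma case_nat_eta [simp]: "case_nat (e 0) (\<lambda>i. e (Suc i)) = e"
  by (auto split: nat.split)

lemma trm_case_nat: "trm f \<Longrightarrow> (\<And>j. trm (g j)) \<Longrightarrow> trm (\<lambda>e. case_nat (f e) (\<lambda>j. g j e) i)"
  by (cases i) auto

lemma Sg_subst: "Sg k P \<Longrightarrow> (\<And>i. trm (f i)) \<Longrightarrow> Sg k (\<lambda>e. P (\<lambda>i. f i e))"
proof (induction k arbitrary: P f)
  case 0
  then show ?case using dfn_subst Delta0_substf by simp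
next
  case (Suc k)
  from Suc.prems obtain R where R: "Sg k R" "P = (\<lambda>e. \<exists>z. \<not> R (case_nat z e))" by auto
  define g where "g i = (\<lambda>e::nat \<Rightarrow> 'a. case_nat (e 0) (\<lambda>i. f i (\<lambda>j. e (Suc j))) i)" for i
  have "trm (\<lambda>e. f i (\<lambda>j. e (Suc j)))" for i
    using trm_subst[OF Suc.prems(2), of "\<lambda>j e. e (Suc j)"] by (simp add: trm_var)
  then have "trm (g i)" for i unfolding g_def by (intro trm_case_nat trm_var)
  then have "Sg k (\<lambda>e. R (\<lambda>i. g i e))" using R(1) by (rule Suc.IH[rotated])
  moreover have "case_nat z (\<lambda>i. f i e) = (\<lambda>i. g i (case_nat z e))" for z e
    by (auto simp: g_def fun_eq_iff split: nat.split)
  then have "(\<lambda>e. P (\<lambda>i. f i e)) = (\<lambda>e. \<exists>z. \<not> R (\<lambda>i. g i (case_nat z e)))"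
    by (simp add: R(2))
  ultimately show ?case by (auto intro!: exI[of _ "\<lambda>e. R (\<lambda>i. g i e)"])
qed

lemma Sg_re:
  assumes "Sg k (\<lambda>e. R (e 0) (\<lambda>i. e (Suc i)))" "trm f" "\<And>i. trm (g i)"
  shows "Sg k (\<lambda>e. R (f e) (\<lambda>i. g i e))"
  using Sg_subst[OF assms(1), of "case_nat f g"] assms(2,3) by (simp split: nat.split)

lemma Sg_re2:
  assumes "Sg k (\<lambda>e. R (e 0) (e 1) (\<lambda>i. e (Suc (Suc i))))" "trm f" "trm f'" "\<And>i. trm (g i)"
  shows "Sg k (\<lambda>e. R (f e) (f' e) (\<lambda>i. g i e))"
  using Sg_subst[OF assms(1), of "case_nat f (case_nat f' g)"] assms(2-4) by (simp split: nat.split)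

lemma Sg_SucI:
  assumes "Sg k (\<lambda>e. \<not> P (e 0) (\<lambda>i. e (Suc i)))"
  shows "Sg (Suc k) (\<lambda>e. \<exists>z. P z e)"
  using assms by (auto intro!: exI[of _ "\<lambda>e. \<not> P (e 0) (\<lambda>i. e (Suc i))"])

lemma Sg_SucD:
  assumes "Sg (Suc k) P"
  shows "\<exists>R. Sg k (\<lambda>e. \<not> R (e 0) (\<lambda>i. e (Suc i))) \<and> (\<forall>e. P e \<longleftrightarrow> (\<exists>z. R z e))"
proof -
  from assms obtain R where "Sg k R" "P = (\<lambda>e. \<exists>z. \<not> R (case_nat z e))" by auto
  then show ?thesis by (intro exI[of _ "\<lambda>z e. \<not> R (case_nat z e)"]) simp
qed

lemma Sg_SucD1:
  assumes "Sg (Suc k) (\<lambda>e. P (e 0) (\<lambda>i. e (Suc i)))"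
  shows "\<exists>R. Sg k (\<lambda>e. \<not> R (e 0) (e 1) (\<lambda>i. e (Suc (Suc i)))) \<and> (\<forall>x e. P x e \<longleftrightarrow> (\<exists>z. R z x e))"
proof -
  from Sg_SucD[OF assms] obtain R where
    "Sg k (\<lambda>e. \<not> R (e 0) (\<lambda>i. e (Suc i))) \<and> (\<forall>e. P (e 0) (\<lambda>i. e (Suc i)) \<longleftrightarrow> (\<exists>z. R z e))" ..
  then have R: "Sg k (\<lambda>e. \<not> R (e 0) (\<lambda>i. e (Suc i)))"
    "\<And>e. P (e 0) (\<lambda>i. e (Suc i)) \<longleftrightarrow> (\<exists>z. R z e)" by blast+
  have "case_nat (e 1) (\<lambda>i. e (Suc (Suc i))) = (\<lambda>i. e (Suc i))" for e :: "nat \<Rightarrow> 'a"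
    by (auto split: nat.split)
  with R(1) have "Sg k (\<lambda>e. \<not> R (e 0) (case_nat (e 1) (\<lambda>i. e (Suc (Suc i)))))" by simp
  moreover have "P x e \<longleftrightarrow> (\<exists>z. R z (case_nat x e))" for x e
    using R(2)[of "case_nat x e"] by simp
  ultimately show ?thesis by (intro exI[of _ "\<lambda>z x e. R z (case_nat x e)"] conjI allI)
qed

lemma Sg_Suc_not: "Sg k P \<Longrightarrow> Sg (Suc k) (\<lambda>e. \<not> P e)"
proof -
  assume "Sg k P"
  then have "Sg k (\<lambda>e. \<not> \<not> P (\<lambda>i. e (Suc i)))"
    using Sg_subst[of k P "\<lambda>i e. e (Suc i)"] by (simp add: trm_var)
  then have "Sg (Suc k) (\<lambda>e. \<exists>z::'a. \<not> P e)" by (rule Sg_SucI)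
  then show ?thesis by simp
qed

lemma Sg_Suc: "Sg k P \<Longrightarrow> Sg (Suc k) P"
proof (induction k arbitrary: P)
  case 0
  then have "Sg 0 (\<lambda>e. \<not> P e)" by (rule Sg0_not)
  from Sg_Suc_not[OF this] show ?case by (simp only: not_not)
next
  case (Suc k)
  from Suc.prems obtain R where "Sg k R" "P = (\<lambda>e. \<exists>z. \<not> R (case_nat z e))" by auto
  with Suc.IH show ?case by (subst Sg.simps(2)) blast
qed

lemma Sg_mono: "Sg m P \<Longrightarrow> m \<le> n \<Longrightarrow> Sg n P"
  by (rotate_tac 1, induction rule: dec_induct) (auto intro: Sg_Suc simp del: Sg.simps)

definition BS :: "nat \<Rightarrow> bool" where
  "BS k \<longleftrightarrow> (\<forall>P a. Sg k (\<lambda>e. P (e 0) (e 1)) \<longrightarrow> (\<forall>x. x \<prec> a \<longrightarrow> (\<exists>y. P x y)) \<longrightarrow>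
     (\<exists>b. \<forall>x. x \<prec> a \<longrightarrow> (\<exists>y. y \<prec> b \<and> P x y)))"

lemma BSD: "BS k \<Longrightarrow> Sg k (\<lambda>e. P (e 0) (e 1)) \<Longrightarrow> (\<And>x. x \<prec> a \<Longrightarrow> \<exists>y. P x y) \<Longrightarrow>
    \<exists>b. \<forall>x. x \<prec> a \<longrightarrow> (\<exists>y. y \<prec> b \<and> P x y)"
  unfolding BS_def by blast

lemma BS_mono: "BS n \<Longrightarrow> m \<le> n \<Longrightarrow> BS m"
  unfolding BS_def using Sg_mono[of m _ n] by blast

definition bounded_closed :: "nat \<Rightarrow> bool" where
  "bounded_closed k \<longleftrightarrow>
    (\<forall>P Q. Sg k P \<longrightarrow> Sg k Q \<longrightarrow> Sg k (\<lambda>e. P e \<and> Q e)) \<and>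
    (\<forall>P Q. Sg k P \<longrightarrow> Sg k Q \<longrightarrow> Sg k (\<lambda>e. P e \<or> Q e)) \<and>
    (\<forall>P f. Sg k (\<lambda>e. P (e 0) (\<lambda>i. e (Suc i))) \<longrightarrow> trm f \<longrightarrow> Sg k (\<lambda>e. \<forall>x. x \<prec> f e \<longrightarrow> P x e)) \<and>
    (\<forall>P f. Sg k (\<lambda>e. P (e 0) (\<lambda>i. e (Suc i))) \<longrightarrow> trm f \<longrightarrow> Sg k (\<lambda>e. \<exists>x. x \<prec> f e \<and> P x e))"

lemma bound2: "\<exists>b. x \<prec> b \<and> y \<prec> b"
proof (rule exI[of _ "x \<oplus> y \<oplus> one"], intro conjI)
  show "x \<prec> x \<oplus> y \<oplus> one" by (simp add: less_succ_leq leq_add)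
  show "y \<prec> x \<oplus> y \<oplus> one" by (simp add: less_succ_leq leq_add)
qed

text \<open>Witnesses of two existential statements get a common bound, and collection gives one
  bound for the witnesses of all \<open>x\<close> below \<open>f e\<close>. After this the matrix is
  the negation of a level-\<open>k\<close> relation, so each closure property rests on dual
  properties one level below; hence the bundling into one induction.\<close>

lemma bounded_closedI: "BS k \<Longrightarrow> bounded_closed k"
proof (induction k)
  case 0
  show ?case unfolding bounded_closed_def using Sg0_and Sg0_or Sg0_ball Sg0_bex by blast
next
  case (Suc k)
  then have k: "bounded_closed k" using BS_mono[of "Suc k" k] by simp
  have and_k: "Sg k P \<Longrightarrow> Sg k Q \<Longrightarrow> Sg k (\<lambda>e. P e \<and> Q e)"
    and or_k: "Sg k P \<Longrightarrow> Sg k Q \<Longrightarrow> Sg k (\<lambda>e. P e \<or> Q e)" for P Q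
    using k by (simp_all add: bounded_closed_def del: Sg.simps)
  have ball_k: "Sg k (\<lambda>e. P (e 0) (\<lambda>i. e (Suc i))) \<Longrightarrow> trm f \<Longrightarrow> Sg k (\<lambda>e. \<forall>x. x \<prec> f e \<longrightarrow> P x e)"
    and bex_k: "Sg k (\<lambda>e. P (e 0) (\<lambda>i. e (Suc i))) \<Longrightarrow> trm f \<Longrightarrow> Sg k (\<lambda>e. \<exists>x. x \<prec> f e \<and> P x e)" for P f
    using k by (simp_all add: bounded_closed_def del: Sg.simps)
  show ?case unfolding bounded_closed_def
  proof (intro conjI allI impI)
    fix P Q assume "Sg (Suc k) P" "Sg (Suc k) Q"
    note PQ = this
    from Sg_SucD[OF PQ(1)] obtain R where
      "Sg k (\<lambda>e. \<not> R (e 0) (\<lambda>i. e (Suc i))) \<and> (\<forall>e. P e \<longleftrightarrow> (\<exists>z. R z e))" ..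
    then have R: "Sg k (\<lambda>e. \<not> R (e 0) (\<lambda>i. e (Suc i)))" "\<And>e. P e \<longleftrightarrow> (\<exists>z. R z e)" by blast+
    from Sg_SucD[OF PQ(2)] obtain S where
      "Sg k (\<lambda>e. \<not> S (e 0) (\<lambda>i. e (Suc i))) \<and> (\<forall>e. Q e \<longleftrightarrow> (\<exists>z. S z e))" ..
    then have S: "Sg k (\<lambda>e. \<not> S (e 0) (\<lambda>i. e (Suc i)))" "\<And>e. Q e \<longleftrightarrow> (\<exists>z. S z e)" by blast+
    have "Sg k (\<lambda>e. (\<forall>z. z \<prec> e 0 \<longrightarrow> \<not> R z (\<lambda>i. e (Suc i))) \<or> (\<forall>z. z \<prec> e 0 \<longrightarrow> \<not> S z (\<lambda>i. e (Suc i))))"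
      by (intro or_k ball_k trm_intros Sg_re[OF R(1)] Sg_re[OF S(1)])
    then have "Sg (Suc k) (\<lambda>e. \<exists>b. (\<exists>z. z \<prec> b \<and> R z e) \<and> (\<exists>z. z \<prec> b \<and> S z e))"
      by (intro Sg_SucI) simp
    also have "(\<lambda>e. \<exists>b. (\<exists>z. z \<prec> b \<and> R z e) \<and> (\<exists>z. z \<prec> b \<and> S z e)) = (\<lambda>e. P e \<and> Q e)"
      unfolding R(2) S(2) by (intro ext iffI; use bound2 in blast)
    finally show "Sg (Suc k) (\<lambda>e. P e \<and> Q e)" .
    have "Sg k (\<lambda>e. \<not> R (e 0) (\<lambda>i. e (Suc i)) \<and> \<not> S (e 0) (\<lambda>i. e (Suc i)))"
      using R(1) S(1) by (rule and_k)
    then have "Sg (Suc k) (\<lambda>e. \<exists>z. R z e \<or> S z e)" by (intro Sg_SucI) simp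
    then show "Sg (Suc k) (\<lambda>e. P e \<or> Q e)" unfolding R(2) S(2) ex_disj_distrib .
  next
    fix P f assume "Sg (Suc k) (\<lambda>e. P (e 0) (\<lambda>i. e (Suc i)))" and f: "trm f"
    from Sg_SucD1[OF this(1)] obtain R where
      "Sg k (\<lambda>e. \<not> R (e 0) (e 1) (\<lambda>i. e (Suc (Suc i)))) \<and> (\<forall>x e. P x e \<longleftrightarrow> (\<exists>z. R z x e))" ..
    then have R: "Sg k (\<lambda>e. \<not> R (e 0) (e 1) (\<lambda>i. e (Suc (Suc i))))"
      "\<And>x e. P x e \<longleftrightarrow> (\<exists>z. R z x e)" by blast+
    have f': "trm (\<lambda>e. f (\<lambda>i. e (Suc i)))" using trm_subst[OF f, of "\<lambda>i e. e (Suc i)"] trm_var by simp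
    have "Sg k (\<lambda>e. \<exists>x. x \<prec> f (\<lambda>i. e (Suc i)) \<and> (\<forall>z. z \<prec> e 0 \<longrightarrow> \<not> R z x (\<lambda>i. e (Suc i))))"
      by (intro bex_k ball_k f' trm_intros Sg_re2[OF R(1)])
    then have "Sg (Suc k) (\<lambda>e. \<exists>b. \<forall>x. x \<prec> f e \<longrightarrow> (\<exists>z. z \<prec> b \<and> R z x e))"
      by (intro Sg_SucI) simp
    also have "(\<lambda>e. \<exists>b. \<forall>x. x \<prec> f e \<longrightarrow> (\<exists>z. z \<prec> b \<and> R z x e)) = (\<lambda>e. \<forall>x. x \<prec> f e \<longrightarrow> P x e)"
    proof (intro ext iffI)
      fix e assume *: "\<forall>x. x \<prec> f e \<longrightarrow> P x e"
      \<comment> \<open>The environment \<open>e\<close> is frozen into parameters, since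
        \<open>BS\<close> speaks of relations between two numbers only.\<close>
      have "Sg k (\<lambda>e'. \<not> R (e' 1) (e' 0) (\<lambda>i. e i))"
        by (intro Sg_re2[OF R(1)] trm_intros)
      then have "Sg (Suc k) (\<lambda>e'. R (e' 1) (e' 0) (\<lambda>i. e i))"
        using Sg_Suc_not by fastforce
      then show "\<exists>b. \<forall>x. x \<prec> f e \<longrightarrow> (\<exists>z. z \<prec> b \<and> R z x e)"
        using BSD[OF Suc.prems, of "\<lambda>x z. R z x e" "f e"] * R(2) by simp
    qed (auto simp: R(2))
    finally show "Sg (Suc k) (\<lambda>e. \<forall>x. x \<prec> f e \<longrightarrow> P x e)" .
    have "Sg k (\<lambda>e. \<forall>x. x \<prec> f (\<lambda>i. e (Suc i)) \<longrightarrow> \<not> R (e 0) x (\<lambda>i. e (Suc i)))"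
      by (intro ball_k f' trm_intros Sg_re2[OF R(1)])
    then have "Sg (Suc k) (\<lambda>e. \<exists>z. \<exists>x. x \<prec> f e \<and> R z x e)"
      by (intro Sg_SucI) simp
    also have "(\<lambda>e. \<exists>z. \<exists>x. x \<prec> f e \<and> R z x e) = (\<lambda>e. \<exists>x. x \<prec> f e \<and> P x e)"
      unfolding R(2) by blast
    finally show "Sg (Suc k) (\<lambda>e. \<exists>x. x \<prec> f e \<and> P x e)" .
  qed
qed

lemma
  assumes "BS k"
  shows Sg_and: "Sg k P \<Longrightarrow> Sg k Q \<Longrightarrow> Sg k (\<lambda>e. P e \<and> Q e)"
    and Sg_or: "Sg k P \<Longrightarrow> Sg k Q \<Longrightarrow> Sg k (\<lambda>e. P e \<or> Q e)"
    and Sg_ball: "Sg k (\<lambda>e. S (e 0) (\<lambda>i. e (Suc i))) \<Longrightarrow> trm f \<Longrightarrow> Sg k (\<lambda>e. \<forall>x. x \<prec> f e \<longrightarrow> S x e)"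
    and Sg_bex: "Sg k (\<lambda>e. S (e 0) (\<lambda>i. e (Suc i))) \<Longrightarrow> trm f \<Longrightarrow> Sg k (\<lambda>e. \<exists>x. x \<prec> f e \<and> S x e)"
  using bounded_closedI[OF assms] by (simp_all add: bounded_closed_def del: Sg.simps)

text \<open>Two adjacent quantifiers are replaced by one quantifier over a common bound of both
  witnesses, followed by bounded quantifiers, which level \<open>k\<close> absorbs.\<close>

lemma Sg_ex:
  assumes "BS (Suc k)" "Sg (Suc k) (\<lambda>e. P (e 0) (\<lambda>i. e (Suc i)))"
  shows "Sg (Suc k) (\<lambda>e. \<exists>x. P x e)"
proof -
  have k: "BS k" using BS_mono[OF assms(1), of k] by simp
  from Sg_SucD1[OF assms(2)] obtain R where
    "Sg k (\<lambda>e. \<not> R (e 0) (e 1) (\<lambda>i. e (Suc (Suc i)))) \<and> (\<forall>x e. P x e \<longleftrightarrow> (\<exists>z. R z x e))" ..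
  then have R: "Sg k (\<lambda>e. \<not> R (e 0) (e 1) (\<lambda>i. e (Suc (Suc i))))"
    "\<And>x e. P x e \<longleftrightarrow> (\<exists>z. R z x e)" by blast+
  have "Sg k (\<lambda>e. \<forall>x. x \<prec> e 0 \<longrightarrow> (\<forall>z. z \<prec> e 0 \<longrightarrow> \<not> R z x (\<lambda>i. e (Suc i))))"
    by (intro Sg_ball[OF k] trm_intros Sg_re2[OF R(1)])
  then have "Sg (Suc k) (\<lambda>e. \<exists>b. \<exists>x. x \<prec> b \<and> (\<exists>z. z \<prec> b \<and> R z x e))"
    by (intro Sg_SucI) simp
  also have "(\<lambda>e. \<exists>b. \<exists>x. x \<prec> b \<and> (\<exists>z. z \<prec> b \<and> R z x e)) = (\<lambda>e. \<exists>x. P x e)"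
    unfolding R(2) by (intro ext iffI; use bound2 in blast)
  finally show ?thesis .
qed

lemma trm_evt: "trm (\<lambda>e. evt e t)"
  by (induction t) (simp_all add: trm_intros)

lemma Delta0_Sg0:
  assumes Y: "Sg 0 (\<lambda>e. mem (e 0) Y)"
  shows "Delta0 p \<Longrightarrow> Sg 0 (\<lambda>e. ev e (\<lambda>_. Y) p)"
proof (induction rule: Delta0.induct)
  case (1 s t)
  show ?case unfolding ev.simps by (intro Sg0_eq trm_evt)
next
  case (2 s t)
  show ?case unfolding ev.simps by (intro Sg0_less trm_evt)
next
  case (3 t Z)
  show ?case unfolding ev.simps using Sg_subst[OF Y, of "\<lambda>_ e. evt e t"] trm_evt by blast
next
  case 4
  show ?case unfolding ev.simps by (rule Sg0_bool)
next
  case (5 p q)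
  then show ?case unfolding ev.simps by (intro Sg0_imp)
next
  case (6 p t)
  then show ?case unfolding ev_ball by (intro Sg0_ball trm_evt) (simp del: Sg.simps)
next
  case (7 p t)
  then show ?case unfolding ev_bex by (intro Sg0_bex trm_evt) (simp del: Sg.simps)
qed

text \<open>For \<open>Y = X\<close> the assumption is trivial; in general \<open>X\<close> is a join having \<open>Y\<close> as a part.\<close>

lemma Sigma_Pi_Sg:
  assumes Y: "Sg 0 (\<lambda>e. mem (e 0) Y)"
  shows "Sigma n p \<Longrightarrow> BS n \<longrightarrow> Sg n (\<lambda>e. ev e (\<lambda>_. Y) p)"
    "Pi n p \<Longrightarrow> BS n \<longrightarrow> Sg n (\<lambda>e. \<not> ev e (\<lambda>_. Y) p)"
proof (induction rule: Sigma_Pi.inducts)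
  case (1 p)
  then show ?case using Delta0_Sg0[OF Y] by blast
next
  case (2 n p)
  show ?case
  proof (intro impI)
    assume "BS (Suc n)"
    then have "Sg n (\<lambda>e. \<not> ev e (\<lambda>_. Y) p)" using 2 BS_mono[of "Suc n" n] by simp
    from Sg_Suc_not[OF this] show "Sg (Suc n) (\<lambda>e. ev e (\<lambda>_. Y) p)" by (simp only: not_not)
  qed
next
  case (3 n p)
  show ?case
  proof (intro impI)
    assume "BS (Suc n)"
    then have "Sg (Suc n) (\<lambda>e. ev (case_nat (e 0) (\<lambda>i. e (Suc i))) (\<lambda>_. Y) p)"
      using 3 by (simp del: Sg.simps)
    from Sg_ex[OF \<open>BS (Suc n)\<close> this] show "Sg (Suc n) (\<lambda>e. ev e (\<lambda>_. Y) (ExN p))" by (simp del: Sg.simps)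
  qed
next
  case (4 p)
  then show ?case using Sg0_not[OF Delta0_Sg0[OF Y]] by blast
next
  case (5 n p)
  show ?case
  proof (intro impI)
    assume "BS (Suc n)"
    then have "Sg n (\<lambda>e. ev e (\<lambda>_. Y) p)" using 5 BS_mono[of "Suc n" n] by simp
    from Sg_Suc_not[OF this] show "Sg (Suc n) (\<lambda>e. \<not> ev e (\<lambda>_. Y) p)" .
  qed
next
  case (6 n p)
  show ?case
  proof (intro impI)
    assume "BS (Suc n)"
    then have "Sg (Suc n) (\<lambda>e. \<not> ev (case_nat (e 0) (\<lambda>i. e (Suc i))) (\<lambda>_. Y) p)"
      using 6 by (simp del: Sg.simps)
    from Sg_ex[OF \<open>BS (Suc n)\<close> this] show "Sg (Suc n) (\<lambda>e. \<not> ev e (\<lambda>_. Y) (AllN p))" by (simp del: Sg.simps)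
  qed
qed

lemma Sigma_Pi_dual:
  "Sigma n p \<Longrightarrow> \<exists>q. Pi n q \<and> setbd q = setbd p \<and> (\<forall>e s. ev e s q \<longleftrightarrow> \<not> ev e s p)"
  "Pi n p \<Longrightarrow> \<exists>q. Sigma n q \<and> setbd q = setbd p \<and> (\<forall>e s. ev e s q \<longleftrightarrow> \<not> ev e s p)"
proof (induction rule: Sigma_Pi.inducts)
  case (1 p)
  then show ?case by (intro exI[of _ "Neg p"]) (auto intro: Sigma_Pi.intros Delta0.intros)
next
  case (4 p)
  then show ?case by (intro exI[of _ "Neg p"]) (auto intro: Sigma_Pi.intros Delta0.intros)
next
  case (2 n p)
  then show ?case by (blast intro: Sigma_Pi.intros)
next
  case (5 n p)
  then show ?case by (blast intro: Sigma_Pi.intros)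
next
  case (3 n p)
  then obtain q where "Pi (Suc n) q" "setbd q = setbd p" "\<forall>e s. ev e s q \<longleftrightarrow> \<not> ev e s p" by blast
  then show ?case by (intro exI[of _ "AllN q"]) (auto intro: Sigma_Pi.intros)
next
  case (6 n p)
  then obtain q where "Sigma (Suc n) q" "setbd q = setbd p" "\<forall>e s. ev e s q \<longleftrightarrow> \<not> ev e s p" by blast
  then show ?case by (intro exI[of _ "ExN q"]) (auto intro: Sigma_Pi.intros)
qed

text \<open>The way back from relations to formulas, required because collection is given for
  formulas. A negated prenex formula is not prenex, so the inner formula is replaced by its
  dual.\<close>

lemma Sg_Sigma: "Sg k P \<Longrightarrow> dfn (Sigma k) P"
proof (induction k arbitrary: P)
  case 0
  then show ?case unfolding Sg.simps dfn_def by (meson Sigma_Pi.intros(1))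
next
  case (Suc k)
  from Sg_SucD[OF Suc.prems] obtain R where
    "Sg k (\<lambda>e. \<not> R (e 0) (\<lambda>i. e (Suc i))) \<and> (\<forall>e. P e \<longleftrightarrow> (\<exists>z. R z e))" ..
  then have R: "Sg k (\<lambda>e. \<not> R (e 0) (\<lambda>i. e (Suc i)))" "\<And>e. P e \<longleftrightarrow> (\<exists>z. R z e)" by blast+
  from dfn_bind[OF Suc.IH[OF R(1)] Sigma_Pi_substf(1)] obtain p c where
    pc: "Sigma k p" "setbd p \<le> 1" "\<And>x e. \<not> R x e \<longleftrightarrow> tr (case_nat x (merge e c)) p" by metis
  from Sigma_Pi_dual(1)[OF pc(1)] obtain q where
    q: "Pi k q" "setbd q = setbd p" "\<forall>e s. ev e s q \<longleftrightarrow> \<not> ev e s p" by blast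
  have "P = (\<lambda>e. tr (merge e c) (ExN q))"
    using q(3) by (simp add: R(2) fun_eq_iff flip: pc(3))
  moreover have "Sigma (Suc k) (ExN q)" using q(1) by (intro Sigma_Pi.intros)
  ultimately show ?case unfolding dfn_def using pc(2) q(2)
    by (intro exI[of _ "ExN q"] exI[of _ c]) simp
qed

lemma BS_Coll:
  assumes "\<And>p e. p \<in> SigmaX k \<Longrightarrow> tr e (Coll p)"
  shows "BS k"
  unfolding BS_def
proof (intro allI impI)
  fix P a assume "Sg k (\<lambda>e. P (e 0) (e 1))" and total: "\<forall>x. x \<prec> a \<longrightarrow> (\<exists>y. P x y)"
  from Sg_Sigma[OF this(1)] obtain p c where
    p: "Sigma k p" "setbd p \<le> 1" "(\<lambda>e. P (e 0) (e 1)) = (\<lambda>e. tr (merge e c) p)"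
    by (auto simp: dfn_def)
  \<comment> \<open>This undoes the interleaving: positions 0 and 2 are the displayed arguments of
    \<open>Coll\<close>, odd positions are its parameters. The other even positions are variables
    that \<open>P\<close> ignores; they are set to zero.\<close>
  define \<sigma> where "\<sigma> i = (if i = 0 then Var 0 else if i = 2 then Var 1
      else if odd i then Var (Suc (Suc (i div 2))) else Zero)" for i
  have P: "P x y \<longleftrightarrow> tr (case_nat x (case_nat y c)) (substf \<sigma> id p)" for x y
  proof -
    have "P x y \<longleftrightarrow> tr (merge (case_nat x (case_nat y (\<lambda>_. zero))) c) p"
      using fun_cong[OF p(3), of "case_nat x (case_nat y (\<lambda>_. zero))"] by simp
    also have "\<dots> \<longleftrightarrow> tr (\<lambda>i. evt (case_nat x (case_nat y c)) (\<sigma> i)) p"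
      by (intro ev_cong) (auto simp: merge_def \<sigma>_def elim!: evenE split: nat.split)
    finally show ?thesis by (simp add: ev_substf)
  qed
  have app3: "tr (case_nat y (case_nat x (case_nat a c))) (app (substf \<sigma> id p) [Var (Suc 0), Var 0] 3) \<longleftrightarrow> P x y"
    for x y a
    unfolding P ev_app by (intro ev_cong) (auto simp: nth_Cons numeral_3_eq_3 split: nat.split)
  have app4: "tr (case_nat y (case_nat x (case_nat b (case_nat a c)))) (app (substf \<sigma> id p) [Var (Suc 0), Var 0] 4)
      \<longleftrightarrow> P x y" for x y a b
    unfolding P ev_app by (intro ev_cong) (auto simp: nth_Cons eval_nat_numeral split: nat.split)
  have "substf \<sigma> id p \<in> SigmaX k" using p(1,2) Sigma_Pi_substf(1) by (simp add: SigmaX_def)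
  from assms[OF this, of c] total
  show "\<exists>b. \<forall>x. x \<prec> a \<longrightarrow> (\<exists>y. y \<prec> b \<and> P x y)"
    by (simp add: Coll_def app3 app4)
qed

end

section \<open>Relations that are both existential and universal\<close>

locale collection_model = set_model zero one add mul less mem X
  for zero one :: 'a
    and add mul :: "'a \<Rightarrow> 'a \<Rightarrow> 'a"
    and less :: "'a \<Rightarrow> 'a \<Rightarrow> bool"
    and mem :: "'a \<Rightarrow> 's \<Rightarrow> bool"
    and X :: 's +
  fixes k :: nat
  assumes BS: "BS (Suc k)"
begin

abbreviation Sk :: "((nat \<Rightarrow> 'a) \<Rightarrow> bool) \<Rightarrow> bool" where
  "Sk \<equiv> Sg (Suc k)"

text \<open>The Delta relations of level \<open>Suc k\<close>. The level is at least one, which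
  makes room for the graph of exponentiation.\<close>

definition D :: "((nat \<Rightarrow> 'a) \<Rightarrow> bool) \<Rightarrow> bool" where
  "D P \<longleftrightarrow> Sk P \<and> Sk (\<lambda>e. \<not> P e)"

text \<open>Functions with a Delta graph. Like terms, they can be substituted into Delta relations
  and can bound quantifiers.\<close>

definition dtrm :: "((nat \<Rightarrow> 'a) \<Rightarrow> 'a) \<Rightarrow> bool" where
  "dtrm f \<longleftrightarrow> D (\<lambda>e. e 0 = f (\<lambda>i. e (Suc i)))"

lemma D_Sg0: "Sg 0 P \<Longrightarrow> D P"
  unfolding D_def using Sg_mono[of 0 _ "Suc k"] Sg0_not by simp

lemma D_Sgk: "Sg k P \<Longrightarrow> D P" "Sg k (\<lambda>e. \<not> P e) \<Longrightarrow> D P"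
proof -
  show "Sg k P \<Longrightarrow> D P" unfolding D_def using Sg_Suc Sg_Suc_not by blast
  show "Sg k (\<lambda>e. \<not> P e) \<Longrightarrow> D P" unfolding D_def using Sg_Suc Sg_Suc_not[of k "\<lambda>e. \<not> P e"] by simp
qed

lemma D_not: "D P \<Longrightarrow> D (\<lambda>e. \<not> P e)"
  by (simp add: D_def del: Sg.simps)

lemma D_bool: "D (\<lambda>e. b)"
  by (intro D_Sg0 Sg0_bool)

lemma D_and: "D P \<Longrightarrow> D Q \<Longrightarrow> D (\<lambda>e. P e \<and> Q e)"
  unfolding D_def de_Morgan_conj using Sg_and[OF BS] Sg_or[OF BS] by blast

lemma D_or: "D P \<Longrightarrow> D Q \<Longrightarrow> D (\<lambda>e. P e \<or> Q e)"
  unfolding D_def de_Morgan_disj using Sg_and[OF BS] Sg_or[OF BS] by blast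

lemma D_imp: "D P \<Longrightarrow> D Q \<Longrightarrow> D (\<lambda>e. P e \<longrightarrow> Q e)"
  unfolding imp_conv_disj by (intro D_or D_not)

lemma D_iff: "D P \<Longrightarrow> D Q \<Longrightarrow> D (\<lambda>e. P e \<longleftrightarrow> Q e)"
  unfolding iff_conv_conj_imp by (intro D_and D_imp)

lemma D_subst: "D P \<Longrightarrow> (\<And>i. trm (f i)) \<Longrightarrow> D (\<lambda>e. P (\<lambda>i. f i e))"
  unfolding D_def using Sg_subst[of "Suc k" P f] Sg_subst[of "Suc k" "\<lambda>e. \<not> P e" f]
  by (simp del: Sg.simps)

text \<open>The quantifier over the value of \<open>f\<close> can be taken existentially or universally.\<close>

lemma D_dtrm:
  assumes "D (\<lambda>e. P (e 0) (\<lambda>i. e (Suc i)))" "dtrm f"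
  shows "D (\<lambda>e. P (f e) e)"
proof -
  have "D (\<lambda>e. e 0 = f (\<lambda>i. e (Suc i)) \<and> P (e 0) (\<lambda>i. e (Suc i)))"
    using assms(2,1) unfolding dtrm_def by (rule D_and)
  moreover have "D (\<lambda>e. e 0 = f (\<lambda>i. e (Suc i)) \<and> \<not> P (e 0) (\<lambda>i. e (Suc i)))"
    using assms(2) D_not[OF assms(1)] unfolding dtrm_def by (rule D_and)
  ultimately have "Sk (\<lambda>e. \<exists>y. y = f e \<and> P y e)" "Sk (\<lambda>e. \<exists>y. y = f e \<and> \<not> P y e)"
    by (intro Sg_ex[OF BS]; simp add: D_def del: Sg.simps)+
  then show ?thesis by (simp add: D_def del: Sg.simps)
qed

lemma dtrm_subst: "dtrm f \<Longrightarrow> (\<And>i. trm (g i)) \<Longrightarrow> dtrm (\<lambda>e. f (\<lambda>i. g i e))"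
proof -
  assume "dtrm f" "\<And>i. trm (g i)"
  then have "D (\<lambda>e. e 0 = f (\<lambda>i. g i (\<lambda>i. e (Suc i))))"
    using D_subst[of "\<lambda>e. e 0 = f (\<lambda>i. e (Suc i))" "case_nat (\<lambda>e. e 0) (\<lambda>i e. g i (\<lambda>j. e (Suc j)))"]
      trm_subst[of "g _" "\<lambda>i e. e (Suc i)"]
    by (simp add: dtrm_def trm_var split: nat.split)
  then show ?thesis by (simp add: dtrm_def)
qed

lemma dtrm_trm: "trm f \<Longrightarrow> dtrm f"
  unfolding dtrm_def using trm_subst[of f "\<lambda>i e. e (Suc i)"] trm_var
  by (intro D_Sg0 Sg0_eq) simp_all

lemma dtrm_comp:
  assumes "dtrm (\<lambda>e. h (e 0) (\<lambda>i. e (Suc i)))" "dtrm f"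
  shows "dtrm (\<lambda>e. h (f e) e)"
proof -
  have "dtrm (\<lambda>e. f (\<lambda>i. e (Suc i)))" using dtrm_subst[OF assms(2)] trm_var by simp
  moreover have "D (\<lambda>e. e 1 = h (e 0) (\<lambda>i. e (Suc (Suc i))))"
    using D_subst[OF assms(1)[unfolded dtrm_def], of "case_nat (\<lambda>e. e 1) (case_nat (\<lambda>e. e 0) (\<lambda>i e. e (Suc (Suc i))))"]
    by (simp add: trm_var split: nat.split)
  ultimately have "D (\<lambda>e. e 0 = h (f (\<lambda>i. e (Suc i))) (\<lambda>i. e (Suc i)))"
    using D_dtrm[of "\<lambda>x e. e 0 = h x (\<lambda>i. e (Suc i))"] by simp
  then show ?thesis by (simp add: dtrm_def)
qed

lemma dtrm_comp2:
  assumes "dtrm (\<lambda>e. h (e 0) (e 1))" "dtrm f" "dtrm g"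
  shows "dtrm (\<lambda>e. h (f e) (g e))"
proof -
  have "dtrm (\<lambda>e. h (e 0) (g (\<lambda>i. e (Suc i))))"
  proof (rule dtrm_comp[of "\<lambda>y e. h (e 0) y"])
    show "dtrm (\<lambda>e. h (e (Suc 0)) (e 0))"
      using dtrm_subst[OF assms(1), of "\<lambda>i. if i = 0 then (\<lambda>e. e 1) else (\<lambda>e. e 0)"] trm_var by simp
    show "dtrm (\<lambda>e. g (\<lambda>i. e (Suc i)))" using dtrm_subst[OF assms(3)] trm_var by simp
  qed
  then show ?thesis using assms(2) by (rule dtrm_comp[of "\<lambda>x e. h x (g e)"])
qed

lemma D_comp2:
  assumes "D (\<lambda>e. P (e 0) (e 1))" "dtrm f" "dtrm g"
  shows "D (\<lambda>e. P (f e) (g e))"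
proof -
  have "D (\<lambda>e. P (e 0) (g (\<lambda>i. e (Suc i))))"
  proof (rule D_dtrm[of "\<lambda>y e. P (e 0) y"])
    show "D (\<lambda>e. P (e (Suc 0)) (e 0))"
      using D_subst[OF assms(1), of "\<lambda>i. if i = 0 then (\<lambda>e. e 1) else (\<lambda>e. e 0)"] trm_var by simp
    show "dtrm (\<lambda>e. g (\<lambda>i. e (Suc i)))" using dtrm_subst[OF assms(3)] trm_var by simp
  qed
  then show ?thesis using assms(2) by (rule D_dtrm[of "\<lambda>x e. P x (g e)"])
qed

lemma dtrm_var: "dtrm (\<lambda>e. e i)" and dtrm_const: "dtrm (\<lambda>e. a)"
  by (rule dtrm_trm, rule trm_intros)+

lemma dtrm_add: "dtrm f \<Longrightarrow> dtrm g \<Longrightarrow> dtrm (\<lambda>e. f e \<oplus> g e)"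
  by (rule dtrm_comp2[of add, OF dtrm_trm], intro trm_intros)

lemma dtrm_mul: "dtrm f \<Longrightarrow> dtrm g \<Longrightarrow> dtrm (\<lambda>e. f e \<otimes> g e)"
  by (rule dtrm_comp2[of mul, OF dtrm_trm], intro trm_intros)

lemma dtrm_pr: "dtrm f \<Longrightarrow> dtrm g \<Longrightarrow> dtrm (\<lambda>e. pr (f e) (g e))"
  unfolding pr_def by (intro dtrm_add dtrm_mul)

lemma D_eq: "dtrm f \<Longrightarrow> dtrm g \<Longrightarrow> D (\<lambda>e. f e = g e)"
  by (rule D_comp2[of "(=)", OF D_Sg0], intro Sg0_intros)

lemma D_less: "dtrm f \<Longrightarrow> dtrm g \<Longrightarrow> D (\<lambda>e. f e \<prec> g e)"
  by (rule D_comp2[of less, OF D_Sg0], intro Sg0_intros)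

lemma D_leq: "dtrm f \<Longrightarrow> dtrm g \<Longrightarrow> D (\<lambda>e. f e \<preceq> g e)"
  unfolding leq_def by (intro D_or D_less D_eq)

lemma D_ball:
  assumes "D (\<lambda>e. P (e 0) (\<lambda>i. e (Suc i)))" "dtrm f"
  shows "D (\<lambda>e. \<forall>x. x \<prec> f e \<longrightarrow> P x e)"
proof (rule D_dtrm[of "\<lambda>y e. \<forall>x. x \<prec> y \<longrightarrow> P x e"])
  have "D (\<lambda>e. P (e 0) (\<lambda>i. e (Suc (Suc i))))"
    using D_subst[OF assms(1), of "case_nat (\<lambda>e. e 0) (\<lambda>i e. e (Suc (Suc i)))"]
    by (simp add: trm_var split: nat.split)
  then have "Sk (\<lambda>e. \<forall>x. x \<prec> e 0 \<longrightarrow> P x (\<lambda>i. e (Suc i)))"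
    "Sk (\<lambda>e. \<exists>x. x \<prec> e 0 \<and> \<not> P x (\<lambda>i. e (Suc i)))"
    unfolding D_def by (intro Sg_ball[OF BS] Sg_bex[OF BS] trm_intros; blast)+
  then show "D (\<lambda>e. \<forall>x. x \<prec> e 0 \<longrightarrow> P x (\<lambda>i. e (Suc i)))"
    by (simp add: D_def del: Sg.simps)
qed fact

lemma D_bex:
  assumes "D (\<lambda>e. P (e 0) (\<lambda>i. e (Suc i)))" "dtrm f"
  shows "D (\<lambda>e. \<exists>x. x \<prec> f e \<and> P x e)"
  using D_not[OF D_ball[OF D_not[OF assms(1)] assms(2)]] by simp

lemmas D_intros = D_eq D_less D_leq D_bool D_imp D_not D_and D_or D_iff D_ball D_bex
  dtrm_var dtrm_const dtrm_add dtrm_mul dtrm_pr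

text \<open>Collection one level higher bounds a witness for every \<open>x\<close> below
  \<open>a\<close> that has one, so the outermost quantifier becomes bounded; induction on
  \<open>n\<close> treats the others. The bounds obtained on the way become parameters of the
  bounded relation.\<close>

lemma Sg_bounded_Delta0:
  "BS (Suc n) \<Longrightarrow> Sg n (\<lambda>e. P (e 0)) \<Longrightarrow> \<exists>R. Sg 0 (\<lambda>e. R (e 0)) \<and> (\<forall>x. x \<prec> a \<longrightarrow> (P x \<longleftrightarrow> R x))"
proof (induction n arbitrary: P)
  case (Suc n)
  have B: "BS (Suc n)" "BS n"
    using BS_mono[OF Suc.prems(1), of "Suc n"] BS_mono[OF Suc.prems(1), of n] by simp_all
  from Sg_SucD1[OF Suc.prems(2)] obtain R where
    "Sg n (\<lambda>e. \<not> R (e 0) (e 1) (\<lambda>i. e (Suc (Suc i)))) \<and> (\<forall>x e. P x \<longleftrightarrow> (\<exists>z. R z x e))" ..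
  then have R: "Sg n (\<lambda>e. \<not> R (e 0) (e 1) (\<lambda>i. e (Suc (Suc i))))"
    "\<And>x e. P x \<longleftrightarrow> (\<exists>z. R z x e)" by blast+
  define c where "c = (\<lambda>_::nat. zero)"
  have Rn: "Sg n (\<lambda>e. \<not> R (e 1) (e 0) c)"
    using Sg_re2[OF R(1), of "\<lambda>e. e 1" "\<lambda>e. e 0" "\<lambda>i e. c i"] by (simp add: trm_intros)
  have "Sg (Suc (Suc n)) (\<lambda>e. R (e 1) (e 0) c)"
    using Sg_Suc[OF Sg_Suc_not[OF Rn]] by (simp only: not_not)
  moreover have "Sg (Suc (Suc n)) (\<lambda>e. \<not> P (e 0))"
    by (rule Sg_Suc_not[OF Suc.prems(2)])
  \<comment> \<open>The disjunct \<open>\<not> P\<close> makes the relation total, as collection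
    requires.\<close>
  ultimately have "Sg (Suc (Suc n)) (\<lambda>e. R (e 1) (e 0) c \<or> \<not> P (e 0))"
    by (rule Sg_or[OF Suc.prems(1)])
  from BSD[OF Suc.prems(1) this, of a] R(2)[of _ c]
  obtain b where b: "\<And>x. x \<prec> a \<Longrightarrow> \<exists>y. y \<prec> b \<and> (R y x c \<or> \<not> P x)" by blast
  have "Sg n (\<lambda>e. \<forall>y. y \<prec> b \<longrightarrow> \<not> R y (e 0) c)"
    using Sg_subst[OF Rn, of "case_nat (\<lambda>e. e 1) (\<lambda>i e. e 0)"]
    by (intro Sg_ball[OF B(2)] trm_intros) (simp add: trm_var split: nat.split)
  from Suc.IH[OF B(1) this] obtain R' where
    R': "Sg 0 (\<lambda>e. R' (e 0))" "\<And>x. x \<prec> a \<Longrightarrow> (\<forall>y. y \<prec> b \<longrightarrow> \<not> R y x c) \<longleftrightarrow> R' x" by blast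
  have "P x \<longleftrightarrow> \<not> R' x" if "x \<prec> a" for x
    using R'(2)[OF that] b[OF that] R(2)[of x c] by blast
  then show ?case using Sg0_not[OF R'(1)] by (intro exI[of _ "\<lambda>x. \<not> R' x"]) simp
qed blast

text \<open>Every \<open>x\<close> has a witness either for \<open>P x\<close> or for its negation,
  so collection bounds one of the two for all \<open>x\<close> below \<open>a\<close>. A search
  below this bound decides \<open>P\<close>, and \<open>Sg_bounded_Delta0\<close> applies to the
  search.\<close>

lemma D_bounded_Delta0:
  assumes "D (\<lambda>e. P (e 0))"
  shows "\<exists>R. Sg 0 (\<lambda>e. R (e 0)) \<and> (\<forall>x. x \<prec> a \<longrightarrow> (P x \<longleftrightarrow> R x))"
proof -
  have B: "BS k" using BS_mono[OF BS, of k] by simp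
  define c where "c = (\<lambda>_::nat. zero)"
  from assms have "Sk (\<lambda>e. P (e 0))" "Sk (\<lambda>e. \<not> P (e 0))" by (simp_all add: D_def del: Sg.simps)
  note P = this
  from Sg_SucD1[OF P(1)] obtain R where
    "Sg k (\<lambda>e. \<not> R (e 0) (e 1) (\<lambda>i. e (Suc (Suc i)))) \<and> (\<forall>x e. P x \<longleftrightarrow> (\<exists>z. R z x e))" ..
  then have R: "Sg k (\<lambda>e. \<not> R (e 0) (e 1) (\<lambda>i. e (Suc (Suc i))))"
    "\<And>x e. P x \<longleftrightarrow> (\<exists>z. R z x e)" by blast+
  from Sg_SucD1[OF P(2)] obtain S where
    "Sg k (\<lambda>e. \<not> S (e 0) (e 1) (\<lambda>i. e (Suc (Suc i)))) \<and> (\<forall>x e. \<not> P x \<longleftrightarrow> (\<exists>z. S z x e))" ..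
  then have S: "Sg k (\<lambda>e. \<not> S (e 0) (e 1) (\<lambda>i. e (Suc (Suc i))))"
    "\<And>x e. \<not> P x \<longleftrightarrow> (\<exists>z. S z x e)" by blast+
  have Rn: "Sg k (\<lambda>e. \<not> R (e 1) (e 0) c)"
    using Sg_re2[OF R(1), of "\<lambda>e. e 1" "\<lambda>e. e 0" "\<lambda>i e. c i"] by (simp add: trm_intros)
  have Sn: "Sg k (\<lambda>e. \<not> S (e 1) (e 0) c)"
    using Sg_re2[OF S(1), of "\<lambda>e. e 1" "\<lambda>e. e 0" "\<lambda>i e. c i"] by (simp add: trm_intros)
  have "Sk (\<lambda>e. R (e 1) (e 0) c \<or> S (e 1) (e 0) c)"
    using Sg_or[OF BS Sg_Suc_not[OF Rn] Sg_Suc_not[OF Sn]] by (simp only: not_not)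
  from BSD[OF BS this, of a] R(2)[of _ c] S(2)[of _ c]
  obtain b where b: "\<And>x. x \<prec> a \<Longrightarrow> \<exists>y. y \<prec> b \<and> (R y x c \<or> S y x c)" by blast
  have "Sg k (\<lambda>e. \<forall>y. y \<prec> b \<longrightarrow> \<not> R y (e 0) c)"
    using Sg_subst[OF Rn, of "case_nat (\<lambda>e. e 1) (\<lambda>i e. e 0)"]
    by (intro Sg_ball[OF B] trm_intros) (simp add: trm_var split: nat.split)
  from Sg_bounded_Delta0[OF BS this] obtain R' where
    R': "Sg 0 (\<lambda>e. R' (e 0))" "\<And>x. x \<prec> a \<Longrightarrow> (\<forall>y. y \<prec> b \<longrightarrow> \<not> R y x c) \<longleftrightarrow> R' x" by blast
  have "P x \<longleftrightarrow> \<not> R' x" if "x \<prec> a" for x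
    using R'(2)[OF that] b[OF that] R(2)[of x c] S(2)[of x c] by blast
  then show ?thesis using Sg0_not[OF R'(1)] by (intro exI[of _ "\<lambda>x. \<not> R' x"]) simp
qed

text \<open>Up to any given \<open>x\<close> the relation coincides with a bounded one, for which
  induction is an axiom. In this way collection yields Delta induction.\<close>

lemma D_induct:
  assumes "D (\<lambda>e. P (e 0))" "P zero" "\<And>x. P x \<Longrightarrow> P (x \<oplus> one)"
  shows "P x"
proof -
  obtain R where R: "Sg 0 (\<lambda>e. R (e 0))" "\<And>y. y \<prec> x \<oplus> one \<Longrightarrow> P y \<longleftrightarrow> R y"
    using D_bounded_Delta0[OF assms(1)] by blast
  have "y \<prec> x \<oplus> one \<longrightarrow> R y" for y
  proof (induction rule: induct0[of "\<lambda>y. y \<prec> x \<oplus> one \<longrightarrow> R y"])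
    case 1 show ?case by (intro Sg0_intros R(1))
  next
    case 2 show ?case using assms(2) R(2) by blast
  next
    case (3 y)
    show ?case
    proof
      assume *: "y \<oplus> one \<prec> x \<oplus> one"
      then have "y \<prec> x \<oplus> one" using less_succ less_trans by blast
      with 3 R(2) assms(3) R(2)[OF *] show "R (y \<oplus> one)" by blast
    qed
  qed
  then show ?thesis using R(2) less_succ by blast
qed

lemma D_least:
  assumes "D (\<lambda>e. P (e 0))" "P a"
  shows "\<exists>x. P x \<and> (\<forall>y. y \<prec> x \<longrightarrow> \<not> P y)"
proof (rule ccontr)
  assume *: "\<not> ?thesis"
  have "\<forall>y. y \<prec> x \<longrightarrow> \<not> P y" for x
  proof (induction rule: D_induct[of "\<lambda>x. \<forall>y. y \<prec> x \<longrightarrow> \<not> P y"])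
    case 1 show ?case by (intro D_intros assms(1))
  next
    case 2 show ?case by (simp add: not_less_zero)
  next
    case (3 x) then show ?case using * less_succ by blast
  qed
  with assms(2) less_succ show False by blast
qed

end

context set_model
begin

section \<open>Powers of two\<close>

declare M.one_add_one [simp del]

abbreviation two :: 'a where "two \<equiv> one \<oplus> one"

definition bt :: "'a \<Rightarrow> 'a \<Rightarrow> 'a \<Rightarrow> 'a \<Rightarrow> bool" where
  "bt c d i r \<longleftrightarrow> r \<prec> (i \<oplus> one) \<otimes> d \<oplus> one \<and>
     (\<exists>q. q \<prec> c \<oplus> one \<and> c = q \<otimes> ((i \<oplus> one) \<otimes> d \<oplus> one) \<oplus> r)"

lemma ev_beta: "ev e s (beta c d i r) \<longleftrightarrow> bt (evt e c) (evt e d) (evt e i) (evt e r)"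
  by (simp add: beta_def Let_def bt_def)

lemma bt_unique: "bt c d i r \<Longrightarrow> bt c d i r' \<Longrightarrow> r = r'"
  unfolding bt_def using div_unique by blast

lemma bt_bound: "bt c d i r \<Longrightarrow> r \<prec> c \<oplus> one"
  unfolding bt_def less_succ_leq using leq_add by blast

lemma Sg0_bt: "trm f \<Longrightarrow> trm g \<Longrightarrow> trm h \<Longrightarrow> trm h' \<Longrightarrow> Sg 0 (\<lambda>e. bt (f e) (g e) (h e) (h' e))"
proof -
  assume *: "trm f" "trm g" "trm h" "trm h'"
  have "Sg 0 (\<lambda>e. bt (e 0) (e 1) (e 2) (e 3))"
    unfolding bt_def by (intro Sg0_intros)
  from Sg_subst[OF this, of "case_nat f (case_nat g (case_nat h (\<lambda>_. h')))"] * show ?thesis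
    by (simp add: eval_nat_numeral split: nat.split)
qed

text \<open>A beta-coded sequence 1, 2, 4, ... of length \<open>n \<oplus> one\<close>, as supplied
  by \<open>exp_total\<close> for base two.\<close>

definition doubling :: "'a \<Rightarrow> 'a \<Rightarrow> 'a \<Rightarrow> 'a \<Rightarrow> bool" where
  "doubling c d n y \<longleftrightarrow> bt c d zero one \<and>
     (\<forall>i. i \<prec> n \<longrightarrow> (\<exists>u. u \<prec> c \<oplus> one \<and> bt c d i u \<and> bt c d (i \<oplus> one) (two \<otimes> u))) \<and> bt c d n y"

lemma doubling_exists: "\<exists>y c d. doubling c d n y"
proof -
  have "ev (\<lambda>_. zero) (\<lambda>_. X) exp_total" by (rule RCA[OF RCA0star_exp])
  then have "\<forall>m n. \<exists>y c d. bt c d zero one \<and>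
     (\<forall>i. i \<prec> n \<longrightarrow> (\<exists>u. u \<prec> c \<oplus> one \<and> bt c d i u \<and> bt c d (i \<oplus> one) (m \<otimes> u))) \<and> bt c d n y"
    by (simp add: exp_total_def ev_beta eval_nat_numeral)
  then show ?thesis unfolding doubling_def by blast
qed

lemma doubling_unique:
  assumes "doubling c d n y" "doubling c' d' n y'"
  shows "y = y'"
proof -
  \<comment> \<open>Two codes of the sequence agree entry by entry. An entry never exceeds its code
    \<open>c\<close>, so \<open>r\<close> can be bounded and induction for bounded relations is
    enough.\<close>
  have "i \<prec> n \<oplus> one \<longrightarrow> (\<exists>r. r \<prec> c \<oplus> one \<and> bt c d i r \<and> bt c' d' i r)" for i
  proof (induction rule: induct0[of "\<lambda>i. i \<prec> n \<oplus> one \<longrightarrow>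
      (\<exists>r. r \<prec> c \<oplus> one \<and> bt c d i r \<and> bt c' d' i r)"])
    case 1 show ?case by (intro Sg0_intros Sg0_bt)
  next
    case 2
    have "bt c d zero one" "bt c' d' zero one" using assms by (auto simp: doubling_def)
    then show ?case using bt_bound by blast
  next
    case (3 i)
    show ?case
    proof
      assume "i \<oplus> one \<prec> n \<oplus> one"
      then have "i \<prec> n" using succ_leq less_succ_leq by blast
      then have "i \<prec> n \<oplus> one" using less_succ by blast
      with 3 obtain r where r: "bt c d i r" "bt c' d' i r" by blast
      from assms \<open>i \<prec> n\<close> obtain u u' where
        u: "bt c d i u" "bt c d (i \<oplus> one) (two \<otimes> u)" "bt c' d' i u'" "bt c' d' (i \<oplus> one) (two \<otimes> u')"
        unfolding doubling_def by blast
      have "u = r" "u' = r" using bt_unique[OF u(1) r(1)] bt_unique[OF u(3) r(2)] by simp_all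
      with u(2,4) bt_bound[OF u(2)]
      show "\<exists>r. r \<prec> c \<oplus> one \<and> bt c d (i \<oplus> one) r \<and> bt c' d' (i \<oplus> one) r"
        by (intro exI[of _ "two \<otimes> u"]) simp
    qed
  qed
  then obtain r where r: "bt c d n r" "bt c' d' n r" using less_succ by blast
  have "bt c d n y" "bt c' d' n y'" using assms by (simp_all add: doubling_def)
  with r show ?thesis using bt_unique by metis
qed

lemma doubling_zero: "doubling c d zero y \<Longrightarrow> y = one"
  unfolding doubling_def using bt_unique by blast

lemma doubling_succ:
  assumes "doubling c d (n \<oplus> one) y"
  shows "\<exists>u. doubling c d n u \<and> y = u \<oplus> u"
proof -
  have "n \<prec> n \<oplus> one" by (simp add: less_succ)
  with assms obtain u where u: "bt c d n u" "bt c d (n \<oplus> one) (two \<otimes> u)"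
    unfolding doubling_def by blast
  have "y = two \<otimes> u" using assms u(2) bt_unique unfolding doubling_def by blast
  moreover have "doubling c d n u"
    using assms u(1) unfolding doubling_def using less_succ by blast
  ultimately show ?thesis by (auto simp: add_mul one_mul)
qed

definition p2 :: "'a \<Rightarrow> 'a" where
  "p2 n = (THE y. \<exists>c d. doubling c d n y)"

lemma p2_eq: "doubling c d n y \<Longrightarrow> p2 n = y"
  unfolding p2_def using doubling_unique by (intro the_equality) blast+

lemma p2_iff: "y = p2 n \<longleftrightarrow> (\<exists>c d. doubling c d n y)"
  using doubling_exists p2_eq by metis

lemma p2_zero: "p2 zero = one"
  using doubling_exists[of zero] doubling_zero p2_eq by metis

lemma p2_succ: "p2 (n \<oplus> one) = p2 n \<oplus> p2 n"
proof -
  obtain y c d where y: "doubling c d (n \<oplus> one) y" using doubling_exists by blast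
  then obtain u where "doubling c d n u" "y = u \<oplus> u" using doubling_succ by blast
  with y show ?thesis using p2_eq by blast
qed

end

context collection_model
begin

lemma Sk_p2: "Sk (\<lambda>e. e 0 = p2 (e 1))"
proof -
  have "Sg 0 (\<lambda>e. doubling (e 1) (e 0) (e 3) (e 2))"
    unfolding doubling_def by (intro Sg0_intros Sg0_bt)
  then have "Sk (\<lambda>e. doubling (e 1) (e 0) (e 3) (e 2))" by (rule Sg_mono) simp
  then have "Sk (\<lambda>e. \<exists>d. doubling (e 0) d (e 2) (e 1))"
    by - (rule Sg_ex[OF BS], simp add: eval_nat_numeral del: Sg.simps)
  then have "Sk (\<lambda>e. \<exists>c d. doubling c d (e 1) (e 0))"
    by - (rule Sg_ex[OF BS], simp add: eval_nat_numeral del: Sg.simps)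
  then show ?thesis by (simp add: p2_iff del: Sg.simps)
qed

text \<open>A total function with a Sigma graph has a Delta graph: a number differs from the value
  exactly if it differs from some number that is the value.\<close>

lemma dtrm_p2: "dtrm f \<Longrightarrow> dtrm (\<lambda>e. p2 (f e))"
proof (rule dtrm_comp[of "\<lambda>x e. p2 x"])
  have "Sk (\<lambda>e. e 0 = p2 (e 2) \<and> \<not> e 1 = e 0)"
  proof (rule Sg_and[OF BS])
    show "Sk (\<lambda>e. e 0 = p2 (e 2))"
      using Sg_subst[OF Sk_p2, of "\<lambda>i. if i = 0 then (\<lambda>e. e 0) else (\<lambda>e. e 2)"] trm_var by simp
    show "Sk (\<lambda>e. \<not> e 1 = e 0)" by (rule Sg_mono[of 0], intro Sg0_intros) simp
  qed
  then have "Sk (\<lambda>e. \<exists>y. y = p2 (e 1) \<and> \<not> e 0 = y)"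
    by - (rule Sg_ex[OF BS], simp add: eval_nat_numeral del: Sg.simps)
  then show "dtrm (\<lambda>e. p2 (e 0))"
    using Sk_p2 by (simp add: dtrm_def D_def del: Sg.simps)
qed

lemmas D_p2_intros = D_intros dtrm_p2

lemma p2_pos: "zero \<prec> p2 n"
proof (induction rule: D_induct[of "\<lambda>n. zero \<prec> p2 n"])
  case 1 show ?case by (intro D_p2_intros)
next
  case 2 show ?case by (simp add: p2_zero zero_less_one)
next
  case (3 n) then show ?case unfolding p2_succ using leq_add M.less_le_trans by blast
qed

lemma p2_add: "p2 (n \<oplus> m) = p2 m \<otimes> p2 n"
proof (induction rule: D_induct[of "\<lambda>m. p2 (n \<oplus> m) = p2 m \<otimes> p2 n"])
  case 1 show ?case by (intro D_p2_intros)
next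
  case 2 show ?case by (simp add: p2_zero add_zero one_mul)
next
  case (3 m) then show ?case by (simp add: add_succ p2_succ add_mul)
qed

section \<open>Codes of bounded relations\<close>

text \<open>Digit \<open>i\<close> of the binary expansion: the quotient by \<open>p2 i\<close> is
  odd. The explicit bounds make the relation Delta; by \<open>Bit_iff\<close> they do not change its
  meaning.\<close>

definition Bit :: "'a \<Rightarrow> 'a \<Rightarrow> bool" where
  "Bit t i \<longleftrightarrow> (\<exists>q. q \<prec> t \<oplus> one \<and> (\<exists>r. r \<prec> p2 i \<and> t = (q \<oplus> q \<oplus> one) \<otimes> p2 i \<oplus> r))"

lemma Bit_iff: "Bit t i \<longleftrightarrow> (\<exists>q r. r \<prec> p2 i \<and> t = (q \<oplus> q \<oplus> one) \<otimes> p2 i \<oplus> r)"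
proof -
  have "q \<prec> (q \<oplus> q \<oplus> one) \<otimes> p2 i \<oplus> r \<oplus> one" for q r
  proof -
    have "one \<preceq> p2 i" using p2_pos[of i] succ_leq[of zero] by (simp add: zero_add)
    then have "(q \<oplus> q \<oplus> one) \<otimes> one \<preceq> (q \<oplus> q \<oplus> one) \<otimes> p2 i" by (intro mul_leq_mono M.order_refl)
    moreover have "q \<preceq> (q \<oplus> q \<oplus> one) \<otimes> one" unfolding mul_one add_assoc by (rule leq_add)
    ultimately have "q \<preceq> (q \<oplus> q \<oplus> one) \<otimes> p2 i" by (rule M.order_trans[rotated])
    then show ?thesis unfolding less_succ_leq using leq_add(1) by (rule M.order_trans)
  qed
  then show ?thesis unfolding Bit_def by blast
qed

lemma D_Bit: "dtrm f \<Longrightarrow> dtrm g \<Longrightarrow> D (\<lambda>e. Bit (f e) (g e))"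
proof (rule D_comp2[of Bit])
  show "D (\<lambda>e. Bit (e 0) (e 1))" unfolding Bit_def by (intro D_p2_intros)
qed

lemma parity: "\<exists>q. x = q \<oplus> q \<or> x = q \<oplus> q \<oplus> one"
proof -
  have "zero \<prec> two" by (rule zero_less_succ)
  then obtain q r where "r \<prec> two" "x = q \<otimes> two \<oplus> r" using div_exists by blast
  then have "(r = zero \<or> r = one) \<and> x = q \<oplus> q \<oplus> r"
    using less_succ[of r one] less_succ[of r zero] not_less_zero
    by (auto simp: mul_succ mul_one zero_add)
  then show ?thesis using add_zero by metis
qed

lemma even_neq_odd: "a \<oplus> a \<noteq> b \<oplus> b \<oplus> one"
proof
  assume "a \<oplus> a = b \<oplus> b \<oplus> one"
  then have "a \<otimes> two \<oplus> zero = b \<otimes> two \<oplus> one" by (simp add: mul_succ mul_one add_zero)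
  from div_unique[OF this] zero_less_succ[of one] less_succ[of one one] zero_neq_one show False by simp
qed

text \<open>The summand changes the quotient by \<open>p2 i\<close> by the even number
  \<open>w \<oplus> w\<close> and so preserves its parity.\<close>

lemma Bit_add_high: "Bit (t \<oplus> w \<otimes> p2 (i \<oplus> one)) i \<longleftrightarrow> Bit t i"
proof
  have shift: "(Q \<otimes> p2 i \<oplus> r) \<oplus> w \<otimes> p2 (i \<oplus> one) = (Q \<oplus> (w \<oplus> w)) \<otimes> p2 i \<oplus> r" for Q r
    by (simp add: p2_succ add_mul M.distrib_left M.add_ac)
  {
    assume "Bit t i"
    then obtain q r where qr: "r \<prec> p2 i" "t = (q \<oplus> q \<oplus> one) \<otimes> p2 i \<oplus> r" by (auto simp: Bit_iff)
    have "q \<oplus> q \<oplus> one \<oplus> (w \<oplus> w) = (q \<oplus> w) \<oplus> (q \<oplus> w) \<oplus> one" by (simp add: M.add_ac)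
    then show "Bit (t \<oplus> w \<otimes> p2 (i \<oplus> one)) i"
      unfolding Bit_iff qr(2) shift using qr(1) by metis
  next
    assume *: "Bit (t \<oplus> w \<otimes> p2 (i \<oplus> one)) i"
    then obtain q r where qr: "r \<prec> p2 i" "t \<oplus> w \<otimes> p2 (i \<oplus> one) = (q \<oplus> q \<oplus> one) \<otimes> p2 i \<oplus> r"
      by (auto simp: Bit_iff)
    obtain Q r' where Q: "r' \<prec> p2 i" "t = Q \<otimes> p2 i \<oplus> r'" using div_exists[OF p2_pos] by blast
    have "(Q \<oplus> (w \<oplus> w)) \<otimes> p2 i \<oplus> r' = (q \<oplus> q \<oplus> one) \<otimes> p2 i \<oplus> r"
      using qr(2) unfolding Q(2) shift .
    then have eq: "Q \<oplus> (w \<oplus> w) = q \<oplus> q \<oplus> one" using div_unique Q(1) qr(1) by blast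
    obtain a where "Q = a \<oplus> a \<or> Q = a \<oplus> a \<oplus> one" using parity by blast
    moreover have "Q \<noteq> a \<oplus> a"
    proof
      assume "Q = a \<oplus> a"
      then have "(a \<oplus> w) \<oplus> (a \<oplus> w) = q \<oplus> q \<oplus> one" using eq by (simp add: M.add_ac)
      then show False using even_neq_odd by blast
    qed
    ultimately show "Bit t i" unfolding Bit_iff using Q by blast
  }
qed

lemma not_Bit_small: "t \<prec> p2 n \<Longrightarrow> \<not> Bit t n"
proof
  assume "t \<prec> p2 n" "Bit t n"
  then obtain q r where "t = (q \<oplus> q \<oplus> one) \<otimes> p2 n \<oplus> r" by (auto simp: Bit_iff)
  then have "t = p2 n \<oplus> ((q \<oplus> q) \<otimes> p2 n \<oplus> r)" by (simp add: add_mul one_mul M.add_ac)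
  then have "p2 n \<preceq> t" unfolding leq_iff_add by blast
  with \<open>t \<prec> p2 n\<close> show False by (simp add: M.leD)
qed

lemma Bit_add_top: "t \<prec> p2 n \<Longrightarrow> Bit (t \<oplus> p2 n) n"
proof -
  assume "t \<prec> p2 n"
  moreover have "t \<oplus> p2 n = (zero \<oplus> zero \<oplus> one) \<otimes> p2 n \<oplus> t"
    by (simp add: zero_add one_mul add_commute)
  ultimately show ?thesis unfolding Bit_iff by blast
qed

text \<open>Bounded comprehension. Digit \<open>n\<close> is set by adding \<open>p2 n\<close>,
  which for \<open>i\<close> below \<open>n\<close> is a multiple of
  \<open>p2 (i \<oplus> one)\<close> and leaves digit \<open>i\<close> alone.\<close>

lemma code_exists:
  assumes "D (\<lambda>e. Y (e 0))"
  shows "\<exists>t. t \<prec> p2 n \<and> (\<forall>i. i \<prec> n \<longrightarrow> (Bit t i \<longleftrightarrow> Y i))"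
proof (induction rule: D_induct[of "\<lambda>n. \<exists>t. t \<prec> p2 n \<and> (\<forall>i. i \<prec> n \<longrightarrow> (Bit t i \<longleftrightarrow> Y i))"])
  case 1
  have "D (\<lambda>e. Y (e i))" for i using D_subst[OF assms, of "\<lambda>_ e. e i"] trm_var by simp
  then show ?case by (intro D_p2_intros D_Bit)
next
  case 2 show ?case using p2_pos not_less_zero by blast
next
  case (3 n)
  then obtain t where t: "t \<prec> p2 n" "\<And>i. i \<prec> n \<Longrightarrow> Bit t i \<longleftrightarrow> Y i" by blast
  show ?case
  proof (cases "Y n")
    case True
    have "t \<oplus> p2 n \<prec> p2 (n \<oplus> one)" unfolding p2_succ using t(1) by (rule add_less_mono)
    moreover have "Bit (t \<oplus> p2 n) i \<longleftrightarrow> Y i" if "i \<prec> n \<oplus> one" for i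
    proof (cases "i = n")
      case False
      with that have "i \<prec> n" by (simp add: less_succ)
      then obtain w where "n = i \<oplus> one \<oplus> w" using succ_leq leq_iff_add by blast
      then have "p2 n = p2 w \<otimes> p2 (i \<oplus> one)" using p2_add by blast
      then have "Bit (t \<oplus> p2 n) i \<longleftrightarrow> Bit t i" by (simp only: Bit_add_high)
      then show ?thesis using t(2) \<open>i \<prec> n\<close> by blast
    qed (use True t(1) Bit_add_top in simp)
    ultimately show ?thesis by blast
  next
    case False
    have "t \<prec> p2 (n \<oplus> one)" unfolding p2_succ using t(1) leq_add M.less_le_trans by blast
    moreover have "Bit t i \<longleftrightarrow> Y i" if "i \<prec> n \<oplus> one" for i
      using that t False not_Bit_small less_succ by blast
    ultimately show ?thesis by blast
  qed
qed

text \<open>A relation on \<open>[0, x) \<times> [0, y)\<close> is coded by the set of values of the pairing function.\<close>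

lemma code_rel_exists:
  assumes "D (\<lambda>e. R (e 0) (e 1))"
  shows "\<exists>t. t \<prec> p2 (pr a b) \<and> (\<forall>x y. x \<prec> a \<longrightarrow> y \<prec> b \<longrightarrow> (Bit t (pr x y) \<longleftrightarrow> R x y))"
proof -
  define Y where "Y i \<longleftrightarrow> (\<exists>x. x \<prec> a \<and> (\<exists>y. y \<prec> b \<and> i = pr x y \<and> R x y))" for i
  have "D (\<lambda>e. Y (e 0))" unfolding Y_def by (intro D_p2_intros D_comp2[OF assms])
  from code_exists[OF this, of "pr a b"] obtain t where
    t: "t \<prec> p2 (pr a b)" "\<And>i. i \<prec> pr a b \<Longrightarrow> Bit t i \<longleftrightarrow> Y i" by blast
  have "Bit t (pr x y) \<longleftrightarrow> R x y" if "x \<prec> a" "y \<prec> b" for x y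
  proof -
    have "Bit t (pr x y) \<longleftrightarrow> Y (pr x y)" using t(2) pr_less that by blast
    then show ?thesis unfolding Y_def pr_inject using that by blast
  qed
  with t(1) show ?thesis by blast
qed

section \<open>The pigeonhole principle for definable relations\<close>

definition codes_injection :: "'a \<Rightarrow> 'a \<Rightarrow> bool" where
  "codes_injection t n \<longleftrightarrow> (\<forall>x. x \<prec> n \<oplus> one \<longrightarrow> (\<exists>y. y \<prec> n \<and> Bit t (pr x y))) \<and>
     (\<forall>y. y \<prec> n \<longrightarrow> (\<forall>x. x \<prec> n \<oplus> one \<longrightarrow> (\<forall>x'. x' \<prec> n \<oplus> one \<longrightarrow>
        Bit t (pr x y) \<and> Bit t (pr x' y) \<longrightarrow> x = x')))"

text \<open>The induction on \<open>n\<close> has to range over all injective multifunctions from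
  \<open>n \<oplus> one\<close> into \<open>n\<close>, but definable relations cannot be quantified
  over. Codes below the fixed \<open>T\<close> can, and the relation built in the induction step has
  such a code again.\<close>

lemma pigeonhole:
  assumes F: "D (\<lambda>e. F (e 0) (e 1))" and total: "\<And>x. x \<prec> m \<oplus> one \<Longrightarrow> \<exists>y. y \<prec> m \<and> F x y"
  shows "\<exists>x x' y. x \<prec> m \<oplus> one \<and> x' \<prec> m \<oplus> one \<and> y \<prec> m \<and> x \<noteq> x' \<and> F x y \<and> F x' y"
proof -
  define T where "T = p2 (pr (m \<oplus> one) m)"
  have no: "n \<prec> m \<oplus> one \<longrightarrow> (\<forall>t. t \<prec> T \<longrightarrow> \<not> codes_injection t n)" for n
  proof (induction rule: D_induct[of "\<lambda>n. n \<prec> m \<oplus> one \<longrightarrow> (\<forall>t. t \<prec> T \<longrightarrow> \<not> codes_injection t n)"])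
    case 1 show ?case unfolding codes_injection_def by (intro D_p2_intros D_Bit)
  next
    case 2
    have "zero \<prec> zero \<oplus> one" by (rule zero_less_succ)
    then show ?case unfolding codes_injection_def using not_less_zero by blast
  next
    case (3 n)
    show ?case
    proof (intro impI allI notI)
      fix t assume n: "n \<oplus> one \<prec> m \<oplus> one" and "t \<prec> T" and t: "codes_injection t (n \<oplus> one)"
      let ?G = "\<lambda>x y. Bit t (pr x y)"
      have G1: "\<exists>y. y \<prec> n \<oplus> one \<and> ?G x y" if "x \<prec> n \<oplus> one \<oplus> one" for x
        using t that unfolding codes_injection_def by blast
      have G2: "x = x'" if "?G x y" "?G x' y" "x \<prec> n \<oplus> one \<oplus> one" "x' \<prec> n \<oplus> one \<oplus> one" "y \<prec> n \<oplus> one" for x x' y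
        using t that unfolding codes_injection_def by blast
      \<comment> \<open>To free the value \<open>n\<close>, every \<open>x\<close> related to it is
        also related to all values of the removed argument \<open>n \<oplus> one\<close>.\<close>
      define R where "R x y \<longleftrightarrow> ?G x y \<or> ?G x n \<and> ?G (n \<oplus> one) y" for x y
      have "D (\<lambda>e. R (e 0) (e 1))" unfolding R_def by (intro D_p2_intros D_Bit)
      from code_rel_exists[OF this, of "m \<oplus> one" m] obtain t' where
        t': "t' \<prec> T" "\<And>x y. x \<prec> m \<oplus> one \<Longrightarrow> y \<prec> m \<Longrightarrow> Bit t' (pr x y) \<longleftrightarrow> R x y"
        unfolding T_def by blast
      have nm: "n \<prec> m" using n succ_leq less_succ_leq by blast
      have lt: "n \<prec> n \<oplus> one" "n \<oplus> one \<prec> n \<oplus> one \<oplus> one" by (simp_all add: less_succ)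
      have up: "x \<prec> n \<oplus> one \<oplus> one" if "x \<prec> n \<oplus> one" for x using that less_succ by blast
      have Bit': "Bit t' (pr x y) \<longleftrightarrow> R x y" if "x \<prec> n \<oplus> one" "y \<prec> n" for x y
        using t'(2)[of x y] that nm n less_trans by blast
      have "codes_injection t' n" unfolding codes_injection_def
      proof (intro conjI allI impI)
        fix x assume x: "x \<prec> n \<oplus> one"
        then obtain y where y: "y \<prec> n \<oplus> one" "?G x y" using G1 up by blast
        show "\<exists>y. y \<prec> n \<and> Bit t' (pr x y)"
        proof (cases "y = n")
          case True
          obtain y' where y': "y' \<prec> n \<oplus> one" "?G (n \<oplus> one) y'" using G1 lt by blast
          have "y' \<noteq> n" using G2[of x n "n \<oplus> one"] True y y' x lt up less_irrefl by blast
          then have "y' \<prec> n" using y'(1) less_succ by blast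
          moreover have "R x y'" using True y y' by (auto simp: R_def)
          ultimately show ?thesis using Bit' x by blast
        next
          case False
          then have "y \<prec> n" using y(1) less_succ by blast
          moreover have "R x y" using y by (auto simp: R_def)
          ultimately show ?thesis using Bit' x by blast
        qed
      next
        fix y x x' assume y: "y \<prec> n" and x: "x \<prec> n \<oplus> one" and x': "x' \<prec> n \<oplus> one"
          and "Bit t' (pr x y) \<and> Bit t' (pr x' y)"
        then have R: "R x y" "R x' y" using Bit' by blast+
        have yn: "y \<prec> n \<oplus> one" using y less_succ by blast
        have neq: "x \<noteq> n \<oplus> one" "x' \<noteq> n \<oplus> one" using x x' less_irrefl by blast+
        from R neq G2[OF _ _ up[OF x] up[OF x'] yn] G2[OF _ _ up[OF x] lt(2) yn]
          G2[OF _ _ up[OF x'] lt(2) yn] G2[OF _ _ up[OF x] up[OF x'] lt(1)]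
        show "x = x'" unfolding R_def by blast
      qed
      moreover have "n \<prec> m \<oplus> one" using nm less_succ by blast
      ultimately show False using 3 t'(1) by blast
    qed
  qed
  from code_rel_exists[OF F, of "m \<oplus> one" m] obtain t where
    t: "t \<prec> T" "\<And>x y. x \<prec> m \<oplus> one \<Longrightarrow> y \<prec> m \<Longrightarrow> Bit t (pr x y) \<longleftrightarrow> F x y"
    unfolding T_def by blast
  have "\<not> codes_injection t m" using no t(1) less_succ by blast
  then show ?thesis unfolding codes_injection_def using total t(2) by blast
qed

end

section \<open>The generalized pigeonhole principle from collection\<close>

lemma (in two_sorted) ev_GPHP:
  "ev e s (GPHP p) \<longleftrightarrow> (\<forall>a. \<exists>b. \<forall>c.
     (\<forall>x. less x b \<longrightarrow> (\<exists>y. less y a \<and> ev (case_nat x (case_nat y (case_nat c e))) s p)) \<longrightarrow>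
     \<not> (\<forall>y. less y a \<longrightarrow> (\<forall>x. less x b \<longrightarrow> (\<forall>x'. less x' b \<longrightarrow>
          ev (case_nat x (case_nat y (case_nat c e))) s p \<and>
          ev (case_nat x' (case_nat y (case_nat c e))) s p \<longrightarrow> x = x'))))"
proof -
  have 1: "ev (case_nat y (case_nat x (case_nat c (case_nat b (case_nat a e))))) s
        (app p [Var (Suc 0), Var 0, Var 2] 5) =
      ev (case_nat x (case_nat y (case_nat c e))) s p" for x y c b a
    unfolding ev_app by (intro ev_cong) (auto simp: eval_nat_numeral nth_Cons split: nat.split)
  have 2: "ev (case_nat x' (case_nat x (case_nat y (case_nat c (case_nat b (case_nat a e)))))) s
        (app p [Var (Suc 0), Var 2, Var 3] 6) =
      ev (case_nat x (case_nat y (case_nat c e))) s p"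
    "ev (case_nat x' (case_nat x (case_nat y (case_nat c (case_nat b (case_nat a e)))))) s
        (app p [Var 0, Var 2, Var 3] 6) =
      ev (case_nat x' (case_nat y (case_nat c e))) s p" for x x' y c b a
    unfolding ev_app by ((intro ev_cong; auto simp: eval_nat_numeral nth_Cons split: nat.split)+)
  show ?thesis by (simp add: GPHP_def 1 2, intro all_cong1 ex_cong1, blast)
qed

context collection_model
begin

lemma D_re4:
  assumes "D (\<lambda>e. \<theta> (e 0) (e 1) (e 2) (\<lambda>i. e (Suc (Suc (Suc i)))))"
    "trm f" "trm g" "trm h" "\<And>i. trm (w i)"
  shows "D (\<lambda>e. \<theta> (f e) (g e) (h e) (\<lambda>i. w i e))"
  using D_subst[OF assms(1), of "case_nat f (case_nat g (case_nat h w))"] assms(2-)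
  by (simp add: eval_nat_numeral split: nat.split)

theorem GPHP_of_collection:
  assumes "p \<in> SigmaX (Suc k)"
  shows "tr e (GPHP p)"
  unfolding ev_GPHP
proof (intro allI exI impI notI)
  fix a c
  define \<Phi> where "\<Phi> x y = tr (case_nat x (case_nat y (case_nat c e))) p" for x y
  let ?b = "a \<oplus> one"
  assume total: "\<forall>x. x \<prec> ?b \<longrightarrow> (\<exists>y. y \<prec> a \<and> tr (case_nat x (case_nat y (case_nat c e))) p)"
    and inj: "\<forall>y. y \<prec> a \<longrightarrow> (\<forall>x. x \<prec> ?b \<longrightarrow> (\<forall>x'. x' \<prec> ?b \<longrightarrow>
      tr (case_nat x (case_nat y (case_nat c e))) p \<and> tr (case_nat x' (case_nat y (case_nat c e))) p \<longrightarrow> x = x'))"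
  have "Sk (\<lambda>e. tr e p)"
    using Sigma_Pi_Sg(1)[OF Sg0_mem[OF trm_var]] BS assms by (simp add: SigmaX_def del: Sg.simps)
  then obtain R where "Sg k (\<lambda>e. \<not> R (e 0) (\<lambda>i. e (Suc i))) \<and> (\<forall>e. tr e p \<longleftrightarrow> (\<exists>z. R z e))"
    using Sg_SucD[of k "\<lambda>e. tr e p"] by blast
  then have R: "Sg k (\<lambda>e. \<not> R (e 0) (\<lambda>i. e (Suc i)))" "\<And>e. tr e p \<longleftrightarrow> (\<exists>z. R z e)" by blast+
  define Q where "Q z x y = R z (case_nat x (case_nat y (case_nat c e)))" for z x y
  have "D (\<lambda>e. R (e 0) (\<lambda>i. e (Suc i)))" using R(1) by (rule D_Sgk)
  from D_subst[OF this, of "case_nat (\<lambda>e. e 0) (\<lambda>i e'. case_nat (e' 1) (case_nat (e' 2) (case_nat c e)) i)"]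
  have "D (\<lambda>e'. R (e' 0) (\<lambda>i. case_nat (e' 1) (case_nat (e' 2) (case_nat c e)) i))"
    by (simp add: trm_var trm_case_nat trm_const split: nat.split)
  then have Q: "D (\<lambda>e. Q (e 0) (e 1) (e 2))" unfolding Q_def .
  have Q3: "D (\<lambda>e. Q (e i) (e j) (e l))" for i j l
    using D_subst[OF Q, of "case_nat (\<lambda>e. e i) (case_nat (\<lambda>e. e j) (\<lambda>_ e. e l))"]
    by (simp add: eval_nat_numeral trm_var split: nat.split)
  have \<Phi>: "\<Phi> x y \<longleftrightarrow> (\<exists>z. Q z x y)" for x y by (simp add: \<Phi>_def R(2) Q_def)
  \<comment> \<open>It is the witness \<open>z\<close> that is to be collected; the value
    \<open>y\<close> is already below \<open>a\<close>.\<close>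
  have "D (\<lambda>e. \<exists>y. y \<prec> a \<and> Q (e 1) (e 0) y)" by (intro D_p2_intros Q3)
  then have "Sk (\<lambda>e. \<exists>y. y \<prec> a \<and> Q (e 1) (e 0) y)" by (simp add: D_def del: Sg.simps)
  from BSD[OF BS this, of ?b] total \<Phi> obtain u where
    u: "\<And>x. x \<prec> ?b \<Longrightarrow> \<exists>z. z \<prec> u \<and> (\<exists>y. y \<prec> a \<and> Q z x y)"
    unfolding \<Phi>_def by blast
  have "D (\<lambda>e. \<exists>z. z \<prec> u \<and> Q z (e 0) (e 1))" by (intro D_p2_intros Q3)
  from pigeonhole[OF this, of a] u obtain x x' y where
    "x \<prec> ?b" "x' \<prec> ?b" "y \<prec> a" "x \<noteq> x'" "\<exists>z. Q z x y" "\<exists>z. Q z x' y" by blast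
  with inj show False unfolding \<Phi>[symmetric] \<Phi>_def by blast
qed

end

section \<open>Cuts and coding on a cut\<close>

text \<open>\<open>\<psi>\<close> is the matrix of a formula for which induction fails.\<close>

locale cut_model = collection_model zero one add mul less mem X k
  for zero one :: 'a
    and add mul :: "'a \<Rightarrow> 'a \<Rightarrow> 'a"
    and less :: "'a \<Rightarrow> 'a \<Rightarrow> bool"
    and mem :: "'a \<Rightarrow> 's \<Rightarrow> bool"
    and X :: 's and k :: nat +
  fixes \<psi> :: "'a \<Rightarrow> 'a \<Rightarrow> bool" and m :: 'a
  assumes D_\<psi>: "D (\<lambda>e. \<psi> (e 0) (e 1))"
    and \<psi>_zero: "\<exists>y. \<psi> zero y"
    and \<psi>_succ: "\<exists>y. \<psi> x y \<Longrightarrow> \<exists>y. \<psi> (x \<oplus> one) y"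
    and \<psi>_fails: "\<not> \<psi> m y"
begin

text \<open>Including all \<open>x\<close> up to \<open>i\<close> makes the cut downward closed, and
  a single bound \<open>u\<close> for them makes the least such \<open>u\<close> a nondecreasing
  function of \<open>i\<close>.\<close>

definition bounds :: "'a \<Rightarrow> 'a \<Rightarrow> bool" where
  "bounds u i \<longleftrightarrow> (\<forall>x. x \<prec> i \<oplus> one \<longrightarrow> (\<exists>y. y \<prec> u \<and> \<psi> x y))"

definition cut :: "'a \<Rightarrow> bool" where
  "cut i \<longleftrightarrow> (\<exists>u. bounds u i)"

text \<open>The graph of a cofinal nondecreasing function on the cut.\<close>

definition G :: "'a \<Rightarrow> 'a \<Rightarrow> bool" where
  "G i u \<longleftrightarrow> bounds u i \<and> (\<forall>u'. u' \<prec> u \<longrightarrow> \<not> bounds u' i)"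

lemma D_\<psi>': "D (\<lambda>e. \<psi> (e i) (e j))"
  by (rule D_comp2[OF D_\<psi>]) (intro dtrm_var)+

lemma D_bounds: "D (\<lambda>e. bounds (e i) (e j))"
  unfolding bounds_def by (intro D_p2_intros D_\<psi>')

lemma D_G: "D (\<lambda>e. G (e i) (e j))"
  unfolding G_def by (intro D_p2_intros D_bounds)

lemma bounds_mono: "bounds u i \<Longrightarrow> u \<preceq> u' \<Longrightarrow> j \<preceq> i \<Longrightarrow> bounds u' j"
  unfolding bounds_def less_succ_leq using M.less_le_trans M.order_trans by meson

lemma G_exists: "cut i \<Longrightarrow> \<exists>u. G i u"
proof -
  assume "cut i"
  then obtain u where "bounds u i" by (auto simp: cut_def)
  moreover have "D (\<lambda>e. bounds (e 0) i)"
    using D_subst[OF D_bounds[of 0 1], of "case_nat (\<lambda>e. e 0) (\<lambda>_ _. i)"] trm_intros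
    by (simp split: nat.split)
  ultimately show ?thesis unfolding G_def using D_least[of "\<lambda>u. bounds u i"] by blast
qed

lemma G_unique: "G i u \<Longrightarrow> G i u' \<Longrightarrow> u = u'"
  unfolding G_def using less_linear by blast

lemma G_cut: "G i u \<Longrightarrow> cut i"
  unfolding G_def cut_def by blast

lemma G_mono: "i \<preceq> j \<Longrightarrow> G i u \<Longrightarrow> G j w \<Longrightarrow> u \<preceq> w"
  unfolding G_def using bounds_mono[of w j w i] M.not_le by blast

lemma cut_down: "cut j \<Longrightarrow> i \<preceq> j \<Longrightarrow> cut i"
  unfolding cut_def using bounds_mono by blast

lemma cut_zero: "cut zero"
proof -
  obtain y where y: "\<psi> zero y" using \<psi>_zero by blast
  have "bounds (y \<oplus> one) zero"
    unfolding bounds_def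
  proof (intro allI impI)
    fix x assume "x \<prec> zero \<oplus> one"
    then have "x = zero" using less_succ not_less_zero by blast
    then show "\<exists>z. z \<prec> y \<oplus> one \<and> \<psi> x z" using y less_succ by blast
  qed
  then show ?thesis unfolding cut_def by blast
qed

lemma cut_succ: "cut i \<Longrightarrow> cut (i \<oplus> one)"
proof -
  assume "cut i"
  then obtain u where u: "bounds u i" by (auto simp: cut_def)
  then have "\<exists>y. \<psi> i y" unfolding bounds_def using less_succ by blast
  then obtain y where y: "\<psi> (i \<oplus> one) y" using \<psi>_succ by blast
  obtain b where b: "u \<prec> b" "y \<prec> b" using bound2 by blast
  have "bounds b i" using bounds_mono[OF u] b(1) M.less_imp_le M.order_refl by blast
  then have "bounds b (i \<oplus> one)" unfolding bounds_def using y b(2) less_succ by blast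
  then show ?thesis unfolding cut_def by blast
qed

lemma cut_bounded: "cut i \<Longrightarrow> i \<prec> m"
proof (rule ccontr)
  assume "cut i" "\<not> i \<prec> m"
  then have "cut m" using cut_down M.not_less by blast
  then show False unfolding cut_def bounds_def using \<psi>_fails less_succ by blast
qed

text \<open>The cut contains zero, is closed under successor and omits \<open>m\<close>, which Delta
  induction forbids to a Delta relation.\<close>

lemma cut_not_definable:
  assumes "D (\<lambda>e. R (e 0))"
  shows "\<exists>i. R i \<noteq> cut i"
proof (rule ccontr)
  assume "\<not> ?thesis"
  then have *: "R i = cut i" for i by blast
  have "R m"
    by (rule D_induct[OF assms]) (use * cut_zero cut_succ in auto)
  then show False using * cut_bounded less_irrefl by blast
qed

text \<open>If \<open>z\<close> were above all values of the function, then \<open>bounds z\<close>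
  would be a Delta definition of the cut.\<close>

lemma cofinal: "\<exists>i u. G i u \<and> z \<prec> u"
proof (rule ccontr)
  assume none: "\<not> ?thesis"
  have "bounds z i \<longleftrightarrow> cut i" for i
  proof
    show "bounds z i \<Longrightarrow> cut i" unfolding cut_def by blast
    assume "cut i"
    then obtain u where u: "G i u" using G_exists by blast
    with none have "u \<preceq> z" using M.not_less by blast
    with u show "bounds z i" unfolding G_def using bounds_mono M.order_refl by blast
  qed
  moreover have "D (\<lambda>e. bounds z (e 0))"
    using D_subst[OF D_bounds[of 0 1], of "case_nat (\<lambda>_. z) (\<lambda>_ e. e 0)"] trm_intros
    by (simp split: nat.split)
  ultimately show False using cut_not_definable by blast
qed

lemma overspill:
  assumes "D (\<lambda>e. R (e 0))" "\<And>i. cut i \<Longrightarrow> R i"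
  shows "\<exists>j. \<not> cut j \<and> R j"
proof (rule ccontr)
  assume "\<not> ?thesis"
  then have "R i = cut i" for i using assms(2) by blast
  then show False using cut_not_definable[OF assms(1)] by blast
qed

text \<open>If no code separates the true from the false pairs, collection over the bounded set of codes
  shows that none does so below a single stage of the cofinal enumeration, where all is definable.\<close>

lemma cut_coding:
  assumes "D (\<lambda>e. \<rho> (e 0) (e 1) (e 2))"
  shows "\<exists>S. D (\<lambda>e. S (e 0) (e 1)) \<and>
    (\<forall>n j u. n \<prec> N \<longrightarrow> G j u \<longrightarrow> (S n j \<longleftrightarrow> \<rho> n j u))"
proof -
  have \<rho>: "D (\<lambda>e. \<rho> (e h) (e i) (e j))" for h i j
    using D_subst[OF assms, of "case_nat (\<lambda>e. e h) (case_nat (\<lambda>e. e i) (\<lambda>_ e. e j))"]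
    by (simp add: eval_nat_numeral trm_var split: nat.split)
  \<comment> \<open>All elements of the cut are below \<open>m\<close>, so the relevant sets of
    pairs have codes below \<open>T\<close>.\<close>
  define T where "T = p2 (pr N m)"
  define sep where "sep t w \<longleftrightarrow> (\<forall>n. n \<prec> N \<longrightarrow> (\<forall>j. j \<prec> m \<longrightarrow> (\<forall>u. u \<prec> w \<longrightarrow> G j u \<longrightarrow>
      (Bit t (pr n j) \<longleftrightarrow> \<rho> n j u))))" for t w
  have D_sep: "D (\<lambda>e. sep (e 0) (e 1))" unfolding sep_def by (intro D_p2_intros D_Bit D_G \<rho>)
  have sep_mono: "sep t w \<Longrightarrow> w' \<prec> w \<Longrightarrow> sep t w'" for t w w'
    unfolding sep_def using less_trans by meson
  have "\<exists>t. t \<prec> T \<and> (\<forall>w. sep t w)"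
  proof (rule ccontr)
    assume "\<not> ?thesis"
    moreover have "Sk (\<lambda>e. \<not> sep (e 0) (e 1))" using D_sep by (simp add: D_def del: Sg.simps)
    ultimately obtain W where W: "\<And>t. t \<prec> T \<Longrightarrow> \<exists>w. w \<prec> W \<and> \<not> sep t w"
      using BSD[OF BS, of "\<lambda>t w. \<not> sep t w" T] by blast
    have "D (\<lambda>e. \<exists>u. u \<prec> W \<and> G (e 1) u \<and> \<rho> (e 0) (e 1) u)" by (intro D_p2_intros D_G \<rho>)
    from code_rel_exists[OF this, of N m] obtain t where t: "t \<prec> T"
      "\<And>n j. n \<prec> N \<Longrightarrow> j \<prec> m \<Longrightarrow> Bit t (pr n j) \<longleftrightarrow> (\<exists>u. u \<prec> W \<and> G j u \<and> \<rho> n j u)"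
      unfolding T_def by blast
    have "sep t W" unfolding sep_def
    proof (intro allI impI)
      fix n j u assume "n \<prec> N" "j \<prec> m" "u \<prec> W" "G j u"
      then show "Bit t (pr n j) \<longleftrightarrow> \<rho> n j u" using t(2)[of n j] G_unique by blast
    qed
    with W[OF t(1)] sep_mono show False by blast
  qed
  then obtain t where t: "\<And>w. sep t w" by blast
  have "Bit t (pr n j) \<longleftrightarrow> \<rho> n j u" if "n \<prec> N" "G j u" for n j u
  proof -
    have "u \<prec> u \<oplus> one" "j \<prec> m" using less_succ cut_bounded[OF G_cut[OF that(2)]] by blast+
    with t[of "u \<oplus> one"] that show ?thesis unfolding sep_def by blast
  qed
  moreover have "D (\<lambda>e. Bit t (pr (e 0) (e 1)))" by (intro D_p2_intros D_Bit)
  ultimately show ?thesis by (intro exI[of _ "\<lambda>n j. Bit t (pr n j)"]) blast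
qed

section \<open>Relations determined on the cut\<close>

text \<open>Equality of types. The third argument of \<open>\<theta>\<close> is the value
  \<open>u\<close> of the cofinal function at \<open>j\<close>; it gives \<open>\<theta>\<close> a
  bound for searches, which the type built in \<open>Det_all\<close> relies on.\<close>

definition agree :: "('a \<Rightarrow> 'a \<Rightarrow> 'a \<Rightarrow> (nat \<Rightarrow> 'a) \<Rightarrow> bool) \<Rightarrow> 'a \<Rightarrow> (nat \<Rightarrow> 'a) \<Rightarrow> (nat \<Rightarrow> 'a) \<Rightarrow> bool" where
  "agree \<theta> E e e' \<longleftrightarrow> (\<forall>j u t. G j u \<longrightarrow> t \<prec> E \<longrightarrow> (\<theta> j t u e \<longleftrightarrow> \<theta> j t u e'))"

text \<open>The bound \<open>E\<close> does not depend on \<open>e\<close>, so the number of types is bounded independently of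
  all parameters.\<close>

definition Det :: "((nat \<Rightarrow> 'a) \<Rightarrow> bool) \<Rightarrow> bool" where
  "Det P \<longleftrightarrow> (\<exists>\<theta> E. D (\<lambda>e. \<theta> (e 0) (e 1) (e 2) (\<lambda>i. e (Suc (Suc (Suc i))))) \<and>
     (\<forall>e e'. agree \<theta> E e e' \<longrightarrow> P e = P e'))"

lemma agree_sym: "agree \<theta> E e e' \<Longrightarrow> agree \<theta> E e' e"
  unfolding agree_def by blast

text \<open>The type is the truth value itself, repeated at every \<open>j\<close>; as the cut
  contains zero, it is recorded at least once.\<close>

lemma Det_D:
  assumes "D P"
  shows "Det P"
proof -
  have "P e = P e'" if "agree (\<lambda>_ _ _. P) one e e'" for e e'
  proof -
    obtain u where "G zero u" using G_exists cut_zero by blast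
    then show ?thesis using that zero_less_one unfolding agree_def by blast
  qed
  moreover have "D (\<lambda>e. P (\<lambda>i. e (Suc (Suc (Suc i)))))"
    using assms by (rule D_subst) (rule trm_var)
  ultimately show ?thesis unfolding Det_def by (intro exI[of _ "\<lambda>_ _ _. P"] exI[of _ one]) blast
qed

lemma Det_imp:
  assumes "Det P" "Det Q"
  shows "Det (\<lambda>e. P e \<longrightarrow> Q e)"
proof -
  from assms(1) obtain \<theta> E where \<theta>: "D (\<lambda>e. \<theta> (e 0) (e 1) (e 2) (\<lambda>i. e (Suc (Suc (Suc i)))))"
    "\<And>e e'. agree \<theta> E e e' \<Longrightarrow> P e = P e'" unfolding Det_def by blast
  from assms(2) obtain \<eta> F where \<eta>: "D (\<lambda>e. \<eta> (e 0) (e 1) (e 2) (\<lambda>i. e (Suc (Suc (Suc i)))))"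
    "\<And>e e'. agree \<eta> F e e' \<Longrightarrow> Q e = Q e'" unfolding Det_def by blast
  \<comment> \<open>The disjoint union of the two types, tagged by 0 and 1; all its indices lie
    below \<open>pr two (E \<oplus> F)\<close>.\<close>
  define \<xi> where "\<xi> j t u e \<longleftrightarrow> (\<exists>t'. t' \<prec> E \<and> t = pr zero t' \<and> \<theta> j t' u e) \<or>
      (\<exists>t'. t' \<prec> F \<and> t = pr one t' \<and> \<eta> j t' u e)" for j t u e
  have "D (\<lambda>e. \<xi> (e 0) (e 1) (e 2) (\<lambda>i. e (Suc (Suc (Suc i)))))"
    unfolding \<xi>_def by (intro D_p2_intros D_re4[OF \<theta>(1)] D_re4[OF \<eta>(1)] trm_intros)
  moreover have "(P e \<longrightarrow> Q e) = (P e' \<longrightarrow> Q e')" if *: "agree \<xi> (pr two (E \<oplus> F)) e e'" for e e'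
  proof -
    have "agree \<theta> E e e'" unfolding agree_def
    proof (intro allI impI)
      fix j u t assume ju: "G j u" and t: "t \<prec> E"
      have \<xi>: "\<xi> j (pr zero t) u e \<longleftrightarrow> \<theta> j t u e" for e
        unfolding \<xi>_def pr_inject using t zero_neq_one by blast
      have "pr zero t \<prec> pr two (E \<oplus> F)"
        using zero_less_succ t M.less_le_trans leq_add by (intro pr_less) blast+
      with * ju have "\<xi> j (pr zero t) u e = \<xi> j (pr zero t) u e'" unfolding agree_def by blast
      then show "\<theta> j t u e \<longleftrightarrow> \<theta> j t u e'" unfolding \<xi> .
    qed
    moreover have "agree \<eta> F e e'" unfolding agree_def
    proof (intro allI impI)
      fix j u t assume ju: "G j u" and t: "t \<prec> F"
      have \<xi>: "\<xi> j (pr one t) u e \<longleftrightarrow> \<eta> j t u e" for e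
        unfolding \<xi>_def pr_inject using t zero_neq_one by blast
      have "one \<prec> two" using less_succ by blast
      then have "pr one t \<prec> pr two (E \<oplus> F)"
        using t M.less_le_trans leq_add by (intro pr_less) blast+
      with * ju have "\<xi> j (pr one t) u e = \<xi> j (pr one t) u e'" unfolding agree_def by blast
      then show "\<eta> j t u e \<longleftrightarrow> \<eta> j t u e'" unfolding \<xi> .
    qed
    ultimately show ?thesis using \<theta>(2) \<eta>(2) by blast
  qed
  ultimately show ?thesis unfolding Det_def by blast
qed

text \<open>A back-and-forth argument: each \<open>z\<close> for one environment must be matched by
  a \<open>z'\<close> of the same type for the other. Agreement gives a match up to each
  \<open>j\<close> in the cut, possibly a different one for every \<open>j\<close>; overspill makes
  one of them serve the whole cut.\<close>

lemma Det_all: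
  assumes "Det Q"
  shows "Det (\<lambda>e. \<forall>z. Q (case_nat z e))"
proof -
  from assms obtain \<theta> E where \<theta>: "D (\<lambda>e. \<theta> (e 0) (e 1) (e 2) (\<lambda>i. e (Suc (Suc (Suc i)))))"
    "\<And>e e'. agree \<theta> E e e' \<Longrightarrow> Q e = Q e'" unfolding Det_def by blast
  define T where "T = p2 (pr m E)"
  define local where "local e j u t z \<longleftrightarrow> (\<forall>j'. j' \<prec> j \<longrightarrow> (\<forall>t'. t' \<prec> E \<longrightarrow>
      (Bit t (pr j' t') \<longleftrightarrow> (\<exists>u'. u' \<prec> u \<oplus> one \<and> G j' u' \<and> \<theta> j' t' u' (case_nat z e)))))" for e j u t z
  \<comment> \<open>The search for \<open>z\<close> is bounded by the value \<open>w\<close> at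
    \<open>i\<close>, which itself must be found among the numbers up to \<open>u\<close>. This is
    guaranteed once \<open>i \<preceq> j\<close>, which suffices.\<close>
  define \<Theta> where "\<Theta> j \<tau> u e \<longleftrightarrow> (\<exists>i. i \<prec> m \<and> (\<exists>t. t \<prec> T \<and> \<tau> = pr i t \<and>
      (\<exists>w. w \<prec> u \<oplus> one \<and> G i w \<and> (\<exists>z. z \<prec> w \<and> local e j u t z))))" for j \<tau> u e
  have "D (\<lambda>e. \<Theta> (e 0) (e 1) (e 2) (\<lambda>i. e (Suc (Suc (Suc i)))))"
    unfolding \<Theta>_def local_def
    by (intro D_p2_intros D_Bit D_G D_re4[OF \<theta>(1)] trm_intros trm_case_nat)
  moreover have key: "\<exists>z'. agree \<theta> E (case_nat z e) (case_nat z' e')"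
    if *: "agree \<Theta> (pr m T) e e'" for e e' z
  proof -
    obtain i w where iw: "G i w" "z \<prec> w" using cofinal by blast
    have im: "i \<prec> m" using cut_bounded G_cut iw(1) by blast
    have "D (\<lambda>e'. \<theta> (e' 1) (e' 0) (e' 2) (\<lambda>i. case_nat z e i))"
      by (intro D_re4[OF \<theta>(1)] trm_intros)
    then have "D (\<lambda>e'. \<theta> (e' 1) (e' 0) (e' 2) (case_nat z e))" by simp
    from cut_coding[OF this, of E] obtain S where S: "D (\<lambda>e. S (e 0) (e 1))"
      "\<And>t' j u. t' \<prec> E \<Longrightarrow> G j u \<Longrightarrow> S t' j \<longleftrightarrow> \<theta> j t' u (case_nat z e)" by blast
    have "D (\<lambda>e. S (e 1) (e 0))" by (intro D_comp2[OF S(1)] dtrm_var)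
    from code_rel_exists[OF this, of m E] obtain t where t: "t \<prec> T"
      "\<And>j t'. j \<prec> m \<Longrightarrow> t' \<prec> E \<Longrightarrow> Bit t (pr j t') \<longleftrightarrow> S t' j" unfolding T_def by blast
    have tz: "Bit t (pr j t') \<longleftrightarrow> \<theta> j t' u (case_nat z e)" if "t' \<prec> E" "G j u" for j t' u
      using t(2) S(2) that cut_bounded G_cut by blast
    \<comment> \<open>For \<open>j'\<close> below \<open>j\<close> the bounded search for
      \<open>u'\<close> always succeeds, because the cut is closed downwards and \<open>G\<close> is
      nondecreasing.\<close>
    have local_iff: "local d j u t z \<longleftrightarrow> (\<forall>j' t' u'. j' \<prec> j \<longrightarrow> t' \<prec> E \<longrightarrow> G j' u' \<longrightarrow>
        (Bit t (pr j' t') \<longleftrightarrow> \<theta> j' t' u' (case_nat z d)))" if ju: "G j u" for d j u t z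
    proof -
      have ex: "\<exists>u'. u' \<prec> u \<oplus> one \<and> G j' u'" if "j' \<prec> j" for j'
      proof -
        have "cut j'" using cut_down[OF G_cut[OF ju]] that M.less_imp_le by blast
        then obtain u' where u': "G j' u'" using G_exists by blast
        then have "u' \<preceq> u" using G_mono[OF _ u' ju] that M.less_imp_le by blast
        with u' show ?thesis using less_succ_leq by blast
      qed
      have "(\<exists>u'. u' \<prec> u \<oplus> one \<and> G j' u' \<and> \<theta> j' t' u' (case_nat z d)) \<longleftrightarrow> \<theta> j' t' u'' (case_nat z d)"
        if "j' \<prec> j" "G j' u''" for j' t' u''
        using ex[OF that(1)] that(2) G_unique by blast
      then show ?thesis unfolding local_def using ex by meson
    qed
    have local': "\<exists>z'. z' \<prec> w \<and> local e' j u t z'" if ij: "i \<preceq> j" and ju: "G j u" for j u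
    proof -
      have "local e j u t z" unfolding local_iff[OF ju] using tz by blast
      moreover have "w \<prec> u \<oplus> one" unfolding less_succ_leq using ij iw(1) ju by (rule G_mono)
      ultimately have "\<Theta> j (pr i t) u e" unfolding \<Theta>_def using im t(1) iw by blast
      moreover have "pr i t \<prec> pr m T" using im t(1) by (rule pr_less)
      ultimately have "\<Theta> j (pr i t) u e'" using * ju unfolding agree_def by blast
      then show ?thesis unfolding \<Theta>_def pr_inject using G_unique[OF iw(1)] by blast
    qed
    \<comment> \<open>The types of all \<open>z'\<close> below \<open>w\<close> are put into one
      relation, so that a single Delta relation \<open>S'\<close> represents them uniformly in
      \<open>z'\<close>.\<close>
    define \<rho> where "\<rho> n j u \<longleftrightarrow> (\<exists>z'. z' \<prec> w \<and> (\<exists>t'. t' \<prec> E \<and> n = pr z' t' \<and> \<theta> j t' u (case_nat z' e')))" for n j u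
    have "D (\<lambda>d. \<rho> (d 0) (d 1) (d 2))"
      unfolding \<rho>_def by (intro D_p2_intros D_re4[OF \<theta>(1)] trm_intros trm_case_nat)
    from cut_coding[OF this, of "pr w E"] obtain S' where S': "D (\<lambda>e. S' (e 0) (e 1))"
      "\<And>n j u. n \<prec> pr w E \<Longrightarrow> G j u \<Longrightarrow> S' n j \<longleftrightarrow> \<rho> n j u" by blast
    have S'_iff: "S' (pr z' t') j \<longleftrightarrow> \<theta> j t' u (case_nat z' e')" if "z' \<prec> w" "t' \<prec> E" "G j u" for z' t' j u
    proof -
      have "S' (pr z' t') j \<longleftrightarrow> \<rho> (pr z' t') j u" using S'(2) pr_less that by blast
      then show ?thesis unfolding \<rho>_def pr_inject using that by blast
    qed
    \<comment> \<open>The condition is stated with \<open>t\<close> and \<open>S'\<close> in place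
      of \<open>\<theta>\<close>: they make sense for every \<open>j\<close>, also outside the cut,
      where overspill leads.\<close>
    define R where "R j \<longleftrightarrow> (\<exists>z'. z' \<prec> w \<and> (\<forall>j'. j' \<prec> j \<longrightarrow> (\<forall>t'. t' \<prec> E \<longrightarrow>
        (Bit t (pr j' t') \<longleftrightarrow> S' (pr z' t') j'))))" for j
    have "D (\<lambda>e. R (e 0))" unfolding R_def by (intro D_p2_intros D_Bit D_comp2[OF S'(1)])
    moreover have "R j" if "cut j" for j
    proof -
      \<comment> \<open>A match is guaranteed only from \<open>i\<close> on, so \<open>j\<close> is
        first raised above \<open>i\<close>.\<close>
      have "\<exists>l. cut l \<and> i \<preceq> l \<and> j \<preceq> l"
        using that G_cut[OF iw(1)] M.linear M.order_refl by blast
      then obtain l where l: "cut l" "i \<preceq> l" "j \<preceq> l" by blast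
      then obtain u where u: "G l u" using G_exists by blast
      from local'[OF l(2) u] obtain z' where z': "z' \<prec> w" "local e' l u t z'" by blast
      have "Bit t (pr j' t') \<longleftrightarrow> S' (pr z' t') j'" if "j' \<prec> j" "t' \<prec> E" for j' t'
      proof -
        have "j' \<prec> l" using that(1) l(3) M.less_le_trans by blast
        then have "cut j'" using cut_down[OF l(1)] M.less_imp_le by blast
        then obtain u' where u': "G j' u'" using G_exists by blast
        then show ?thesis
          using z'(2) \<open>j' \<prec> l\<close> that(2) S'_iff[OF z'(1) that(2) u'] unfolding local_iff[OF u] by blast
      qed
      with z'(1) show ?thesis unfolding R_def by blast
    qed
    ultimately obtain j where j: "\<not> cut j" "R j" using overspill by blast
    then obtain z' where z': "z' \<prec> w"
      "\<And>j' t'. j' \<prec> j \<Longrightarrow> t' \<prec> E \<Longrightarrow> Bit t (pr j' t') \<longleftrightarrow> S' (pr z' t') j'" unfolding R_def by blast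
    have "agree \<theta> E (case_nat z e) (case_nat z' e')" unfolding agree_def
    proof (intro allI impI)
      fix j' u' t' assume ju: "G j' u'" and t': "t' \<prec> E"
      have "j' \<prec> j" using G_cut[OF ju] j(1) cut_down M.not_less by blast
      then show "\<theta> j' t' u' (case_nat z e) \<longleftrightarrow> \<theta> j' t' u' (case_nat z' e')"
        using tz[OF t' ju] z'(2)[OF _ t'] S'_iff[OF z'(1) t' ju] by blast
    qed
    then show ?thesis by blast
  qed
  then have "(\<forall>z. Q (case_nat z e)) = (\<forall>z. Q (case_nat z e'))" if "agree \<Theta> (pr m T) e e'" for e e'
    using key[OF that] key[OF agree_sym[OF that]] \<theta>(2) by blast
  ultimately show ?thesis unfolding Det_def by blast
qed

text \<open>Since \<open>Det\<close> is closed under unbounded quantifiers of both kinds, the level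
  \<open>n\<close> may exceed \<open>k\<close>; this is why (b) covers every
  \<open>l\<close>.\<close>

lemma Det_formula:
  assumes Y: "Sg 0 (\<lambda>e. mem (e 0) Y)"
  shows "Sigma n p \<Longrightarrow> Det (\<lambda>e. ev e (\<lambda>_. Y) p)" "Pi n p \<Longrightarrow> Det (\<lambda>e. ev e (\<lambda>_. Y) p)"
proof (induction rule: Sigma_Pi.inducts)
  case (1 p)
  show ?case by (rule Det_D[OF D_Sg0[OF Delta0_Sg0[OF Y 1]]])
next
  case (3 n p)
  have "Det (\<lambda>e. False)" by (intro Det_D D_bool)
  with 3 show ?case unfolding ev.simps by (intro Det_imp Det_all)
next
  case (4 p)
  show ?case by (rule Det_D[OF D_Sg0[OF Delta0_Sg0[OF Y 4]]])
next
  case (6 n p)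
  then show ?case unfolding ev.simps by (intro Det_all)
qed

theorem GPHP_of_Det:
  assumes "Det (\<lambda>e. ev e s p)"
  shows "ev e s (GPHP p)"
proof -
  from assms obtain \<theta> E where \<theta>: "D (\<lambda>e. \<theta> (e 0) (e 1) (e 2) (\<lambda>i. e (Suc (Suc (Suc i)))))"
    "\<And>e e'. agree \<theta> E e e' \<Longrightarrow> ev e s p = ev e' s p" unfolding Det_def by blast
  show ?thesis unfolding ev_GPHP
  proof (intro allI exI impI notI)
    fix a c
    \<comment> \<open>A family of types, one for each \<open>y\<close> below \<open>a\<close>, has a
      code below \<open>T\<close>; neither \<open>m\<close> nor \<open>E\<close> depends on
      \<open>c\<close>.\<close>
    define T where "T = p2 (pr a (pr m E))"
    let ?env = "\<lambda>x y. case_nat x (case_nat y (case_nat c e))"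
    assume total: "\<forall>x. x \<prec> p2 (pr a (pr m E)) \<oplus> one \<longrightarrow> (\<exists>y. y \<prec> a \<and> ev (?env x y) s p)"
      and inj: "\<forall>y. y \<prec> a \<longrightarrow> (\<forall>x. x \<prec> p2 (pr a (pr m E)) \<oplus> one \<longrightarrow>
        (\<forall>x'. x' \<prec> p2 (pr a (pr m E)) \<oplus> one \<longrightarrow> ev (?env x y) s p \<and> ev (?env x' y) s p \<longrightarrow> x = x'))"
    define \<rho> where "\<rho> n j u \<longleftrightarrow> (\<exists>x. x \<prec> T \<oplus> one \<and> (\<exists>y. y \<prec> a \<and> (\<exists>t. t \<prec> E \<and>
        n = pr x (pr y t) \<and> \<theta> j t u (?env x y))))" for n j u
    have "D (\<lambda>d. \<rho> (d 0) (d 1) (d 2))"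
      unfolding \<rho>_def by (intro D_p2_intros D_re4[OF \<theta>(1)] trm_intros trm_case_nat)
    from cut_coding[OF this, of "pr (T \<oplus> one) (pr a E)"] obtain S where S: "D (\<lambda>e. S (e 0) (e 1))"
      "\<And>n j u. n \<prec> pr (T \<oplus> one) (pr a E) \<Longrightarrow> G j u \<Longrightarrow> S n j \<longleftrightarrow> \<rho> n j u" by blast
    have S_iff: "S (pr x (pr y t)) j \<longleftrightarrow> \<theta> j t u (?env x y)"
      if "x \<prec> T \<oplus> one" "y \<prec> a" "t \<prec> E" "G j u" for x y t j u
    proof -
      have "S (pr x (pr y t)) j \<longleftrightarrow> \<rho> (pr x (pr y t)) j u" using S(2) pr_less that by blast
      then show ?thesis unfolding \<rho>_def pr_inject using that by blast
    qed
    \<comment> \<open>If two arguments share a code, then \<open>S\<close> treats them alike for all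
      \<open>j\<close> below \<open>m\<close>. On the cut \<open>S\<close> coincides with
      \<open>\<theta>\<close>, so their types are equal for every \<open>y\<close> below
      \<open>a\<close>.\<close>
    define F where "F x \<tau> \<longleftrightarrow> (\<forall>y. y \<prec> a \<longrightarrow> (\<forall>j. j \<prec> m \<longrightarrow> (\<forall>t. t \<prec> E \<longrightarrow>
        (Bit \<tau> (pr y (pr j t)) \<longleftrightarrow> S (pr x (pr y t)) j))))" for x \<tau>
    have "D (\<lambda>e. F (e 0) (e 1))" unfolding F_def by (intro D_p2_intros D_Bit D_comp2[OF S(1)])
    moreover have "\<exists>\<tau>. \<tau> \<prec> T \<and> F x \<tau>" for x
    proof -
      have "D (\<lambda>e. \<exists>j. j \<prec> m \<and> (\<exists>t. t \<prec> E \<and> e 1 = pr j t \<and> S (pr x (pr (e 0) t)) j))"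
        by (intro D_p2_intros D_comp2[OF S(1)])
      from code_rel_exists[OF this, of a "pr m E"] obtain \<tau> where \<tau>: "\<tau> \<prec> T"
        "\<And>y q. y \<prec> a \<Longrightarrow> q \<prec> pr m E \<Longrightarrow> Bit \<tau> (pr y q) \<longleftrightarrow>
          (\<exists>j. j \<prec> m \<and> (\<exists>t. t \<prec> E \<and> q = pr j t \<and> S (pr x (pr y t)) j))"
        unfolding T_def by blast
      have "F x \<tau>" unfolding F_def
      proof (intro allI impI)
        fix y j t assume "y \<prec> a" and jt: "j \<prec> m" "t \<prec> E"
        then show "Bit \<tau> (pr y (pr j t)) \<longleftrightarrow> S (pr x (pr y t)) j"
          unfolding \<tau>(2)[OF \<open>y \<prec> a\<close> pr_less[OF jt]] pr_inject by blast
      qed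
      with \<tau>(1) show ?thesis by blast
    qed
    ultimately obtain x x' \<tau> where x: "x \<prec> T \<oplus> one" "x' \<prec> T \<oplus> one" "x \<noteq> x'" and F: "F x \<tau>" "F x' \<tau>"
      using pigeonhole[of F T] by blast
    obtain y where y: "y \<prec> a" "ev (?env x y) s p" using total x(1) unfolding T_def by blast
    have "agree \<theta> E (?env x y) (?env x' y)" unfolding agree_def
    proof (intro allI impI)
      fix j u t assume ju: "G j u" and t: "t \<prec> E"
      have "j \<prec> m" using cut_bounded G_cut ju by blast
      then have "S (pr x (pr y t)) j \<longleftrightarrow> S (pr x' (pr y t)) j"
        using F y(1) t unfolding F_def by blast
      then show "\<theta> j t u (?env x y) \<longleftrightarrow> \<theta> j t u (?env x' y)"
        using S_iff[OF x(1) y(1) t ju] S_iff[OF x(2) y(1) t ju] by blast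
    qed
    then have "ev (?env x' y) s p" using \<theta>(2) y(2) by blast
    with inj y x show False unfolding T_def by blast
  qed
qed

end

section \<open>Joins and provability\<close>

context set_model
begin

text \<open>Comprehension is applied with the same bounded formula in both roles. The search for
  \<open>x\<close> can be bounded by \<open>w\<close> because a pair is at least as large as its
  second component.\<close>

lemma join_exists:
  "\<exists>Z. \<forall>w. mem w Z \<longleftrightarrow> (\<exists>x. w = pr zero x \<and> mem x A \<or> w = pr one x \<and> mem x B)"
proof -
  define P where "P c = Add (Mul (Add c (Var 0)) (Add c (Var 0))) c" for c
  define p where "p = bex (Add (Var 0) One)
    (Or (And (Eq (Var 1) (P Zero)) (Mem (Var 0) 0)) (And (Eq (Var 1) (P One)) (Mem (Var 0) 1)))"
  have p: "Delta0 p" unfolding p_def by (intro Delta0.intros)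
  have "Sigma 1 p" "Pi 1 p" using p Sigma_Pi.intros by (metis One_nat_def)+
  then have "ev e s (cl (Comp p p))" for e s by (intro RCA RCA0star_Comp)
  then have C: "ev e s (Comp p p)" for e s unfolding ev_cl by blast
  let ?s = "case_nat A (\<lambda>_. B)"
  have liftS: "ev e (case_nat Z ?s) (liftS p) = ev e ?s p" for e Z
    by (simp add: liftS_def ev_substf)
  have "\<exists>Z. \<forall>w. mem w Z \<longleftrightarrow> ev (case_nat w (\<lambda>_. zero)) ?s p"
    using C[of "\<lambda>_. zero" ?s] by (auto simp: Comp_def liftS)
  moreover have "ev (case_nat w e) ?s p \<longleftrightarrow>
      (\<exists>x. w = pr zero x \<and> mem x A \<or> w = pr one x \<and> mem x B)" for w e
  proof -
    have "ev (case_nat w e) ?s p \<longleftrightarrow>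
        (\<exists>x. x \<prec> w \<oplus> one \<and> (w = pr zero x \<and> mem x A \<or> w = pr one x \<and> mem x B))"
      by (auto simp: p_def P_def pr_def)
    then show ?thesis unfolding less_succ_leq using leq_pr by blast
  qed
  ultimately show ?thesis by simp
qed

end

context arith_model
begin

lemma GPHP_a:
  assumes "\<And>p e. p \<in> SigmaX (Suc k) \<Longrightarrow> ev e (\<lambda>_. X) (Coll p)" and "p \<in> SigmaX (Suc k)"
  shows "ev e (\<lambda>_. X) (GPHP p)"
proof -
  interpret set_model zero one add mul less mem X ..
  interpret collection_model zero one add mul less mem X k
    by unfold_locales (rule BS_Coll, rule assms(1))
  show ?thesis using assms(2) by (rule GPHP_of_collection)
qed

text \<open>Induction may fail for a set \<open>Y\<close> other than \<open>X\<close>. Relative to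
  the join \<open>Z\<close> both are bounded relations, so the cut obtained from \<open>Y\<close>
  can be used for formulas about \<open>X\<close>; collection holds for \<open>Z\<close> because it
  is assumed for all sets.\<close>

lemma GPHP_b:
  assumes coll: "\<And>X p e. p \<in> SigmaX (Suc k) \<Longrightarrow> ev e (\<lambda>_. X) (Coll p)"
    and q: "q \<in> SigmaX (Suc k)" "\<not> ev e' (\<lambda>_. Y) (Ind q)"
    and p: "p \<in> SigmaX l"
  shows "ev e (\<lambda>_. X) (GPHP p)"
proof -
  interpret set_model zero one add mul less mem X ..
  obtain Z where Z: "\<And>w. mem w Z \<longleftrightarrow> (\<exists>x. w = pr zero x \<and> mem x X \<or> w = pr one x \<and> mem x Y)"
    using join_exists by blast
  have mem_X: "mem x X \<longleftrightarrow> mem (pr zero x) Z" and mem_Y: "mem x Y \<longleftrightarrow> mem (pr one x) Z" for x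
    unfolding Z pr_inject using zero_neq_one by blast+
  interpret Z: set_model zero one add mul less mem Z ..
  interpret Z: collection_model zero one add mul less mem Z k
    by unfold_locales (rule Z.BS_Coll, rule coll)
  have X0: "Z.Sg 0 (\<lambda>e. mem (e 0) X)" and Y0: "Z.Sg 0 (\<lambda>e. mem (e 0) Y)"
    unfolding mem_X mem_Y by (intro Z.Sg0_mem Z.trm_pr Z.trm_intros)+
  define \<phi> where "\<phi> x = ev (case_nat x e') (\<lambda>_. Y) q" for x
  have "Z.Sk (\<lambda>e. ev e (\<lambda>_. Y) q)"
    using Z.Sigma_Pi_Sg(1)[OF Y0] Z.BS q(1) by (simp add: SigmaX_def del: Z.Sg.simps)
  from Z.Sg_SucD[OF this] obtain R where
    "Z.Sg k (\<lambda>e. \<not> R (e 0) (\<lambda>i. e (Suc i))) \<and> (\<forall>e. ev e (\<lambda>_. Y) q \<longleftrightarrow> (\<exists>z. R z e))" ..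
  then have R: "Z.Sg k (\<lambda>e. \<not> R (e 0) (\<lambda>i. e (Suc i)))" "\<And>e. ev e (\<lambda>_. Y) q \<longleftrightarrow> (\<exists>z. R z e)"
    by blast+
  have "Z.D (\<lambda>e. R (e 0) (\<lambda>i. e (Suc i)))" using R(1) by (rule Z.D_Sgk)
  from Z.D_subst[OF this, of "case_nat (\<lambda>d. d 1) (\<lambda>i d. case_nat (d 0) e' i)"]
  have D: "Z.D (\<lambda>d. R (d 1) (case_nat (d 0) e'))"
    by (simp add: Z.trm_var Z.trm_case_nat Z.trm_const split: nat.split)
  from q(2) obtain m where m: "\<phi> zero" "\<And>x. \<phi> x \<Longrightarrow> \<phi> (add x one)" "\<not> \<phi> m"
    unfolding ev_Ind \<phi>_def by blast
  interpret Z: cut_model zero one add mul less mem Z k "\<lambda>x y. R y (case_nat x e')" m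
  proof
    show "Z.D (\<lambda>e. R (e 1) (case_nat (e 0) e'))" by (rule D)
  qed (use m in \<open>auto simp: \<phi>_def R(2)\<close>)
  have "Z.Det (\<lambda>e. ev e (\<lambda>_. X) p)" using p by (intro Z.Det_formula(1)[OF X0, of l]) (simp add: SigmaX_def)
  then show ?thesis by (rule Z.GPHP_of_Det)
qed

end

section \<open>Closed axioms, compactness and the return to derivations\<close>

lemma numbd_AllN_funpow: "numbd ((AllN ^^ n) p) = numbd p - n"
  by (induction n) auto

lemma numbd_AllS_funpow [simp]: "numbd ((AllS ^^ n) p) = numbd p"
  by (induction n) auto

lemma setbd_AllS_funpow: "setbd ((AllS ^^ n) p) = setbd p - n"
  by (induction n) auto

lemma numbd_clN [simp]: "numbd (clN p) = 0" and setbd_clN [simp]: "setbd (clN p) = setbd p"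
  by (simp_all add: clN_def numbd_AllN_funpow)

lemma numbd_cl [simp]: "numbd (cl p) = 0" and setbd_cl [simp]: "setbd (cl p) = 0"
  by (simp_all add: cl_def setbd_AllS_funpow)

lemma RCA0star_closed: "p \<in> RCA0star \<Longrightarrow> numbd p = 0 \<and> setbd p = 0"
proof -
  have "numbd exp_total = 0 \<and> setbd exp_total = 0"
    by (simp add: exp_total_def beta_def Let_def ball_def bex_def liftt_def)
  then show "p \<in> RCA0star \<Longrightarrow> numbd p = 0 \<and> setbd p = 0"
    unfolding RCA0star_def by auto
qed

lemma setbd_app [simp]: "setbd (app p ts m) = setbd p"
  by (simp add: app_def)

lemma setbd_instances [simp]:
  "setbd (Ind p) = setbd p" "setbd (Coll p) = setbd p" "setbd (GPHP p) = setbd p"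
  by (simp_all add: Ind_def Coll_def GPHP_def)

lemma closed_substf: "numbd p = 0 \<Longrightarrow> setbd p = 0 \<Longrightarrow> substf \<sigma> \<rho> p = p"
  using substf_cong[of p \<sigma> Var \<rho> id] by simp

lemma derives_AndD:
  assumes "\<Gamma> \<turnstile> And p q"
  shows "\<Gamma> \<turnstile> p" "\<Gamma> \<turnstile> q"
proof -
  have 1: "insert r \<Gamma> \<turnstile> And p q" for r by (rule derives_mono[OF assms]) blast
  have "insert (Neg p) \<Gamma> \<turnstile> Imp p (Neg q)"
  proof (rule ImpI, rule ImpI)
    have "insert q (insert p (insert (Neg p) \<Gamma>)) \<turnstile> Neg p" "insert q (insert p (insert (Neg p) \<Gamma>)) \<turnstile> p"
      by (rule Hyp, blast)+
    then show "insert q (insert p (insert (Neg p) \<Gamma>)) \<turnstile> Bot" by (rule ImpE)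
  qed
  with 1 have "insert (Neg p) \<Gamma> \<turnstile> Bot" by (rule ImpE)
  then show "\<Gamma> \<turnstile> p" by (rule Contr)
  have "insert (Neg q) \<Gamma> \<turnstile> Imp p (Neg q)" by (rule ImpI, rule Hyp) blast
  with 1 have "insert (Neg q) \<Gamma> \<turnstile> Bot" by (rule ImpE)
  then show "\<Gamma> \<turnstile> q" by (rule Contr)
qed

lemma derives_Conj: "\<Gamma> \<union> set ps \<turnstile> q \<Longrightarrow> \<Gamma> \<turnstile> Imp (Conj ps) q"
proof (induction ps arbitrary: q)
  case Nil
  then have "insert (Conj []) \<Gamma> \<turnstile> q" by - (rule derives_mono, auto)
  then show ?case by (rule ImpI)
next
  case (Cons p ps)
  have "insert p (\<Gamma> \<union> set ps) \<turnstile> q" using Cons.prems by simp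
  then have "\<Gamma> \<union> set ps \<turnstile> Imp p q" by (rule ImpI)
  then have "\<Gamma> \<turnstile> Imp (Conj ps) (Imp p q)" by (rule Cons.IH)
  then have *: "insert (Conj (p # ps)) \<Gamma> \<turnstile> Imp (Conj ps) (Imp p q)" by (rule derives_mono) blast
  have "insert (Conj (p # ps)) \<Gamma> \<turnstile> And p (Conj ps)" by (rule Hyp) simp
  note A = derives_AndD[OF this]
  from ImpE[OF ImpE[OF * A(2)] A(1)] show ?case by (rule ImpI)
qed

text \<open>A derivation uses finitely many hypotheses; those taken from the scheme \<open>B\<close>
  form the required conjunction.\<close>

lemma derives_Conj_of_inconsistent:
  assumes "\<Gamma> \<union> B \<union> {Neg q} \<turnstile> Bot"
  shows "\<exists>ps. set ps \<subseteq> B \<and> \<Gamma> \<turnstile> Imp (Conj ps) q"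
proof -
  from derives_finite[OF assms] obtain \<Delta> where
    \<Delta>: "\<Delta> \<subseteq> \<Gamma> \<union> B \<union> {Neg q}" "finite \<Delta>" "\<Delta> \<turnstile> Bot" by blast
  obtain ps where ps: "set ps = \<Delta> \<inter> B" using \<Delta>(2) finite_list[of "\<Delta> \<inter> B"] by auto
  have "insert (Neg q) (\<Gamma> \<union> set ps) \<turnstile> Bot"
    by (rule derives_mono[OF \<Delta>(3)]) (use \<Delta>(1) ps in auto)
  then have "\<Gamma> \<turnstile> Imp (Conj ps) q" by - (rule derives_Conj, rule Contr)
  with ps show ?thesis by (intro exI[of _ ps]) simp
qed

text \<open>The two forms of \<open>B\<close> are collection for one set, left free and read off
  from \<open>s\<close>, and collection for all sets. At most set variable 0 is free in the formulas
  involved, so index 1 is fresh.\<close>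

lemma RCA0star_model:
  assumes "B = BSigma n \<or> B = AllS ` BSigma n" and \<gamma>: "numbd \<gamma> = 0" "setbd \<gamma> \<le> 1"
    and con: "\<not> RCA0star \<union> B \<union> {Neg \<gamma>} \<turnstile> Bot"
  obtains zero one :: nat and add mul less mem and e s :: "nat \<Rightarrow> nat"
  where "arith_model zero one add mul less mem"
    and "\<And>p. p \<in> B \<Longrightarrow> two_sorted.ev zero one add mul less mem e s p"
    and "\<not> two_sorted.ev zero one add mul less mem e s \<gamma>"
proof -
  let ?\<Gamma> = "RCA0star \<union> B \<union> {Neg \<gamma>}"
  have fresh: "fresh 1 ?\<Gamma>"
    using RCA0star_closed assms(1) \<gamma> by (auto simp: fresh_def BSigma_def SigmaX_def)
  have S0: "cl (Neg (Eq (Add (Var 0) One) Zero)) \<in> ?\<Gamma>"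
    and Sinj: "cl (Imp (Eq (Add (Var 0) One) (Add (Var 1) One)) (Eq (Var 0) (Var 1))) \<in> ?\<Gamma>"
    using RCA0star_basic by (auto simp: basic_axioms_def)
  obtain zero one :: nat and add mul less mem and e s :: "nat \<Rightarrow> nat"
    where model: "\<And>p. p \<in> ?\<Gamma> \<Longrightarrow> two_sorted.ev zero one add mul less mem e s p"
    by (rule completeness[OF fresh con S0 Sinj]; blast)
  interpret two_sorted zero one add mul less mem .
  have "arith_model zero one add mul less mem"
  proof
    fix p e' s' assume p: "p \<in> RCA0star"
    then have "ev e s p" by (intro model) simp
    then show "ev e' s' p" using ev_cong[of p e e' s s'] RCA0star_closed[OF p] by simp
  qed
  moreover have "\<not> ev e s \<gamma>" using model[of "Neg \<gamma>"] by simp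
  ultimately show thesis using model by (intro that) auto
qed

text \<open>Only set variable 0 can occur, so the assignment of sets may be made constant, which is
  the form that set models use.\<close>

lemma (in two_sorted) ev_clN_const:
  assumes "setbd p \<le> 1"
  shows "ev e s (clN p) \<longleftrightarrow> (\<forall>e. ev e (\<lambda>_. s 0) p)"
proof -
  have "i = 0" if "i < setbd p" for i using that assms by simp
  then have "ev e s p = ev e (\<lambda>_. s 0) p" for e by (intro ev_cong) auto
  then show ?thesis by (simp add: ev_clN)
qed

text \<open>A scheme enters a derivation as hypothesis through a finite conjunction of instances.
  Failure of induction means that some instance fails, an infinite disjunction, so (b) is derived
  from the failure of each instance separately.\<close>

theorem theorem4p3:
  fixes k l :: nat
  assumes "k \<ge> 1" and "l \<ge> 1"
  shows "(\<forall>\<gamma> \<in> GPHPSigma l. \<exists>\<beta>s. set \<beta>s \<subseteq> BSigma l \<and>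
            RCA0star \<turnstile> AllS (Imp (Conj \<beta>s) \<gamma>)) \<and>
         (\<forall>\<gamma> \<in> GPHPSigma l. \<forall>\<iota> \<in> ISigma k. \<exists>\<beta>s. set \<beta>s \<subseteq> BSigma k \<and>
            RCA0star \<turnstile> Imp (And (Conj (map AllS \<beta>s)) (Neg (AllS \<iota>))) (AllS \<gamma>))"
proof (intro conjI ballI)
  obtain k' l' where kl: "k = Suc k'" "l = Suc l'" using assms by (metis Suc_le_D One_nat_def)
  {
    fix \<gamma> assume "\<gamma> \<in> GPHPSigma l"
    then obtain p where p: "p \<in> SigmaX l" "\<gamma> = clN (GPHP p)" by (auto simp: GPHPSigma_def)
    then have \<gamma>: "numbd \<gamma> = 0" "setbd \<gamma> \<le> 1" by (simp_all add: SigmaX_def)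
    have "RCA0star \<union> BSigma l \<union> {Neg \<gamma>} \<turnstile> Bot"
    proof (rule ccontr)
      assume "\<not> ?thesis"
      from RCA0star_model[OF disjI1[OF refl] \<gamma> this]
      obtain zero one :: nat and add mul less mem and e s :: "nat \<Rightarrow> nat"
        where M: "arith_model zero one add mul less mem"
          "\<And>p. p \<in> BSigma l \<Longrightarrow> two_sorted.ev zero one add mul less mem e s p"
          "\<not> two_sorted.ev zero one add mul less mem e s \<gamma>" by blast
      interpret arith_model zero one add mul less mem by (rule M)
      have "ev e' (\<lambda>_. s 0) (Coll q)" if "q \<in> SigmaX (Suc l')" for q e'
        using M(2)[of "clN (Coll q)"] that ev_clN_const[of "Coll q"]
        by (auto simp: BSigma_def kl SigmaX_def)
      then have "ev e' (\<lambda>_. s 0) (GPHP p)" for e' using p(1) kl by (intro GPHP_a) simp_all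
      then show False using M(3) p ev_clN_const[of "GPHP p"] by (simp add: SigmaX_def)
    qed
    from derives_Conj_of_inconsistent[OF this] obtain \<beta>s where
      \<beta>s: "set \<beta>s \<subseteq> BSigma l" "RCA0star \<turnstile> Imp (Conj \<beta>s) \<gamma>" by blast
    \<comment> \<open>The axioms are closed, so the set variable left free so far can be
      generalized.\<close>
    have "liftS ` RCA0star = RCA0star"
      using RCA0star_closed closed_substf by (force simp: liftS_def)
    with \<beta>s(2) have "RCA0star \<turnstile> AllS (Imp (Conj \<beta>s) \<gamma>)" by (intro AllSI) simp
    with \<beta>s(1) show "\<exists>\<beta>s. set \<beta>s \<subseteq> BSigma l \<and> RCA0star \<turnstile> AllS (Imp (Conj \<beta>s) \<gamma>)" by blast
  }
  {
    fix \<gamma> \<iota> assume "\<gamma> \<in> GPHPSigma l" "\<iota> \<in> ISigma k"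
    then obtain p q where p: "p \<in> SigmaX l" "\<gamma> = clN (GPHP p)" and q: "q \<in> SigmaX k" "\<iota> = clN (Ind q)"
      by (auto simp: GPHPSigma_def ISigma_def)
    \<comment> \<open>The failure of induction is moved into the conclusion, so that only instances
      of collection remain to be selected.\<close>
    let ?\<delta> = "Imp (Neg (AllS \<iota>)) (AllS \<gamma>)"
    have \<delta>: "numbd ?\<delta> = 0" "setbd ?\<delta> \<le> 1" using p q by (simp_all add: SigmaX_def)
    have "RCA0star \<union> AllS ` BSigma k \<union> {Neg ?\<delta>} \<turnstile> Bot"
    proof (rule ccontr)
      assume "\<not> ?thesis"
      from RCA0star_model[OF disjI2[OF refl] \<delta> this]
      obtain zero one :: nat and add mul less mem and e s :: "nat \<Rightarrow> nat"
        where M: "arith_model zero one add mul less mem"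
          "\<And>p. p \<in> AllS ` BSigma k \<Longrightarrow> two_sorted.ev zero one add mul less mem e s p"
          "\<not> two_sorted.ev zero one add mul less mem e s ?\<delta>" by blast
      interpret arith_model zero one add mul less mem by (rule M)
      have coll: "ev e' (\<lambda>_. X) (Coll r)" if r: "r \<in> SigmaX (Suc k')" for r X e'
      proof -
        have "clN (Coll r) \<in> BSigma k" using r kl by (auto simp: BSigma_def)
        then have "ev e s (AllS (clN (Coll r)))" by (intro M(2)) simp
        then have "ev e (case_nat X s) (clN (Coll r))" by simp
        then show ?thesis using r ev_clN_const[of "Coll r" e "case_nat X s"] by (simp add: SigmaX_def)
      qed
      from M(3) obtain X Y where X: "\<not> ev e (case_nat X s) \<gamma>" and Y: "\<not> ev e (case_nat Y s) \<iota>" by auto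
      from Y obtain e' where "\<not> ev e' (\<lambda>_. Y) (Ind q)"
        using q ev_clN_const[of "Ind q" e "case_nat Y s"] by (auto simp: SigmaX_def)
      from GPHP_b[OF coll _ this p(1)] have "ev e' (\<lambda>_. X) (GPHP p)" for e' using q(1) kl by simp
      then show False using X p ev_clN_const[of "GPHP p" e "case_nat X s"] by (simp add: SigmaX_def)
    qed
    from derives_Conj_of_inconsistent[OF this] obtain bs where
      bs: "set bs \<subseteq> AllS ` BSigma k" "RCA0star \<turnstile> Imp (Conj bs) ?\<delta>" by blast
    from bs(1) have "bs \<in> lists (AllS ` BSigma k)" by (simp add: in_lists_conv_set subset_iff)
    then obtain \<beta>s where \<beta>s: "set \<beta>s \<subseteq> BSigma k" "bs = map AllS \<beta>s"
      unfolding lists_image by (auto simp: subset_iff)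
    let ?A = "And (Conj bs) (Neg (AllS \<iota>))"
    have "insert ?A RCA0star \<turnstile> ?A" by (rule Hyp) simp
    note A = derives_AndD[OF this]
    have "insert ?A RCA0star \<turnstile> Imp (Conj bs) ?\<delta>" by (rule derives_mono[OF bs(2)]) blast
    from ImpE[OF ImpE[OF this A(1)] A(2)] have "RCA0star \<turnstile> Imp ?A (AllS \<gamma>)" by (rule ImpI)
    with \<beta>s show "\<exists>\<beta>s. set \<beta>s \<subseteq> BSigma k \<and>
        RCA0star \<turnstile> Imp (And (Conj (map AllS \<beta>s)) (Neg (AllS \<iota>))) (AllS \<gamma>)" by blast
  }
qed

end
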